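(* Let $n\ge1$ be an integer, let $\alpha=a/b\in(0,2)$ be a rational number with $a,b\in\mathbb{N}$ and $\gcd(a,b)=1$, and let $\nu>0$ be an irrational number. Then the power series $$A_{1;\alpha,\nu,n}(z)=\sum_{l=0}^\infty\frac{(-1)^l}{l!}\Gamma(\nu+l)\frac{\Gamma\left(\frac{n-\alpha(\nu+l)}{2}\right)}{\Gamma\left(\frac{\alpha(\nu+l)}{2}\right)}\frac{z^l}{2^{\alpha l}},$$ $$A_{2;\alpha,\nu,n}(z)=\frac2\alpha\sum_{j=0}^\infty\frac{(-1)^j}{j!}\frac{\Gamma\left(\frac{n+2j}{\alpha}\right)}{\Gamma\left(\frac{n+2j}{2}\right)}\Gamma\left(\frac{\alpha\nu-n-2j}{\alpha}\right)\frac{z^j}{2^{2j}}$$ converge absolutely for all $z\in\mathbb{C}$ (so they define entire functions), and for $r>0$ $$q_{\alpha,\nu,n}(r)=\frac{1}{2^n\pi^{\frac n2}\Gamma(\nu)}\left\{\frac{r^{\alpha\nu-n}}{2^{\alpha\nu-n}}A_{1;\alpha,\nu,n}(r^\alpha)+A_{2;\alpha,\nu,n}(r^2)\right\}.$$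
   Context: $\Vert\cdot\Vert$ is the Euclidean norm on $\mathbb{R}^n$. For an integer $n\ge1$, $\alpha\in(0,2]$, $\nu>0$, $p_{\alpha,\nu,n}$ denotes the probability density function on $\mathbb{R}^n$ whose characteristic function is $\int_{\mathbb{R}^n}e^{i\mathbf{x}\cdot\boldsymbol{t}}p_{\alpha,\nu,n}(\mathbf{x})\,d^n\mathbf{x}=(1+\Vert\boldsymbol{t}\Vert^\alpha)^{-\nu}$ for all $\boldsymbol{t}\in\mathbb{R}^n$. It is a radial function; one takes the version which is continuous on $\mathbb{R}^n\setminus\{\mathbf{0}\}$, and $q_{\alpha,\nu,n}(r)$, $r>0$, denotes the value of $p_{\alpha,\nu,n}(\mathbf{x})$ at points with $\Vert\mathbf{x}\Vert=r$. $\mathbb{N}=\{1,2,\ldots\}$. *)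

theory Defs
  imports "HOL-Probability.Probability" "HOL-Complex_Analysis.Complex_Analysis"
begin

text \<open>
  A version, continuous off the origin, of the probability density on Euclidean space (of dimension
  \<open>CARD('n)\<close>) with characteristic function \<open>(1 + \<parallel>t\<parallel>\<^sup>\<alpha>)\<^sup>-\<^sup>\<nu>\<close>.  Such a density may be unbounded near
  the origin, so the (real) value \<open>p 0\<close> is arbitrary apart from being nonnegative.
\<close>

definition linnik_density :: "real \<Rightarrow> real \<Rightarrow> (real ^ 'n \<Rightarrow> real) \<Rightarrow> bool" where
  "linnik_density \<alpha> \<nu> p \<longleftrightarrow>
     p \<in> borel_measurable borel \<and> (\<forall>x. 0 \<le> p x) \<and>
     prob_space (density lborel (\<lambda>x. ennreal (p x))) \<and>
     (\<forall>t. (CLINT x|lborel. iexp (x \<bullet> t) * complex_of_real (p x)) =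
            complex_of_real ((1 + norm t powr \<alpha>) powr (- \<nu>))) \<and>
     continuous_on (- {0}) p"

text \<open>
  The common value of \<open>p\<close> at the points of norm \<open>r\<close>; unspecified if \<open>p\<close> is not constant on that sphere.
\<close>

definition radial_value :: "(real ^ 'n \<Rightarrow> real) \<Rightarrow> real \<Rightarrow> real" where
  "radial_value p r = (THE y. p ` {x. norm x = r} = {y})"

text \<open>
  The library's \<open>Gamma\<close> is total, with value 0 at the nonpositive integers.  No such argument occurs
  below when \<open>\<alpha> > 0\<close> is rational and \<open>\<nu> > 0\<close> is irrational.
\<close>

definition A1_term :: "real \<Rightarrow> real \<Rightarrow> nat \<Rightarrow> complex \<Rightarrow> nat \<Rightarrow> complex" where
  "A1_term \<alpha> \<nu> n z l =
     complex_of_real ((- 1) ^ l / fact l * Gamma (\<nu> + real l)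
        * (Gamma ((real n - \<alpha> * (\<nu> + real l)) / 2) / Gamma (\<alpha> * (\<nu> + real l) / 2)))
     * (z ^ l / complex_of_real (2 powr (\<alpha> * real l)))"

definition A1 :: "real \<Rightarrow> real \<Rightarrow> nat \<Rightarrow> complex \<Rightarrow> complex" where
  "A1 \<alpha> \<nu> n z = (\<Sum>l. A1_term \<alpha> \<nu> n z l)"

definition A2_term :: "real \<Rightarrow> real \<Rightarrow> nat \<Rightarrow> complex \<Rightarrow> nat \<Rightarrow> complex" where
  "A2_term \<alpha> \<nu> n z j =
     complex_of_real ((- 1) ^ j / fact j
        * (Gamma ((real n + 2 * real j) / \<alpha>) / Gamma ((real n + 2 * real j) / 2))
        * Gamma ((\<alpha> * \<nu> - real n - 2 * real j) / \<alpha>))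
     * (z ^ j / 2 ^ (2 * j))"

definition A2 :: "real \<Rightarrow> real \<Rightarrow> nat \<Rightarrow> complex \<Rightarrow> complex" where
  "A2 \<alpha> \<nu> n z = complex_of_real (2 / \<alpha>) * (\<Sum>j. A2_term \<alpha> \<nu> n z j)"

end

theory Submission
  imports Defs
begin

text \<open>
  Test the density \<open>p\<close> against Gaussians \<open>exp (- s * (norm x)\<^sup>2)\<close>.  Both series gain a factor
  \<open>Gamma\<close> cancelling one in their denominators, stay absolutely convergent, and may be integrated
  termwise, so no decay of the (oscillating) sum at infinity has to be known.  On the Fourier side the same
  integral is a multiple of \<open>\<integral> (1 + v) powr (- \<nu>) * exp (- c * v powr (2/\<alpha>)) * v powr (n/\<alpha> - 1)\<close>
  over \<open>v > 0\<close>, where \<open>c = 1 / (4 * s)\<close>.  Splitting it at \<open>v = 2\<close>, expanding the exponential below and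
  the binomial above, gives the two series: the boundary contributions cancel by the analytically
  continued Beta integral and incomplete Gamma function.  These two identities also bound the Gamma
  quotients, so that Stirling's formula is not needed; rationality of \<open>\<alpha>\<close> and irrationality of \<open>\<nu>\<close>
  keep all denominators away from zero.  Finally, a radial function that is continuous off the origin
  and whose Gaussian integrals all vanish is zero there, by Weierstrass approximation in the variable
  \<open>exp (- (norm x)\<^sup>2)\<close>.
\<close>

section \<open>Radial integrals and Gaussians\<close>

text \<open>Put \<open>\<mu> = n / \<alpha>\<close> and \<open>\<beta> = 2 / \<alpha>\<close>. The
  l-th binomial term times the j-th exponential term leaves the exponent
  \<open>\<mu> - \<nu> - l + \<beta> * j\<close>, and integrating up to or from the cut divides by
  it. Each half of the split integral is therefore a sum of complete Gamma factors minus a double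
  boundary sum with these denominators. The two double sums are opposite, but one is produced as
  l-outside-j and the other as j-outside-l. Exchanging the order takes absolute convergence, for
  which nonzero denominators are not enough: a uniform lower bound \<delta> is wanted. This
  small-denominator problem is where the arithmetic of \<alpha> and \<nu> enters. Integer shifts of
  a single Gaussian parameter suffice for the uniqueness argument, because
  \<open>exp (- k * (norm x)^2)\<close> is the k-th power of \<open>exp (- (norm x)^2)\<close>:
  vanishing Gaussian integrals are vanishing moments in that bounded variable. Radial symmetry is
  not part of \<open>linnik_density\<close>; it is derived from the characteristic function by the
  same moment argument.\<close>

lemma measure_power_law_eq_density:
  fixes N :: "real measure" and C k :: real
  assumes sets: "sets N = sets borel" and k: "k > 0" and C: "C \<ge> 0"
    and em: "\<And>a. a \<ge> 0 \<Longrightarrow> emeasure N {..a} = ennreal (C * a powr k)"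
  shows "N = density lborel (\<lambda>v. ennreal (indicator {0<..} v * (C * k * v powr (k - 1))))"
proof (rule measure_eqI_generator_eq[where E = "range (\<lambda>a. {..a})" and \<Omega> = UNIV and A = "\<lambda>i. {..real i}"])
  let ?M = "density lborel (\<lambda>v. ennreal (indicator {0<..} v * (C * k * v powr (k - 1))))"
  have pos: "emeasure ?M {..a} = ennreal (C * a powr k)" if a: "a \<ge> 0" for a
  proof -
    have "((\<lambda>v. C * k * v powr (k - 1)) has_integral (C * k * (a powr k / k))) {0..a}"
      using has_integral_powr_from_0[of "k - 1" a] k a by (intro has_integral_mult_right) auto
    hence "((\<lambda>v. C * k * v powr (k - 1)) has_integral (C * a powr k)) {0..a}"
      using k by simp
    from nn_integral_has_integral_lebesgue[OF _ this] C k
    have 1: "(\<integral>\<^sup>+v. ennreal (indicator {0..a} v * (C * k * v powr (k - 1))) \<partial>lborel) = ennreal (C * a powr k)"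
      by simp
    have "emeasure ?M {..a} = (\<integral>\<^sup>+v. ennreal (indicator {0<..} v * (C * k * v powr (k - 1))) * indicator {..a} v \<partial>lborel)"
      by (subst emeasure_density) auto
    also have "\<dots> = (\<integral>\<^sup>+v. ennreal (indicator {0..a} v * (C * k * v powr (k - 1))) \<partial>lborel)"
      by (intro nn_integral_cong) (auto simp: indicator_def)
    finally show ?thesis using 1 by simp
  qed
  show "Int_stable (range (\<lambda>a::real. {..a}))"
    by (auto simp: Int_stable_def)
  show "sets N = sigma_sets UNIV (range (\<lambda>a. {..a}))"
    unfolding sets by (simp add: borel_eq_atMost)
  show "sets ?M = sigma_sets UNIV (range (\<lambda>a. {..a}))"
    by (simp add: borel_eq_atMost)
  show "(\<Union>i. {..real i}) = UNIV"
    using real_arch_simple by auto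
  show "emeasure N {..real i} \<noteq> \<infinity>" for i
    by (simp add: em)
  show "emeasure N X = emeasure ?M X" if X: "X \<in> range (\<lambda>a. {..a})" for X
  proof -
    obtain a where a: "X = {..a}" using X by auto
    show ?thesis
    proof (cases "a \<ge> 0")
      case True thus ?thesis using a em pos by simp
    next
      case False
      \<comment> \<open>Half-lines ending below 0 lie in \<open>{..0}\<close>, whose mass is 0 for
        both measures because \<open>0 powr k = 0\<close>.\<close>
      have "emeasure N {..a} \<le> emeasure N {..0}" "emeasure ?M {..a} \<le> emeasure ?M {..0}"
        using False by (auto intro!: emeasure_mono simp: sets)
      thus ?thesis using a em[of 0] pos[of 0] k by simp
    qed
  qed
qed auto

text \<open>The preimage of \<open>{..a}\<close> is the ball of radius
  \<open>a powr (1/\<tau>)\<close>, so its volume is a power law in a, and a measure with such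
  values on half-lines is known.\<close>

lemma distr_norm_powr:
  assumes \<tau>: "\<tau> > 0"
  defines "n \<equiv> real DIM('a::euclidean_space)"
  shows "distr (lborel :: 'a measure) borel (\<lambda>x. norm x powr \<tau>) =
    density lborel (\<lambda>v. ennreal (indicator {0<..} v * (unit_ball_vol n * (n / \<tau>) * v powr (n / \<tau> - 1))))"
proof (rule measure_power_law_eq_density)
  show "n / \<tau> > 0" using \<tau> by (simp add: n_def)
  show "emeasure (distr (lborel :: 'a measure) borel (\<lambda>x. norm x powr \<tau>)) {..a} = ennreal (unit_ball_vol n * a powr (n / \<tau>))"
    if a: "a \<ge> 0" for a
  proof -
    have 1: "norm (x::'a) powr \<tau> \<le> a \<longleftrightarrow> norm x \<le> a powr (1 / \<tau>)" for x
    proof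
      assume "norm x powr \<tau> \<le> a"
      hence "(norm x powr \<tau>) powr (1/\<tau>) \<le> a powr (1 / \<tau>)"
        using \<tau> by (intro powr_mono2) auto
      thus "norm x \<le> a powr (1 / \<tau>)" using \<tau> by (simp add: powr_powr)
    next
      assume "norm x \<le> a powr (1 / \<tau>)"
      hence "norm x powr \<tau> \<le> (a powr (1 / \<tau>)) powr \<tau>"
        using \<tau> by (intro powr_mono2) auto
      thus "norm x powr \<tau> \<le> a" using \<tau> a by (simp add: powr_powr)
    qed
    hence 2: "(\<lambda>x::'a. norm x powr \<tau>) -` {..a} \<inter> space lborel = cball 0 (a powr (1/\<tau>))"
      by auto
    have "emeasure (distr (lborel :: 'a measure) borel (\<lambda>x. norm x powr \<tau>)) {..a} = emeasure lborel (cball (0::'a) (a powr (1/\<tau>)))"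
      by (subst emeasure_distr) (use 2 in auto)
    also have "\<dots> = ennreal (unit_ball_vol n * (a powr (1/\<tau>)) ^ DIM('a))"
      by (subst emeasure_cball) (auto simp: n_def)
    also have "(a powr (1/\<tau>)) ^ DIM('a) = a powr (n / \<tau>)"
      using a \<tau> by (cases "a = 0") (auto simp: n_def powr_realpow[symmetric] powr_powr)
    finally show ?thesis .
  qed
qed (auto simp: n_def)

text \<open>Polar coordinates with \<open>v = norm x powr \<tau>\<close> as radial variable, without
  a surface measure. The choice \<tau> = \<alpha> produces the factor \<open>1 + v\<close> on the
  Fourier side, \<tau> = 2 serves Gaussians, and in dimension one the formula replaces a power
  substitution.\<close>

lemma
  fixes f :: "real \<Rightarrow> real"
  assumes \<tau>: "\<tau> > 0" and f[measurable]: "f \<in> borel_measurable borel"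
  defines "n \<equiv> real DIM('a::euclidean_space)"
  defines "c \<equiv> unit_ball_vol n * (n / \<tau>)"
  shows integrable_norm_powr: "integrable (lborel :: 'a measure) (\<lambda>x. f (norm x powr \<tau>)) \<longleftrightarrow>
      integrable lborel (\<lambda>v. indicator {0<..} v * (f v * v powr (n / \<tau> - 1)))"
    and integral_norm_powr: "(LINT x|(lborel :: 'a measure). f (norm x powr \<tau>)) =
      c * (LINT v|lborel. indicator {0<..} v * (f v * v powr (n / \<tau> - 1)))"
proof -
  have c: "c > 0" using \<tau> by (auto simp: c_def n_def)
  have eq: "indicator {0<..} v * (unit_ball_vol n * (n / \<tau>) * v powr (n / \<tau> - 1)) * f v =
      c * (indicator {0<..} v * (f v * v powr (n / \<tau> - 1)))" for v
    by (simp add: c_def)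
  have nn: "0 \<le> indicator {0<..} v * (unit_ball_vol n * (n / \<tau>) * v powr (n / \<tau> - 1))" for v
    using mult_nonneg_nonneg[OF less_imp_le[OF c], of "v powr (n / \<tau> - 1)"]
    by (auto simp: c_def indicator_def mult_ac)
  have "integrable (lborel :: 'a measure) (\<lambda>x. f (norm x powr \<tau>)) \<longleftrightarrow>
      integrable (distr (lborel :: 'a measure) borel (\<lambda>x. norm x powr \<tau>)) f"
    by (subst integrable_distr_eq) auto
  also have "\<dots> \<longleftrightarrow> integrable lborel (\<lambda>v. c * (indicator {0<..} v * (f v * v powr (n / \<tau> - 1))))"
    unfolding distr_norm_powr[OF \<tau>] n_def[symmetric]
    by (subst integrable_real_density) (use nn eq in auto)
  also have "\<dots> \<longleftrightarrow> integrable lborel (\<lambda>v. indicator {0<..} v * (f v * v powr (n / \<tau> - 1)))"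
    using c by simp
  finally show "integrable (lborel :: 'a measure) (\<lambda>x. f (norm x powr \<tau>)) \<longleftrightarrow>
      integrable lborel (\<lambda>v. indicator {0<..} v * (f v * v powr (n / \<tau> - 1)))" .
  have "(LINT x|(lborel :: 'a measure). f (norm x powr \<tau>)) =
      (LINT v|distr (lborel :: 'a measure) borel (\<lambda>x. norm x powr \<tau>). f v)"
    by (subst integral_distr) auto
  also have "\<dots> = (LINT v|lborel. c * (indicator {0<..} v * (f v * v powr (n / \<tau> - 1))))"
    unfolding distr_norm_powr[OF \<tau>] n_def[symmetric]
    by (subst integral_real_density) (use nn eq in auto)
  finally show "(LINT x|(lborel :: 'a measure). f (norm x powr \<tau>)) =
      c * (LINT v|lborel. indicator {0<..} v * (f v * v powr (n / \<tau> - 1)))"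
    by simp
qed

section \<open>Gamma integrals and the Fourier transform of a Gaussian\<close>

lemma has_bochner_integral_Gamma:
  fixes s a :: real
  assumes a: "a > 0" and s: "s > 0"
  shows "has_bochner_integral lborel (\<lambda>v. indicator {0<..} v * (exp (- a * v) * v powr (s - 1))) (Gamma s * a powr (- s))"
proof -
  have "((\<lambda>t. t powr (s - 1) / exp t) has_integral Gamma s) {0..}"
    by (rule Gamma_integral_real[OF s])
  from nn_integral_has_integral_lebesgue[OF _ this]
  have 1: "(\<integral>\<^sup>+v. ennreal (indicator {0..} v * (v powr (s - 1) / exp v)) \<partial>lborel) = ennreal (Gamma s)"
    by simp
  have "has_bochner_integral lborel (\<lambda>v::real. indicator {0..} v * (v powr (s - 1) / exp v)) (Gamma s)"
    by (rule has_bochner_integral_nn_integral) (use 1 s in \<open>auto simp: Gamma_real_pos less_imp_le\<close>)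
  hence "has_bochner_integral lborel (\<lambda>v::real. indicator {0..} (0 + a * v) * ((0 + a * v) powr (s - 1) / exp (0 + a * v))) (Gamma s /\<^sub>R \<bar>a\<bar>)"
    by (subst lborel_has_bochner_integral_real_affine_iff[symmetric]) (use a in auto)
  hence "has_bochner_integral lborel (\<lambda>v::real. a powr (- (s - 1)) * (indicator {0..} (0 + a * v) * ((0 + a * v) powr (s - 1) / exp (0 + a * v)))) (a powr (- (s - 1)) * (Gamma s /\<^sub>R \<bar>a\<bar>))"
    by (intro has_bochner_integral_mult_right) auto
  also have "a powr (- (s - 1)) * (Gamma s /\<^sub>R \<bar>a\<bar>) = Gamma s * a powr (- s)"
    using a powr_add[of a "1" "-s"] by (simp add: field_simps)
  also have "(\<lambda>v::real. a powr (- (s - 1)) * (indicator {0..} (0 + a * v) * ((0 + a * v) powr (s - 1) / exp (0 + a * v)))) =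
     (\<lambda>v. indicator {0<..} v * (exp (- a * v) * v powr (s - 1)))"
  proof
    fix v :: real
    show "a powr (- (s - 1)) * (indicator {0..} (0 + a * v) * ((0 + a * v) powr (s - 1) / exp (0 + a * v))) =
      indicator {0<..} v * (exp (- a * v) * v powr (s - 1))"
    proof (cases "v > 0")
      case True
      have "a powr (- (s - 1)) * ((a * v) powr (s - 1) / exp (a * v)) = exp (- a * v) * v powr (s - 1)"
        using True a by (simp add: powr_mult exp_minus field_simps powr_minus[of a "s - 1"] del: minus_diff_eq)
      thus ?thesis using True a by simp
    next
      case False
      thus ?thesis using a by (auto simp: indicator_def zero_le_mult_iff)
    qed
  qed
  finally show ?thesis .
qed

lemma
  fixes s :: real and t :: "'a::euclidean_space"
  assumes s: "s > 0"
  shows gaussian_fourier_integrable: "integrable lborel (\<lambda>x::'a. iexp (x \<bullet> t) * exp (- s * (norm x)\<^sup>2))"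
    and gaussian_fourier: "(CLINT x|lborel. iexp (x \<bullet> t) * complex_of_real (exp (- s * (norm x)\<^sup>2)))
      = complex_of_real ((pi / s) powr (DIM('a) / 2) * exp (- (norm t)\<^sup>2 / (4 * s)))"
proof -
  have one: "has_bochner_integral lborel (\<lambda>x::real. iexp (x * t) * complex_of_real (exp (- s * x\<^sup>2)))
     (complex_of_real (sqrt (pi / s) * exp (- t\<^sup>2 / (4 * s))))" for t :: real
  proof -
    \<comment> \<open>Scaling by \<open>sqrt (2 * s)\<close> turns \<open>exp (- y^2 / 2)\<close>
      into \<open>exp (- s * x^2)\<close>, so the characteristic function of the standard normal law
      gives the one-dimensional case.\<close>
    let ?c = "sqrt (2 * s)"
    let ?t = "t / ?c"
    have "(CLINT x|std_normal_distribution. iexp (?t * x)) = complex_of_real (exp (- ?t\<^sup>2 / 2))"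
      using fun_cong[OF char_std_normal_distribution, of ?t] unfolding char_def .
    moreover have "(CLINT x|std_normal_distribution. iexp (?t * x)) = (CLINT x|lborel. std_normal_density x *\<^sub>R iexp (?t * x))"
      by (subst integral_density) (auto simp: normal_density_nonneg)
    ultimately have I: "(CLINT x|lborel. std_normal_density x *\<^sub>R iexp (?t * x)) = complex_of_real (exp (- ?t\<^sup>2 / 2))"
      by simp
    have J: "integrable lborel (\<lambda>x. std_normal_density x *\<^sub>R iexp (?t * x))"
    proof (rule Bochner_Integration.integrable_bound[where f = std_normal_density])
      show "integrable lborel std_normal_density" by (rule integrable_normal_density) simp
    qed (auto intro!: AE_I2)
    have "has_bochner_integral lborel (\<lambda>x. std_normal_density x *\<^sub>R iexp (?t * x)) (complex_of_real (exp (- ?t\<^sup>2 / 2)))"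
      using I J by (simp add: has_bochner_integral_iff)
    hence "has_bochner_integral lborel (\<lambda>x. std_normal_density (0 + ?c * x) *\<^sub>R iexp (?t * (0 + ?c * x))) (complex_of_real (exp (- ?t\<^sup>2 / 2)) /\<^sub>R \<bar>?c\<bar>)"
      by (subst lborel_has_bochner_integral_real_affine_iff[symmetric]) (use s in auto)
    hence "has_bochner_integral lborel (\<lambda>x. complex_of_real (sqrt (2 * pi)) * (std_normal_density (0 + ?c * x) *\<^sub>R iexp (?t * (0 + ?c * x)))) (complex_of_real (sqrt (2 * pi)) * (complex_of_real (exp (- ?t\<^sup>2 / 2)) /\<^sub>R \<bar>?c\<bar>))"
      by (intro has_bochner_integral_mult_right) auto
    also have "(\<lambda>x. complex_of_real (sqrt (2 * pi)) * (std_normal_density (0 + ?c * x) *\<^sub>R iexp (?t * (0 + ?c * x)))) =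
       (\<lambda>x::real. iexp (x * t) * complex_of_real (exp (- s * x\<^sup>2)))"
    proof
      fix x :: real
      have 1: "?t * (0 + ?c * x) = x * t" using s by simp
      have 2: "sqrt (2 * pi) * std_normal_density (0 + ?c * x) = exp (- s * x\<^sup>2)"
        using s by (simp add: std_normal_density_def power_mult_distrib)
      show "complex_of_real (sqrt (2 * pi)) * (std_normal_density (0 + ?c * x) *\<^sub>R iexp (?t * (0 + ?c * x))) =
         iexp (x * t) * complex_of_real (exp (- s * x\<^sup>2))"
        unfolding 1 2[symmetric] scaleR_conv_of_real of_real_mult by (simp add: mult_ac)
    qed
    also have "complex_of_real (sqrt (2 * pi)) * (complex_of_real (exp (- ?t\<^sup>2 / 2)) /\<^sub>R \<bar>?c\<bar>) = complex_of_real (sqrt (pi / s) * exp (- t\<^sup>2 / (4 * s)))"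
    proof -
      have "sqrt (2 * pi) / ?c = sqrt (pi / s)"
        by (simp add: real_sqrt_divide[symmetric])
      moreover have "- ?t\<^sup>2 / 2 = - t\<^sup>2 / (4 * s)" using s by (simp add: power_divide)
      ultimately show ?thesis using s
        by (simp add: scaleR_conv_of_real field_simps flip: of_real_mult of_real_divide)
    qed
    finally show ?thesis .
  qed
  \<comment> \<open>Lebesgue measure is the image of the product over \<open>Basis\<close> under the
    coordinate sum, and the integrand is a product of functions of single coordinates, so the
    integral factorizes.\<close>
  interpret product_sigma_finite "\<lambda>_::'a. lborel :: real measure" ..
  have prod: "iexp (x \<bullet> t) * complex_of_real (exp (- s * (norm x)\<^sup>2)) =
     (\<Prod>b\<in>Basis. iexp ((x \<bullet> b) * (t \<bullet> b)) * complex_of_real (exp (- s * (x \<bullet> b)\<^sup>2)))" for x :: 'a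
  proof -
    have 1: "x \<bullet> t = (\<Sum>b\<in>Basis. (x \<bullet> b) * (t \<bullet> b))" by (rule euclidean_inner)
    have 2: "(norm x)\<^sup>2 = (\<Sum>b\<in>Basis. (x \<bullet> b)\<^sup>2)"
      unfolding power2_norm_eq_inner by (subst euclidean_inner) (simp add: power2_eq_square)
    show ?thesis
      unfolding 1 2 by (simp add: prod.distrib exp_sum[symmetric] sum_distrib_left of_real_prod[symmetric] sum_negf[symmetric] flip: exp_of_real)
  qed
  have comp: "(\<Sum>b\<in>Basis. g b *\<^sub>R b) \<bullet> c = g c" if "c \<in> Basis" for g and c :: 'a
    using that by (simp add: inner_sum_left inner_Basis if_distrib sum.delta cong: if_cong)
  let ?f = "\<lambda>b x::real. iexp (x * (t \<bullet> b)) * complex_of_real (exp (- s * x\<^sup>2))"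
  have int: "integrable lborel (?f b)" for b using one[of "t \<bullet> b"] by (simp add: has_bochner_integral_iff)
  have "integrable (\<Pi>\<^sub>M b\<in>Basis. lborel) (\<lambda>x. \<Prod>b\<in>Basis. ?f b (x b))"
    by (rule product_integrable_prod) (use int in auto)
  hence "has_bochner_integral (\<Pi>\<^sub>M b\<in>Basis. lborel) (\<lambda>x. \<Prod>b\<in>Basis. ?f b (x b)) (\<Prod>b\<in>Basis. integral\<^sup>L lborel (?f b))"
    using product_integral_prod[of Basis ?f] int by (simp add: has_bochner_integral_iff)
  also have "(\<Prod>b\<in>Basis. integral\<^sup>L lborel (?f b)) = (\<Prod>b\<in>Basis. complex_of_real (sqrt (pi / s) * exp (- (t \<bullet> b)\<^sup>2 / (4 * s))))"
    using one by (intro prod.cong refl has_bochner_integral_integral_eq) auto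
  also have "\<dots> = complex_of_real (sqrt (pi / s) ^ DIM('a) * (\<Prod>b\<in>Basis. exp (- (t \<bullet> b)\<^sup>2 / (4 * s))))"
    by (simp add: prod.distrib)
  also have "(\<Prod>b\<in>Basis. exp (- (t \<bullet> b)\<^sup>2 / (4 * s))) = exp (- (norm t)\<^sup>2 / (4 * s))"
    unfolding power2_norm_eq_inner by (subst (2) euclidean_inner)
      (simp add: exp_sum[symmetric] power2_eq_square sum_divide_distrib sum_negf)
  also have "sqrt (pi / s) ^ DIM('a) = (pi / s) powr (DIM('a) / 2)"
    using s by (simp add: powr_realpow[symmetric] powr_half_sqrt[symmetric] powr_powr)
  also have "(\<lambda>x. \<Prod>b\<in>Basis. ?f b (x b)) = (\<lambda>g. iexp ((\<Sum>b\<in>Basis. g b *\<^sub>R b) \<bullet> t) * complex_of_real (exp (- s * (norm (\<Sum>b\<in>Basis. g b *\<^sub>R b))\<^sup>2)))"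
    unfolding prod by (intro ext prod.cong refl) (simp add: comp)
  finally have fin: "has_bochner_integral (\<Pi>\<^sub>M b\<in>Basis. lborel) (\<lambda>g. iexp ((\<Sum>b\<in>Basis. g b *\<^sub>R b) \<bullet> t) * complex_of_real (exp (- s * (norm (\<Sum>b\<in>Basis. g b *\<^sub>R b))\<^sup>2)))
    (complex_of_real ((pi / s) powr (DIM('a) / 2) * exp (- (norm t)\<^sup>2 / (4 * s))))" .
  have "has_bochner_integral lborel (\<lambda>x::'a. iexp (x \<bullet> t) * complex_of_real (exp (- s * (norm x)\<^sup>2)))
    (complex_of_real ((pi / s) powr (DIM('a) / 2) * exp (- (norm t)\<^sup>2 / (4 * s))))"
    unfolding lborel_eq[where ?'a = 'a] by (rule has_bochner_integral_distr) (use fin in \<open>auto\<close>)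
  thus "integrable lborel (\<lambda>x::'a. iexp (x \<bullet> t) * exp (- s * (norm x)\<^sup>2))"
    "(CLINT x|lborel. iexp (x \<bullet> t) * complex_of_real (exp (- s * (norm x)\<^sup>2)))
      = complex_of_real ((pi / s) powr (DIM('a) / 2) * exp (- (norm t)\<^sup>2 / (4 * s)))"
    by (simp_all add: has_bochner_integral_iff)
qed

section \<open>Series and integrals over half-lines\<close>

lemma has_bochner_integral_of_has_integral_nonneg:
  fixes f :: "real \<Rightarrow> real"
  assumes [measurable]: "f \<in> borel_measurable borel" "S \<in> sets borel"
    and nn: "\<And>x. x \<in> S \<Longrightarrow> f x \<ge> 0" and I: "(f has_integral I) S"
  shows "has_bochner_integral lborel (\<lambda>x. indicator S x * f x) I"
proof -
  have I0: "I \<ge> 0" using has_integral_nonneg[OF I nn] by simp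
  have "(\<integral>\<^sup>+x. ennreal (indicator S x * f x) \<partial>lborel) = ennreal I"
    using nn_integral_has_integral_lebesgue[OF nn I] by simp
  thus ?thesis using I0 nn by (intro has_bochner_integral_nn_integral) (auto simp: indicator_def)
qed

text \<open>Antiderivatives yield integrals over closed sets, while \<open>{0<..2}\<close> and
  \<open>{2<..}\<close> are wanted because they partition \<open>{0<..}\<close>. The sets differ in
  one point, a null set.\<close>

lemma has_bochner_integral_indicator_change:
  fixes f :: "real \<Rightarrow> real"
  assumes "has_bochner_integral lborel (\<lambda>x. indicator S x * f x) I"
    and "f \<in> borel_measurable borel" "T \<in> sets borel"
    and "\<And>x. x \<noteq> a \<Longrightarrow> x \<in> S \<longleftrightarrow> x \<in> T"
  shows "has_bochner_integral lborel (\<lambda>x. indicator T x * f x) I"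
proof (subst has_bochner_integral_cong_AE)
  have "AE x in lborel. x \<noteq> a" using AE_lborel_singleton[of a] by simp
  thus "AE x in lborel. indicator T x * f x = indicator S x * f x"
    by eventually_elim (use assms(4) in \<open>auto simp: indicator_def\<close>)
  show "(\<lambda>x. indicator S x * f x) \<in> borel_measurable lborel"
    using assms(1) by (auto dest: borel_measurable_has_bochner_integral)
  show "(\<lambda>x. indicator T x * f x) \<in> borel_measurable lborel"
    using assms(2,3) by measurable
qed (rule assms(1))

lemma has_bochner_integral_powr_lower:
  fixes s \<theta> :: real
  assumes "s > 0" "\<theta> > 0"
  shows "has_bochner_integral lborel (\<lambda>v. indicator {0<..\<theta>} v * v powr (s - 1)) (\<theta> powr s / s)"
proof (rule has_bochner_integral_indicator_change[where S = "{0..\<theta>}" and a = 0])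
  have "((\<lambda>v. v powr (s - 1)) has_integral (\<theta> powr s / s)) {0..\<theta>}"
    using has_integral_powr_from_0[of "s - 1" \<theta>] assms by simp
  thus "has_bochner_integral lborel (\<lambda>v. indicator {0..\<theta>} v * v powr (s - 1)) (\<theta> powr s / s)"
    by (intro has_bochner_integral_of_has_integral_nonneg) auto
qed auto

lemma has_bochner_integral_powr_upper:
  fixes s \<theta> :: real
  assumes "s > 0" "\<theta> > 0"
  shows "has_bochner_integral lborel (\<lambda>v. indicator {\<theta><..} v * v powr (- s - 1)) (\<theta> powr (- s) / s)"
proof (rule has_bochner_integral_indicator_change[where S = "{\<theta>..}" and a = \<theta>])
  have "((\<lambda>v. v powr (- s - 1)) has_integral (\<theta> powr (- s) / s)) {\<theta>..}"
    using has_integral_powr_to_inf[of "- s - 1" \<theta>] assms by simp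
  thus "has_bochner_integral lborel (\<lambda>v. indicator {\<theta>..} v * v powr (- s - 1)) (\<theta> powr (- s) / s)"
    by (intro has_bochner_integral_of_has_integral_nonneg) auto
qed auto

text \<open>Fubini for counting measure: domination by a product of two summable sequences makes the
  double family absolutely summable. It exchanges the order in the boundary double sum.\<close>

lemma suminf_swap_of_product_bound:
  fixes f :: "nat \<Rightarrow> nat \<Rightarrow> real"
  assumes bound: "\<And>l j. \<bar>f l j\<bar> \<le> A l * B j" and A: "summable A" and B: "summable B"
    and B0: "\<And>j. B j \<ge> 0"
  shows "(\<Sum>l. \<Sum>j. f l j) = (\<Sum>j. \<Sum>l. f l j)"
    and "summable (\<lambda>l. \<Sum>j. f l j)" and "summable (\<lambda>j. \<Sum>l. f l j)"
proof -
  have s1: "summable (\<lambda>j. \<bar>f l j\<bar>)" for l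
    by (rule summable_comparison_test'[OF summable_mult[OF B, of "A l"]]) (simp add: bound)
  have s2: "summable (\<lambda>l. \<bar>f l j\<bar>)" for j
    by (rule summable_comparison_test'[OF summable_mult2[OF A, of "B j"]]) (simp add: bound)
  have i: "integrable (count_space UNIV) (f l)" for l
    using s1 by (simp add: integrable_count_space_nat_iff)
  have "(\<Sum>j. \<bar>f l j\<bar>) \<le> A l * (\<Sum>j. B j)" for l
    using suminf_le[OF bound s1 summable_mult[OF B]] suminf_mult[OF B] by simp
  moreover have "(\<Sum>j. \<bar>f l j\<bar>) \<ge> 0" for l by (rule suminf_nonneg[OF s1]) simp
  ultimately have s3: "summable (\<lambda>l. \<Sum>j. \<bar>f l j\<bar>)"
    by (intro summable_comparison_test'[OF summable_mult2[OF A, of "\<Sum>j. B j"]]) simp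
  have n: "(\<integral>j. norm (f l j) \<partial>count_space UNIV) = (\<Sum>j. \<bar>f l j\<bar>)" for l
    using i[of l] by (subst integral_count_space_nat) auto
  have sums: "(\<lambda>l. \<integral>j. f l j \<partial>count_space UNIV) sums (\<integral>j. (\<Sum>l. f l j) \<partial>count_space UNIV)"
    by (rule sums_integral) (use i s2 s3 n in auto)
  have int: "integrable (count_space UNIV) (\<lambda>j. \<Sum>l. f l j)"
    by (rule integrable_suminf) (use i s2 s3 n in auto)
  have "(\<lambda>l. \<Sum>j. f l j) sums (\<Sum>j. \<Sum>l. f l j)"
    using sums i int by (simp add: integral_count_space_nat)
  thus "(\<Sum>l. \<Sum>j. f l j) = (\<Sum>j. \<Sum>l. f l j)" "summable (\<lambda>l. \<Sum>j. f l j)"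
    by (auto simp: sums_iff)
  show "summable (\<lambda>j. \<Sum>l. f l j)"
    using int by (auto simp: integrable_count_space_nat_iff intro: summable_norm_cancel)
qed

text \<open>The binomial series has radius of convergence at least 1, and 1/2 is the value of
  \<open>1 / v\<close> at the cut \<open>v = 2\<close>.\<close>

lemma summable_abs_gbinomial:
  fixes a :: real
  shows "summable (\<lambda>l. \<bar>a gchoose l\<bar> * (1/2) ^ l)"
proof -
  have "conv_radius (\<lambda>n. a gchoose n) \<ge> 1"
    unfolding conv_radius_gchoose by (simp add: one_ereal_def)
  hence "ereal (norm (1/2 :: real)) < conv_radius (\<lambda>n. a gchoose n)"
    by (rule less_le_trans[rotated]) (simp add: one_ereal_def)
  from abs_summable_in_conv_radius[OF this] show ?thesis by (simp add: abs_mult power_abs)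
qed

text \<open>Coefficient form of differentiating \<open>(1 + x) powr (- \<nu>)\<close>; it links the
  expansions for \<nu> and \<nu> + 1 in the continuation of the Beta integral.\<close>

lemma gbinomial_uminus_Suc:
  fixes \<nu> :: real
  shows "real (Suc l) * ((- \<nu>) gchoose Suc l) = - \<nu> * ((- (\<nu> + 1)) gchoose l)"
proof -
  have "pochhammer \<nu> (Suc l) = \<nu> * pochhammer (\<nu> + 1) l" by (rule pochhammer_rec)
  thus ?thesis
    by (simp add: gbinomial_pochhammer field_simps del: of_nat_Suc)
qed

text \<open>Identifies the factor of the first series with the binomial coefficients that arise from
  expanding \<open>(1 + v) powr (- \<nu>)\<close>.\<close>

lemma Gamma_gbinomial:
  assumes "\<nu> > 0"
  shows "(- 1) ^ l / fact l * Gamma (\<nu> + real l) = Gamma \<nu> * ((- \<nu>) gchoose l)"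
proof -
  have "\<nu> \<notin> \<int>\<^sub>\<le>\<^sub>0" "Gamma \<nu> \<noteq> 0" using assms Gamma_real_pos[of \<nu>] by (auto elim!: nonpos_Ints_cases simp del: Gamma_real_pos)
  thus ?thesis using pochhammer_Gamma[of \<nu> l] by (simp add: gbinomial_pochhammer)
qed

section \<open>Incomplete Gamma integrals\<close>

text \<open>
  The half-line is cut at 2 instead of 1 so that the binomial series converges geometrically on the
  upper part for every \<open>\<nu>\<close>.
\<close>

definition upper_exp :: "real \<Rightarrow> real \<Rightarrow> real \<Rightarrow> real" where
  "upper_exp c \<beta> \<sigma> = (LINT v|lborel. indicator {2<..} v * (exp (- c * v powr \<beta>) * v powr (\<sigma> - 1)))"

text \<open>With \<open>u = v / (1 + v)\<close> this is the incomplete Beta function with parameters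
  m and \<nu> - m at u = 2/3. It is finite for every m > 0, also when m exceeds \<nu>.\<close>

definition lower_beta :: "real \<Rightarrow> real \<Rightarrow> real" where
  "lower_beta \<nu> m = (LINT v|lborel. indicator {0<..2} v * ((1 + v) powr (- \<nu>) * v powr (m - 1)))"

text \<open>The substitution \<open>w = v powr \<beta>\<close> is made by reading one integral over
  the real line as radial in two ways, with exponents \<beta> and 1; the volume of the unit ball
  cancels.\<close>

lemma has_bochner_integral_exp_powr:
  fixes c \<beta> \<sigma> :: real
  assumes c: "c > 0" and \<beta>: "\<beta> > 0" and \<sigma>: "\<sigma> > 0"
  shows "has_bochner_integral lborel (\<lambda>v. indicator {0<..} v * (exp (- c * v powr \<beta>) * v powr (\<sigma> - 1)))
    (c powr (- \<sigma> / \<beta>) * Gamma (\<sigma> / \<beta>) / \<beta>)"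
proof -
  define f where "f = (\<lambda>w. exp (- c * w) * w powr ((\<sigma> - 1) / \<beta>))"
  define g where "g = (\<lambda>v. exp (- c * v powr \<beta>) * v powr (\<sigma> - 1))"
  have [measurable]: "f \<in> borel_measurable borel" "g \<in> borel_measurable borel"
    unfolding f_def g_def by measurable
  have fg: "f (norm x powr \<beta>) = g (norm x powr 1)" for x :: real
    using \<beta> by (simp add: f_def g_def powr_powr)
  have fG: "f v * v powr (1 / \<beta> - 1) = exp (- c * v) * v powr (\<sigma> / \<beta> - 1)" for v
    by (simp add: f_def powr_add[symmetric] diff_divide_distrib)
  have G: "has_bochner_integral lborel (\<lambda>v. indicator {0<..} v * (f v * v powr (1 / \<beta> - 1))) (Gamma (\<sigma> / \<beta>) * c powr (- (\<sigma> / \<beta>)))"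
    unfolding fG using has_bochner_integral_Gamma[of c "\<sigma> / \<beta>"] assms by simp
  have g1: "indicator {0<..} v * (g v * v powr (real DIM(real) / 1 - 1)) = indicator {0<..} v * g v" for v
    by (simp add: indicator_def)
  have i1: "integrable lborel (\<lambda>x::real. f (norm x powr \<beta>))"
    using integrable_norm_powr[OF \<beta>, of f, where ?'a = real] G by (simp add: has_bochner_integral_iff)
  hence "integrable lborel (\<lambda>v. indicator {0<..} v * g v)"
    unfolding fg using integrable_norm_powr[of 1 g, where ?'a = real] unfolding g1 by simp
  moreover have "(LINT v|lborel. indicator {0<..} v * g v) = c powr (- \<sigma> / \<beta>) * Gamma (\<sigma> / \<beta>) / \<beta>"
  proof -
    have "unit_ball_vol 1 * (1 / \<beta>) * (Gamma (\<sigma> / \<beta>) * c powr (- (\<sigma> / \<beta>))) = (LINT x|lborel. f (norm (x::real) powr \<beta>))"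
      using integral_norm_powr[OF \<beta>, of f, where ?'a = real] G by (simp add: has_bochner_integral_iff)
    also have "\<dots> = unit_ball_vol 1 * (1 / 1) * (LINT v|lborel. indicator {0<..} v * g v)"
      unfolding fg using integral_norm_powr[of 1 g, where ?'a = real] unfolding g1 by simp
    finally show ?thesis by (simp add: mult_ac)
  qed
  ultimately show ?thesis by (simp add: has_bochner_integral_iff g_def)
qed

lemma integrable_upper_exp:
  fixes c \<beta> \<sigma> :: real
  assumes c: "c > 0" and \<beta>: "\<beta> > 0"
  shows "integrable lborel (\<lambda>v. indicator {2<..} v * (exp (- c * v powr \<beta>) * v powr (\<sigma> - 1)))"
proof (rule Bochner_Integration.integrable_bound)
  \<comment> \<open>Beyond 2, raising the exponent only enlarges the power; since \<tau> > 0 the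
    dominating integral also converges at 0.\<close>
  define \<tau> where "\<tau> = max 1 \<sigma>"
  show "integrable lborel (\<lambda>v. indicator {0<..} v * (exp (- c * v powr \<beta>) * v powr (\<tau> - 1)))"
    using has_bochner_integral_exp_powr[OF c \<beta>, of \<tau>] by (auto simp: has_bochner_integral_iff \<tau>_def)
  show "AE v in lborel. norm (indicator {2<..} v * (exp (- c * v powr \<beta>) * v powr (\<sigma> - 1)))
      \<le> norm (indicator {0<..} v * (exp (- c * v powr \<beta>) * v powr (\<tau> - 1)))"
  proof (intro AE_I2)
    fix v :: real
    have "v > 2 \<Longrightarrow> v powr (\<sigma> - 1) \<le> v powr (\<tau> - 1)"
      by (intro powr_mono) (auto simp: \<tau>_def)
    thus "norm (indicator {2<..} v * (exp (- c * v powr \<beta>) * v powr (\<sigma> - 1)))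
      \<le> norm (indicator {0<..} v * (exp (- c * v powr \<beta>) * v powr (\<tau> - 1)))"
      by (auto simp: indicator_def abs_mult)
  qed
qed measurable

lemma upper_exp_nonneg: "upper_exp c \<beta> \<sigma> \<ge> 0"
  unfolding upper_exp_def by (intro integral_nonneg_AE AE_I2) (auto simp: indicator_def)

text \<open>Each unit taken off the exponent costs a factor \<open>1 / v\<close>, below 1/2 past the
  cut. This geometric gain makes the sum against binomial coefficients converge.\<close>

lemma upper_exp_shift_le:
  assumes c: "c > 0" and \<beta>: "\<beta> > 0"
  shows "upper_exp c \<beta> (\<sigma> - real l) \<le> (1/2) ^ l * upper_exp c \<beta> \<sigma>"
proof -
  have "upper_exp c \<beta> (\<sigma> - real l) \<le> (LINT v|lborel. (1/2) ^ l * (indicator {2<..} v * (exp (- c * v powr \<beta>) * v powr (\<sigma> - 1))))"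
    unfolding upper_exp_def
  proof (rule integral_mono)
    show "integrable lborel (\<lambda>v. indicator {2<..} v * (exp (- c * v powr \<beta>) * v powr (\<sigma> - real l - 1)))"
      by (rule integrable_upper_exp[OF c \<beta>])
    show "integrable lborel (\<lambda>v. (1/2) ^ l * (indicator {2<..} v * (exp (- c * v powr \<beta>) * v powr (\<sigma> - 1))))"
      using integrable_upper_exp[OF c \<beta>] by simp
    fix v :: real
    show "indicator {2<..} v * (exp (- c * v powr \<beta>) * v powr (\<sigma> - real l - 1)) \<le>
       (1/2) ^ l * (indicator {2<..} v * (exp (- c * v powr \<beta>) * v powr (\<sigma> - 1)))"
    proof (cases "v > 2")
      case True
      have "v powr (\<sigma> - real l - 1) = v powr (\<sigma> - 1) * (1 / v) ^ l"
      proof -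
        have e: "\<sigma> - real l - 1 = \<sigma> - 1 - real l" by simp
        show ?thesis unfolding e powr_diff[of v "\<sigma> - 1" "real l"]
          using True by (simp add: powr_realpow power_one_over divide_inverse power_inverse)
      qed
      also have "\<dots> \<le> v powr (\<sigma> - 1) * (1 / 2) ^ l"
        using True by (intro mult_left_mono power_mono) (auto simp: field_simps)
      finally show ?thesis using True by (simp add: mult_ac)
    qed simp
  qed
  thus ?thesis by (simp add: upper_exp_def)
qed

text \<open>Integration by parts. For \<sigma> < 0 both parts of the derivative \<open>f\<close> are
  nonnegative and the antiderivative vanishes at infinity, so the fundamental theorem for
  nonnegative integrands on a half-line applies.\<close>

lemma upper_exp_recursion:
  assumes c: "c > 0" and \<beta>: "\<beta> > 0" and \<sigma>: "\<sigma> < 0"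
  shows "\<sigma> * upper_exp c \<beta> \<sigma> = c * \<beta> * upper_exp c \<beta> (\<sigma> + \<beta>) - 2 powr \<sigma> * exp (- c * 2 powr \<beta>)"
proof -
  define F where "F = (\<lambda>v. - (exp (- c * v powr \<beta>) * v powr \<sigma>))"
  define f where "f = (\<lambda>v. c * \<beta> * (exp (- c * v powr \<beta>) * v powr (\<sigma> + \<beta> - 1)) - \<sigma> * (exp (- c * v powr \<beta>) * v powr (\<sigma> - 1)))"
  have [measurable]: "f \<in> borel_measurable borel" unfolding f_def by measurable
  have nn: "f v \<ge> 0" if "v \<ge> 2" for v
    unfolding f_def using c \<beta> \<sigma> that by (simp add: mult_nonpos_nonneg order_trans[of _ 0])
  have "(\<integral>\<^sup>+v. ennreal (f v) * indicator {2..} v \<partial>lborel) = 0 - F 2"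
  proof (rule nn_integral_FTC_atLeast)
    fix v :: real assume v: "2 \<le> v"
    have "v powr (\<sigma> + \<beta> - 1) = v powr \<sigma> * v powr (\<beta> - 1)" using powr_add[of v \<sigma> "\<beta> - 1"] by (simp add: algebra_simps)
    thus "DERIV F v :> f v"
      unfolding F_def f_def using v
      by (auto intro!: derivative_eq_intros simp: algebra_simps)
    show "0 \<le> f v" by (rule nn[OF v])
  next
    have 1: "((\<lambda>v. v powr \<sigma>) \<longlongrightarrow> 0) at_top" using \<sigma> by (intro tendsto_neg_powr filterlim_ident)
    show "(F \<longlongrightarrow> 0) at_top"
    proof (rule Lim_null_comparison[OF _ 1])
      show "\<forall>\<^sub>F v in at_top. norm (F v) \<le> v powr \<sigma>"
        using eventually_ge_at_top[of 0]
        by eventually_elim (use c in \<open>auto simp: F_def abs_mult intro!: mult_left_le_one_le\<close>)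
    qed
  qed auto
  also have "(\<lambda>v. ennreal (f v) * indicator {2..} v) = (\<lambda>v. ennreal (indicator {2..} v * f v))"
    by (auto simp: indicator_def)
  finally have "has_bochner_integral lborel (\<lambda>v. indicator {2..} v * f v) (0 - F 2)"
    by (intro has_bochner_integral_nn_integral) (use nn in \<open>auto simp: indicator_def F_def\<close>)
  hence 1: "has_bochner_integral lborel (\<lambda>v. indicator {2<..} v * f v) (0 - F 2)"
    by (rule has_bochner_integral_indicator_change[where a = 2]) auto
  have "(LINT v|lborel. indicator {2<..} v * f v) =
    (LINT v|lborel. c * \<beta> * (indicator {2<..} v * (exp (- c * v powr \<beta>) * v powr (\<sigma> + \<beta> - 1))) - \<sigma> * (indicator {2<..} v * (exp (- c * v powr \<beta>) * v powr (\<sigma> - 1))))"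
    by (intro Bochner_Integration.integral_cong refl) (simp add: f_def algebra_simps)
  also have "\<dots> = c * \<beta> * upper_exp c \<beta> (\<sigma> + \<beta>) - \<sigma> * upper_exp c \<beta> \<sigma>"
    unfolding upper_exp_def
    by (subst Bochner_Integration.integral_diff) (use integrable_upper_exp[OF c \<beta>] in \<open>auto\<close>)
  finally have "c * \<beta> * upper_exp c \<beta> (\<sigma> + \<beta>) - \<sigma> * upper_exp c \<beta> \<sigma> = - F 2"
    using 1 by (simp add: has_bochner_integral_iff)
  thus ?thesis by (simp add: F_def mult.commute)
qed

text \<open>Comparison with an exponential series as soon as the denominators have reached 1; the
  finitely many earlier terms do not affect summability, whatever their denominators are.\<close>

lemma summable_exp_powr_coeff:
  fixes c \<beta> \<sigma> :: real
  assumes c: "c > 0" and \<beta>: "\<beta> > 0"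
  shows "summable (\<lambda>j. \<bar>(- c) ^ j / fact j * (2 powr (\<sigma> + \<beta> * real j) / (\<sigma> + \<beta> * real j))\<bar>)"
proof (rule summable_comparison_test_ev)
  have "summable (\<lambda>j. (c * 2 powr \<beta>) ^ j /\<^sub>R fact j)" by (rule summable_exp_generic)
  thus "summable (\<lambda>j. 2 powr \<sigma> * ((c * 2 powr \<beta>) ^ j / fact j))"
    by (intro summable_mult) (simp add: field_simps)
  have "filterlim (\<lambda>j. \<sigma> + \<beta> * real j) at_top sequentially"
    using \<beta> by real_asymp
  hence "\<forall>\<^sub>F j in sequentially. \<sigma> + \<beta> * real j \<ge> 1"
    by (simp add: filterlim_at_top)
  thus "\<forall>\<^sub>F j in sequentially. norm \<bar>(- c) ^ j / fact j * (2 powr (\<sigma> + \<beta> * real j) / (\<sigma> + \<beta> * real j))\<bar>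
      \<le> 2 powr \<sigma> * ((c * 2 powr \<beta>) ^ j / fact j)"
  proof eventually_elim
    case (elim j)
    have "norm \<bar>(- c) ^ j / fact j * (2 powr (\<sigma> + \<beta> * real j) / (\<sigma> + \<beta> * real j))\<bar> =
       (2 powr \<sigma> * ((c * 2 powr \<beta>) ^ j / fact j)) / (\<sigma> + \<beta> * real j)"
      using c elim by (simp add: abs_mult power_abs powr_add powr_powr[symmetric] powr_realpow power_mult_distrib)
    also have "\<dots> \<le> (2 powr \<sigma> * ((c * 2 powr \<beta>) ^ j / fact j)) / 1"
      using elim c by (intro divide_left_mono) auto
    finally show ?case by simp
  qed
qed

text \<open>For \<sigma> > 0 the complete integral converges at 0, so the upper part is the complete
  integral minus the part up to 2, where the exponential series may be integrated term by
  term.\<close>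

lemma upper_exp_eq_of_pos:
  fixes c \<beta> \<sigma> :: real
  assumes c: "c > 0" and \<beta>: "\<beta> > 0" and \<sigma>: "\<sigma> > 0"
  shows "upper_exp c \<beta> \<sigma> = c powr (- \<sigma> / \<beta>) * Gamma (\<sigma> / \<beta>) / \<beta>
     - (\<Sum>j. (- c) ^ j / fact j * (2 powr (\<sigma> + \<beta> * real j) / (\<sigma> + \<beta> * real j)))"
proof -
  let ?g = "\<lambda>v. exp (- c * v powr \<beta>) * v powr (\<sigma> - 1)"
  let ?a = "\<lambda>j. (- c) ^ j / fact j * (2 powr (\<sigma> + \<beta> * real j) / (\<sigma> + \<beta> * real j))"
  define f where "f = (\<lambda>j v. (- c) ^ j / fact j * (indicator {0<..2} v * v powr (\<sigma> + \<beta> * real j - 1)))"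
  have p: "has_bochner_integral lborel (\<lambda>v. indicator {0<..2} v * v powr (\<sigma> + \<beta> * real j - 1)) (2 powr (\<sigma> + \<beta> * real j) / (\<sigma> + \<beta> * real j))" for j
    using \<sigma> \<beta> by (intro has_bochner_integral_powr_lower) (auto intro: add_pos_nonneg)
  have fi: "has_bochner_integral lborel (f j) (?a j)" for j
    unfolding f_def by (intro has_bochner_integral_mult_right p)
  have "has_bochner_integral lborel (\<lambda>v. \<bar>f j v\<bar>) \<bar>?a j\<bar>" for j
  proof -
    have "has_bochner_integral lborel (\<lambda>v. \<bar>(- c) ^ j / fact j\<bar> * (indicator {0<..2} v * v powr (\<sigma> + \<beta> * real j - 1))) (\<bar>(- c) ^ j / fact j\<bar> * (2 powr (\<sigma> + \<beta> * real j) / (\<sigma> + \<beta> * real j)))"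
      by (intro has_bochner_integral_mult_right p)
    thus ?thesis using \<sigma> \<beta> by (simp add: f_def abs_mult)
  qed
  hence nf: "(LINT v|lborel. norm (f j v)) = \<bar>?a j\<bar>" for j by (simp add: has_bochner_integral_iff)
  have fs: "f j v = indicator {0<..2} v * v powr (\<sigma> - 1) * ((- c * v powr \<beta>) ^ j /\<^sub>R fact j)" for j v
    unfolding power_mult_distrib
    by (cases "v > 0") (auto simp: f_def powr_add powr_diff powr_powr[symmetric] powr_realpow field_simps)
  have s1: "summable (\<lambda>j. norm (f j v))" for v
    unfolding fs norm_mult by (intro summable_mult summable_norm_exp)
  have "(\<lambda>j. f j v) sums (indicator {0<..2} v * v powr (\<sigma> - 1) * exp (- c * v powr \<beta>))" for v
    unfolding fs by (intro sums_mult exp_converges)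
  hence s2: "(\<Sum>j. f j v) = indicator {0<..2} v * ?g v" for v by (simp add: sums_iff mult_ac)
  have "(\<lambda>j. integral\<^sup>L lborel (f j)) sums (LINT v|lborel. (\<Sum>j. f j v))"
    by (rule sums_integral) (use fi s1 nf summable_exp_powr_coeff[OF c \<beta>] in \<open>auto simp: has_bochner_integral_iff\<close>)
  hence L: "(LINT v|lborel. indicator {0<..2} v * ?g v) = (\<Sum>j. ?a j)"
    unfolding s2 using fi by (simp add: sums_iff has_bochner_integral_iff)
  have "integrable lborel (\<lambda>v. \<Sum>j. f j v)"
    by (rule integrable_suminf) (use fi s1 nf summable_exp_powr_coeff[OF c \<beta>] in \<open>auto simp: has_bochner_integral_iff\<close>)
  hence Li: "integrable lborel (\<lambda>v. indicator {0<..2} v * ?g v)" unfolding s2 .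
  have "c powr (- \<sigma> / \<beta>) * Gamma (\<sigma> / \<beta>) / \<beta> = (LINT v|lborel. indicator {0<..} v * ?g v)"
    using has_bochner_integral_exp_powr[OF c \<beta> \<sigma>] by (simp add: has_bochner_integral_iff)
  also have "\<dots> = (LINT v|lborel. indicator {0<..2} v * ?g v + indicator {2<..} v * ?g v)"
    by (intro Bochner_Integration.integral_cong refl) (auto simp: indicator_def)
  also have "\<dots> = (\<Sum>j. ?a j) + upper_exp c \<beta> \<sigma>"
    unfolding upper_exp_def using L Li integrable_upper_exp[OF c \<beta>, of \<sigma>] by simp
  finally show ?thesis by simp
qed

text \<open>Analytic continuation in \<sigma> of the expansion of an incomplete Gamma function,
  carried out as induction along steps of length \<beta>: the integral, the complete Gamma term and
  the series all obey compatible recursions. The condition on \<sigma> excludes at once the zero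
  denominators and the poles of \<open>Gamma (\<sigma> / \<beta>)\<close>. \<open>N\<close> counts
  the steps that make the exponent positive.\<close>

lemma upper_exp_eq:
  fixes c \<beta> \<sigma> :: real
  assumes c: "c > 0" and \<beta>: "\<beta> > 0" and \<sigma>: "\<And>j::nat. \<sigma> + \<beta> * real j \<noteq> 0"
  shows "upper_exp c \<beta> \<sigma> = c powr (- \<sigma> / \<beta>) * Gamma (\<sigma> / \<beta>) / \<beta>
     - (\<Sum>j. (- c) ^ j / fact j * (2 powr (\<sigma> + \<beta> * real j) / (\<sigma> + \<beta> * real j)))"
proof -
  have "\<forall>\<sigma>. \<sigma> + \<beta> * real N > 0 \<longrightarrow> (\<forall>j::nat. \<sigma> + \<beta> * real j \<noteq> 0) \<longrightarrow> upper_exp c \<beta> \<sigma> = c powr (- \<sigma> / \<beta>) * Gamma (\<sigma> / \<beta>) / \<beta>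
     - (\<Sum>j. (- c) ^ j / fact j * (2 powr (\<sigma> + \<beta> * real j) / (\<sigma> + \<beta> * real j)))" for N
  proof (induction N)
    case 0
    thus ?case using upper_exp_eq_of_pos[OF c \<beta>] by simp
  next
    case (Suc N)
    show ?case
    proof (intro allI impI)
      fix \<sigma> assume N: "\<sigma> + \<beta> * real (Suc N) > 0" and nz: "\<forall>j::nat. \<sigma> + \<beta> * real j \<noteq> 0"
      show "upper_exp c \<beta> \<sigma> = c powr (- \<sigma> / \<beta>) * Gamma (\<sigma> / \<beta>) / \<beta>
        - (\<Sum>j. (- c) ^ j / fact j * (2 powr (\<sigma> + \<beta> * real j) / (\<sigma> + \<beta> * real j)))"
      proof (cases "\<sigma> > 0")
        case True
        thus ?thesis by (rule upper_exp_eq_of_pos[OF c \<beta>])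
      next
        case False
        moreover have "\<sigma> \<noteq> 0" using nz[rule_format, of 0] by simp
        ultimately have \<sigma>: "\<sigma> < 0" by simp
        define S where "S = (\<lambda>\<sigma>. \<Sum>j. (- c) ^ j / fact j * (2 powr (\<sigma> + \<beta> * real j) / (\<sigma> + \<beta> * real j)))"
        define R where "R = (\<lambda>\<sigma>. c powr (- \<sigma> / \<beta>) * Gamma (\<sigma> / \<beta>) / \<beta>)"
        have eq: "\<sigma> + \<beta> + \<beta> * real j = \<sigma> + \<beta> * real (Suc j)" for j by (simp add: algebra_simps)
        have IH: "upper_exp c \<beta> (\<sigma> + \<beta>) = R (\<sigma> + \<beta>) - S (\<sigma> + \<beta>)"
          unfolding R_def S_def
          by (rule Suc.IH[rule_format]) (use N nz in \<open>simp_all only: eq, simp\<close>)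
        have R: "c * \<beta> * R (\<sigma> + \<beta>) = \<sigma> * R \<sigma>"
        proof -
          have "\<sigma> / \<beta> \<notin> \<int>\<^sub>\<le>\<^sub>0"
          proof
            assume "\<sigma> / \<beta> \<in> \<int>\<^sub>\<le>\<^sub>0"
            then obtain j :: nat where "\<sigma> / \<beta> = - real j" by (elim nonpos_Ints_cases') auto
            hence "\<sigma> + \<beta> * real j = 0" using \<beta> by (simp add: field_simps)
            thus False using nz by simp
          qed
          hence "Gamma ((\<sigma> + \<beta>) / \<beta>) = \<sigma> / \<beta> * Gamma (\<sigma> / \<beta>)"
            using Gamma_plus1[of "\<sigma> / \<beta>"] \<beta> by (simp add: add_divide_distrib)
          moreover have "c * c powr (- (\<sigma> + \<beta>) / \<beta>) = c powr (- \<sigma> / \<beta>)"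
            using c \<beta> powr_add[of c 1 "- (\<sigma> + \<beta>) / \<beta>"] by (simp add: field_simps)
          moreover have "c * \<beta> * R (\<sigma> + \<beta>) = c * c powr (- (\<sigma> + \<beta>) / \<beta>) * Gamma ((\<sigma> + \<beta>) / \<beta>)"
            unfolding R_def using \<beta> by simp
          ultimately have "c * \<beta> * R (\<sigma> + \<beta>) = c powr (- \<sigma> / \<beta>) * (\<sigma> / \<beta> * Gamma (\<sigma> / \<beta>))"
            by (simp only:)
          thus ?thesis unfolding R_def by simp
        qed
        \<comment> \<open>Write \<open>\<sigma> / (\<sigma> + \<beta> * j)\<close> as
          \<open>1 - \<beta> * j / (\<sigma> + \<beta> * j)\<close>. The constant 1 sums to the
          boundary term of the integration by parts; the rest, with its index shifted by one, is the
          series at \<sigma> + \<beta>.\<close>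
        have S: "\<sigma> * S \<sigma> = 2 powr \<sigma> * exp (- c * 2 powr \<beta>) + c * \<beta> * S (\<sigma> + \<beta>)"
        proof -
          let ?t = "\<lambda>\<sigma> j. (- c) ^ j / fact j * (2 powr (\<sigma> + \<beta> * real j) / (\<sigma> + \<beta> * real j))"
          have sm: "summable (?t \<sigma>)" for \<sigma>
            using summable_exp_powr_coeff[OF c \<beta>, of \<sigma>] by (rule summable_rabs_cancel)
          have e: "(\<lambda>j. 2 powr \<sigma> * ((- c * 2 powr \<beta>) ^ j /\<^sub>R fact j)) sums (2 powr \<sigma> * exp (- c * 2 powr \<beta>))"
            by (intro sums_mult exp_converges)
          have t: "\<sigma> * ?t \<sigma> j = 2 powr \<sigma> * ((- c * 2 powr \<beta>) ^ j /\<^sub>R fact j) - \<beta> * real j * ?t \<sigma> j" for j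
          proof -
            define T where "T = ?t \<sigma> j"
            have "2 powr \<sigma> * ((- c * 2 powr \<beta>) ^ j /\<^sub>R fact j) = (- c) ^ j / fact j * 2 powr (\<sigma> + \<beta> * real j)"
              unfolding power_mult_distrib by (simp add: powr_add powr_powr[symmetric] powr_realpow field_simps)
            also have "(- c) ^ j / fact j * 2 powr (\<sigma> + \<beta> * real j) = (\<sigma> + \<beta> * real j) * T" using nz by (simp add: T_def)
            finally show ?thesis unfolding T_def[symmetric] by (simp add: algebra_simps)
          qed
          have "(\<lambda>j. 2 powr \<sigma> * ((- c * 2 powr \<beta>) ^ j /\<^sub>R fact j) - \<sigma> * ?t \<sigma> j) sums (2 powr \<sigma> * exp (- c * 2 powr \<beta>) - \<sigma> * S \<sigma>)"
            unfolding S_def by (intro sums_diff e sums_mult summable_sums sm)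
          hence A: "(\<lambda>j. \<beta> * real j * ?t \<sigma> j) sums (2 powr \<sigma> * exp (- c * 2 powr \<beta>) - \<sigma> * S \<sigma>)"
            unfolding t by simp
          \<comment> \<open>The term with j = 0 carries the factor 0, so the shift leaves the sum
            unchanged.\<close>
          have B: "(\<lambda>j. \<beta> * real (Suc j) * ?t \<sigma> (Suc j)) sums (2 powr \<sigma> * exp (- c * 2 powr \<beta>) - \<sigma> * S \<sigma>)"
            using A by (subst sums_Suc_iff) simp
          have "\<beta> * real (Suc j) * ?t \<sigma> (Suc j) = - (c * \<beta>) * ?t (\<sigma> + \<beta>) j" for j
          proof -
            have "fact (Suc j) = real (Suc j) * fact j" by simp
            hence c': "real (Suc j) * ((- c) ^ Suc j / fact (Suc j)) = - c * ((- c) ^ j / fact j)"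
              by (simp add: field_simps del: fact_Suc of_nat_Suc)
            define X where "X = 2 powr (\<sigma> + \<beta> * real (Suc j)) / (\<sigma> + \<beta> * real (Suc j))"
            have "\<beta> * real (Suc j) * ((- c) ^ Suc j / fact (Suc j) * X) = \<beta> * (real (Suc j) * ((- c) ^ Suc j / fact (Suc j))) * X"
              by (simp only: mult.assoc)
            also have "\<dots> = - (c * \<beta>) * ((- c) ^ j / fact j * X)"
              unfolding c' by (simp add: mult_ac)
            finally show ?thesis unfolding X_def eq .
          qed
          hence "(\<lambda>j. - (c * \<beta>) * ?t (\<sigma> + \<beta>) j) sums (2 powr \<sigma> * exp (- c * 2 powr \<beta>) - \<sigma> * S \<sigma>)"
            using B by simp
          moreover have "(\<lambda>j. - (c * \<beta>) * ?t (\<sigma> + \<beta>) j) sums (- (c * \<beta>) * S (\<sigma> + \<beta>))"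
            unfolding S_def by (intro sums_mult summable_sums sm)
          ultimately have "2 powr \<sigma> * exp (- c * 2 powr \<beta>) - \<sigma> * S \<sigma> = - (c * \<beta>) * S (\<sigma> + \<beta>)"
            by (rule sums_unique2)
          thus ?thesis by simp
        qed
        have "\<sigma> * upper_exp c \<beta> \<sigma> = \<sigma> * (R \<sigma> - S \<sigma>)"
          unfolding upper_exp_recursion[OF c \<beta> \<sigma>] IH using R S by (simp add: algebra_simps)
        hence "upper_exp c \<beta> \<sigma> = R \<sigma> - S \<sigma>" using \<sigma> by simp
        thus ?thesis by (simp add: R_def S_def)
      qed
    qed
  qed
  moreover obtain N :: nat where "real N > - \<sigma> / \<beta>" using reals_Archimedean2 by blast
  hence "\<sigma> + \<beta> * real N > 0" using \<beta> by (simp add: field_simps)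
  ultimately show ?thesis using \<sigma> by blast
qed

section \<open>Incomplete Beta integrals\<close>

text \<open>Tonelli for \<open>v powr (m - 1) * u powr (\<nu> - 1) * exp (- (1 + v) * u)\<close>:
  integrating u first gives \<open>Gamma \<nu>\<close> times the Beta integrand, integrating v first
  gives \<open>Gamma m\<close> times the integrand of \<open>Gamma (\<nu> - m)\<close>.\<close>

lemma has_bochner_integral_Beta:
  fixes m \<nu> :: real
  assumes m: "0 < m" "m < \<nu>"
  shows "has_bochner_integral lborel (\<lambda>v. indicator {0<..} v * ((1 + v) powr (- \<nu>) * v powr (m - 1))) (Gamma m * Gamma (\<nu> - m) / Gamma \<nu>)"
proof -
  have \<nu>: "\<nu> > 0" using m by simp
  have G: "Gamma m > 0" "Gamma \<nu> > 0" "Gamma (\<nu> - m) > 0" using m by auto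
  have gi: "(\<integral>\<^sup>+u. ennreal (indicator {0<..} u * (exp (- a * u) * u powr (s - 1))) \<partial>lborel) = ennreal (Gamma s * a powr (- s))"
    if "a > 0" "s > 0" for a s :: real
    using has_bochner_integral_Gamma[OF that] by (subst nn_integral_eq_integral) (auto simp: has_bochner_integral_iff)
  let ?h = "\<lambda>v u. ennreal (indicator {0<..} v * v powr (m - 1) * (indicator {0<..} u * (exp (- (1 + v) * u) * u powr (\<nu> - 1))))"
  have "(\<integral>\<^sup>+v. ennreal (Gamma \<nu> * (indicator {0<..} v * ((1 + v) powr (- \<nu>) * v powr (m - 1)))) \<partial>lborel)
     = (\<integral>\<^sup>+v. \<integral>\<^sup>+u. ?h v u \<partial>lborel \<partial>lborel)"
  proof (rule nn_integral_cong)
    fix v :: real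
    show "ennreal (Gamma \<nu> * (indicator {0<..} v * ((1 + v) powr (- \<nu>) * v powr (m - 1)))) = (\<integral>\<^sup>+u. ?h v u \<partial>lborel)"
    proof (cases "v > 0")
      case True
      have "(\<integral>\<^sup>+u. ?h v u \<partial>lborel) = (\<integral>\<^sup>+u. ennreal (v powr (m - 1)) * ennreal (indicator {0<..} u * (exp (- (1 + v) * u) * u powr (\<nu> - 1))) \<partial>lborel)"
        using True by (intro nn_integral_cong) (simp add: ennreal_mult[symmetric])
      also have "\<dots> = ennreal (v powr (m - 1)) * ennreal (Gamma \<nu> * (1 + v) powr (- \<nu>))"
        using True \<nu> unfolding gi[of "1 + v" \<nu>, OF _ \<nu>, symmetric, OF add_pos_pos[OF zero_less_one True]] by (intro nn_integral_cmult) measurable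
      finally show ?thesis using True G by (simp add: ennreal_mult[symmetric] mult_ac)
    qed simp
  qed
  also have "\<dots> = (\<integral>\<^sup>+u. \<integral>\<^sup>+v. ?h v u \<partial>lborel \<partial>lborel)"
    by (rule lborel_pair.Fubini') measurable
  also have "\<dots> = (\<integral>\<^sup>+u. ennreal (Gamma m) * ennreal (indicator {0<..} u * (exp (- 1 * u) * u powr (\<nu> - m - 1))) \<partial>lborel)"
  proof (rule nn_integral_cong)
    fix u :: real
    show "(\<integral>\<^sup>+v. ?h v u \<partial>lborel) = ennreal (Gamma m) * ennreal (indicator {0<..} u * (exp (- 1 * u) * u powr (\<nu> - m - 1)))"
    proof (cases "u > 0")
      case True
      have "(\<integral>\<^sup>+v. ?h v u \<partial>lborel) = (\<integral>\<^sup>+v. ennreal (exp (- u) * u powr (\<nu> - 1)) * ennreal (indicator {0<..} v * (exp (- u * v) * v powr (m - 1))) \<partial>lborel)"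
      proof (intro nn_integral_cong)
        fix v :: real
        have "exp (- (1 + v) * u) = exp (- u) * exp (- u * v)" by (simp add: exp_add[symmetric] algebra_simps)
        thus "?h v u = ennreal (exp (- u) * u powr (\<nu> - 1)) * ennreal (indicator {0<..} v * (exp (- u * v) * v powr (m - 1)))"
          using True by (subst ennreal_mult[symmetric]) (simp_all add: mult_ac)
      qed
      also have "\<dots> = ennreal (exp (- u) * u powr (\<nu> - 1)) * ennreal (Gamma m * u powr (- m))"
        unfolding gi[OF True m(1), symmetric] by (intro nn_integral_cmult) measurable
      also have "\<dots> = ennreal (Gamma m) * ennreal (exp (- u) * (u powr (\<nu> - 1) * u powr (- m)))"
        using G by (simp add: ennreal_mult[symmetric] mult_ac)
      also have "u powr (\<nu> - 1) * u powr (- m) = u powr (\<nu> - m - 1)"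
        by (simp add: powr_add[symmetric] algebra_simps)
      finally show ?thesis using True by simp
    qed simp
  qed
  also have "\<dots> = ennreal (Gamma m * Gamma (\<nu> - m))"
  proof -
    have "\<nu> - m > 0" using m by simp
    from gi[OF zero_less_one this] show ?thesis
      using G by (subst nn_integral_cmult) (simp_all only: , simp_all add: ennreal_mult[symmetric])
  qed
  finally have "has_bochner_integral lborel (\<lambda>v. Gamma \<nu> * (indicator {0<..} v * ((1 + v) powr (- \<nu>) * v powr (m - 1)))) (Gamma m * Gamma (\<nu> - m))"
    using G by (intro has_bochner_integral_nn_integral) (auto simp: indicator_def)
  hence "has_bochner_integral lborel (\<lambda>v. 1 / Gamma \<nu> * (Gamma \<nu> * (indicator {0<..} v * ((1 + v) powr (- \<nu>) * v powr (m - 1))))) (1 / Gamma \<nu> * (Gamma m * Gamma (\<nu> - m)))"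
    by (rule has_bochner_integral_mult_right)
  thus ?thesis using G by simp
qed

lemma integrable_lower_beta:
  fixes m \<nu> :: real
  assumes m: "m > 0" and \<nu>: "\<nu> > 0"
  shows "integrable lborel (\<lambda>v. indicator {0<..2} v * ((1 + v) powr (- \<nu>) * v powr (m - 1)))"
proof (rule Bochner_Integration.integrable_bound)
  show "integrable lborel (\<lambda>v. indicator {0<..2} v * v powr (m - 1))"
    using has_bochner_integral_powr_lower[OF m, of 2] by (simp add: has_bochner_integral_iff)
  have "(1 + v) powr (- \<nu>) \<le> 1" if "v > 0" for v :: real
    using powr_mono[of "- \<nu>" 0 "1 + v"] that \<nu> by simp
  thus "AE v in lborel. norm (indicator {0<..2} v * ((1 + v) powr (- \<nu>) * v powr (m - 1))) \<le> norm (indicator {0<..2} v * v powr (m - 1))"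
    by (intro AE_I2) (auto simp: indicator_def abs_mult intro!: mult_left_le_one_le)
qed measurable

lemma lower_beta_nonneg: "lower_beta \<nu> m \<ge> 0"
  unfolding lower_beta_def by (intro integral_nonneg_AE AE_I2) (auto simp: indicator_def)

text \<open>Up to the cut, \<open>v powr t\<close> is at most \<open>2 powr t\<close>. With t =
  \<beta> * j the growth in j is geometric, which the factorial of the exponential series
  absorbs.\<close>

lemma lower_beta_add_le:
  assumes m: "m > 0" and \<nu>: "\<nu> > 0" and t: "t \<ge> 0"
  shows "lower_beta \<nu> (m + t) \<le> 2 powr t * lower_beta \<nu> m"
proof -
  have "lower_beta \<nu> (m + t) \<le> (LINT v|lborel. 2 powr t * (indicator {0<..2} v * ((1 + v) powr (- \<nu>) * v powr (m - 1))))"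
    unfolding lower_beta_def
  proof (rule integral_mono)
    fix v :: real
    show "indicator {0<..2} v * ((1 + v) powr (- \<nu>) * v powr (m + t - 1)) \<le> 2 powr t * (indicator {0<..2} v * ((1 + v) powr (- \<nu>) * v powr (m - 1)))"
    proof (cases "v \<in> {0<..2}")
      case True
      have "v powr (m + t - 1) = v powr t * v powr (m - 1)" by (simp add: powr_add[symmetric] algebra_simps)
      also have "\<dots> \<le> 2 powr t * v powr (m - 1)" using True t by (intro mult_right_mono powr_mono2) auto
      finally have "(1 + v) powr (- \<nu>) * v powr (m + t - 1) \<le> (1 + v) powr (- \<nu>) * (2 powr t * v powr (m - 1))"
        by (intro mult_left_mono) auto
      thus ?thesis using True by (simp add: mult_ac)
    qed simp
  qed (use integrable_lower_beta[of "m + t" \<nu>] integrable_lower_beta[of m \<nu>] assms in auto)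
  thus ?thesis by (simp add: lower_beta_def)
qed

text \<open>Differentiate \<open>(1 + v) powr (- \<nu>) * v powr m\<close> and replace a factor v by
  (1 + v) - 1. The base 3 is 1 + v at the cut. For m < 1 the derivative may blow up at 0, so the
  fundamental theorem is used with derivatives in the interior only.\<close>

lemma lower_beta_recursion:
  assumes m: "m > 0" and \<nu>: "\<nu> > 0"
  shows "(\<nu> - m) * lower_beta \<nu> m = \<nu> * lower_beta (\<nu> + 1) m - 2 powr m * 3 powr (- \<nu>)"
proof -
  define F where "F = (\<lambda>v::real. (1 + v) powr (- \<nu>) * v powr m)"
  let ?f1 = "\<lambda>v::real. (1 + v) powr (- \<nu>) * v powr (m - 1)" and ?f2 = "\<lambda>v::real. (1 + v) powr (- (\<nu> + 1)) * v powr (m - 1)"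
  have 1: "((\<lambda>v. (m - \<nu>) * ?f1 v + \<nu> * ?f2 v) has_integral (F 2 - F 0)) {0..2}"
  proof (rule fundamental_theorem_of_calculus_interior)
    show "continuous_on {0..2} F"
      unfolding F_def using m by (intro continuous_intros continuous_on_powr') auto
    fix v :: real assume v: "v \<in> {0<..<2}"
    have "(F has_field_derivative (- \<nu> * (1 + v) powr (- \<nu> - 1) * v powr m + (1 + v) powr (- \<nu>) * (m * v powr (m - 1)))) (at v)"
      unfolding F_def using v by (auto intro!: derivative_eq_intros)
    also have "- \<nu> * (1 + v) powr (- \<nu> - 1) * v powr m + (1 + v) powr (- \<nu>) * (m * v powr (m - 1)) = (m - \<nu>) * ?f1 v + \<nu> * ?f2 v"
    proof -
      have a: "(1 + v) powr (- \<nu>) = (1 + v) * (1 + v) powr (- (\<nu> + 1))"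
        using powr_mult_base[of "1 + v" "- (\<nu> + 1)"] v by simp
      have b: "v powr m = v * v powr (m - 1)" using powr_mult_base[of v "m - 1"] v by simp
      have c: "- \<nu> - 1 = - (\<nu> + 1)" by simp
      show ?thesis unfolding a b c by algebra
    qed
    finally show "(F has_vector_derivative (m - \<nu>) * ?f1 v + \<nu> * ?f2 v) (at v)"
      by (simp add: has_real_derivative_iff_has_vector_derivative)
  qed simp
  have int: "integrable lborel (\<lambda>v. indicator {0<..2} v * ?f1 v)" "integrable lborel (\<lambda>v. indicator {0<..2} v * ?f2 v)"
    using integrable_lower_beta[OF m \<nu>] integrable_lower_beta[OF m, of "\<nu> + 1"] \<nu> by simp_all
  have i: "integrable lborel (\<lambda>v. (m - \<nu>) * (indicator {0<..2} v * ?f1 v) + \<nu> * (indicator {0<..2} v * ?f2 v))"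
    using int by auto
  have v: "(LINT v|lborel. (m - \<nu>) * (indicator {0<..2} v * ?f1 v) + \<nu> * (indicator {0<..2} v * ?f2 v)) = (m - \<nu>) * lower_beta \<nu> m + \<nu> * lower_beta (\<nu> + 1) m"
    unfolding lower_beta_def by (subst Bochner_Integration.integral_add) (use int in auto)
  have "((\<lambda>v. (m - \<nu>) * (indicator {0<..2} v * ?f1 v) + \<nu> * (indicator {0<..2} v * ?f2 v)) has_integral ((m - \<nu>) * lower_beta \<nu> m + \<nu> * lower_beta (\<nu> + 1) m)) UNIV"
    using has_integral_integral_lborel[OF i] unfolding v .
  also have "(\<lambda>v. (m - \<nu>) * (indicator {0<..2} v * ?f1 v) + \<nu> * (indicator {0<..2} v * ?f2 v)) = (\<lambda>v. if v \<in> {0..2} then (m - \<nu>) * ?f1 v + \<nu> * ?f2 v else 0)"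
    by (auto simp: indicator_def)
  finally have "((\<lambda>v. (m - \<nu>) * ?f1 v + \<nu> * ?f2 v) has_integral ((m - \<nu>) * lower_beta \<nu> m + \<nu> * lower_beta (\<nu> + 1) m)) {0..2}"
    unfolding has_integral_restrict_UNIV .
  from has_integral_unique[OF this 1] have "(m - \<nu>) * lower_beta \<nu> m + \<nu> * lower_beta (\<nu> + 1) m = F 2" 
    using m by (simp add: F_def)
  thus ?thesis by (simp add: F_def algebra_simps)
qed

lemma summable_gbinomial_coeff:
  fixes \<nu> m :: real
  shows "summable (\<lambda>l. \<bar>((- \<nu>) gchoose l) * (2 powr (m - \<nu> - real l) / (\<nu> + real l - m))\<bar>)"
proof (rule summable_comparison_test_ev)
  show "summable (\<lambda>l. 2 powr (m - \<nu>) * (\<bar>(- \<nu>) gchoose l\<bar> * (1/2) ^ l))"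
    by (intro summable_mult summable_abs_gbinomial)
  have "filterlim (\<lambda>l. \<nu> + real l - m) at_top sequentially" by real_asymp
  hence "\<forall>\<^sub>F l in sequentially. \<nu> + real l - m \<ge> 1" by (simp add: filterlim_at_top)
  thus "\<forall>\<^sub>F l in sequentially. norm \<bar>((- \<nu>) gchoose l) * (2 powr (m - \<nu> - real l) / (\<nu> + real l - m))\<bar> \<le> 2 powr (m - \<nu>) * (\<bar>(- \<nu>) gchoose l\<bar> * (1/2) ^ l)"
  proof eventually_elim
    case (elim l)
    have p: "2 powr (m - \<nu> - real l) = 2 powr (m - \<nu>) * (1/2) ^ l"
      unfolding powr_diff[of 2 "m - \<nu>" "real l"] by (simp add: powr_realpow power_one_over)
    have "norm \<bar>((- \<nu>) gchoose l) * (2 powr (m - \<nu> - real l) / (\<nu> + real l - m))\<bar> = (2 powr (m - \<nu>) * (\<bar>(- \<nu>) gchoose l\<bar> * (1/2) ^ l)) / (\<nu> + real l - m)"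
      unfolding p using elim by (simp add: abs_mult)
    also have "\<dots> \<le> (2 powr (m - \<nu>) * (\<bar>(- \<nu>) gchoose l\<bar> * (1/2) ^ l)) / 1"
      using elim by (intro divide_left_mono) auto
    finally show ?case by simp
  qed
qed

lemma gbinomial_powr_sums:
  assumes "v > (1::real)"
  shows "(\<lambda>l. ((- \<nu>) gchoose l) * v powr (- \<nu> - real l)) sums (1 + v) powr (- \<nu>)"
  using gen_binomial_real''[of 1 v "- \<nu>"] assms by (simp add: add.commute)

text \<open>When m < \<nu> the complete Beta integral converges at infinity; its part beyond 2 is
  integrated term by term after expanding in powers of \<open>1 / v\<close>.\<close>

lemma lower_beta_eq_of_less:
  fixes \<nu> m :: real
  assumes m: "m > 0" "m < \<nu>"
  shows "lower_beta \<nu> m + (\<Sum>l. ((- \<nu>) gchoose l) * (2 powr (m - \<nu> - real l) / (\<nu> + real l - m))) = Gamma m * Gamma (\<nu> - m) / Gamma \<nu>"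
proof -
  let ?g = "\<lambda>v. (1 + v) powr (- \<nu>) * v powr (m - 1)"
  let ?a = "\<lambda>l. ((- \<nu>) gchoose l) * (2 powr (m - \<nu> - real l) / (\<nu> + real l - m))"
  define f where "f = (\<lambda>l v. ((- \<nu>) gchoose l) * (indicator {2<..} v * v powr (m - \<nu> - real l - 1)))"
  have p: "has_bochner_integral lborel (\<lambda>v. indicator {2<..} v * v powr (m - \<nu> - real l - 1)) (2 powr (m - \<nu> - real l) / (\<nu> + real l - m))" for l
    using has_bochner_integral_powr_upper[of "\<nu> + real l - m" 2] m by (simp add: algebra_simps)
  have fi: "has_bochner_integral lborel (f l) (?a l)" for l
    unfolding f_def by (intro has_bochner_integral_mult_right p)
  have "has_bochner_integral lborel (\<lambda>v. \<bar>f l v\<bar>) \<bar>?a l\<bar>" for l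
  proof -
    have "has_bochner_integral lborel (\<lambda>v. \<bar>(- \<nu>) gchoose l\<bar> * (indicator {2<..} v * v powr (m - \<nu> - real l - 1))) (\<bar>(- \<nu>) gchoose l\<bar> * (2 powr (m - \<nu> - real l) / (\<nu> + real l - m)))"
      by (intro has_bochner_integral_mult_right p)
    thus ?thesis using m by (simp add: f_def abs_mult)
  qed
  hence nf: "(LINT v|lborel. norm (f l v)) = \<bar>?a l\<bar>" for l by (simp add: has_bochner_integral_iff)
  have fs: "f l v = indicator {2<..} v * v powr (m - 1) * (((- \<nu>) gchoose l) * v powr (- \<nu> - real l))" for l v
  proof -
    have "v powr (m - \<nu> - real l - 1) = v powr (m - 1) * v powr (- \<nu> - real l)" by (simp add: powr_add[symmetric] algebra_simps)
    thus ?thesis by (simp add: f_def)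
  qed
  have s1: "summable (\<lambda>l. norm (f l v))" for v
  proof (cases "v > 2")
    case True
    have "summable (\<lambda>l. v powr (m - 1) * v powr (- \<nu>) * (\<bar>(- \<nu>) gchoose l\<bar> * (1/2) ^ l))"
      by (intro summable_mult summable_abs_gbinomial)
    thus ?thesis
    proof (rule summable_comparison_test'[where N = 0])
      fix l :: nat
      have "v powr (- \<nu> - real l) = v powr (- \<nu>) * (1 / v) ^ l"
        unfolding powr_diff[of v "- \<nu>" "real l"] using True by (simp add: powr_realpow power_one_over)
      also have "\<dots> \<le> v powr (- \<nu>) * (1/2) ^ l"
        using True by (intro mult_left_mono power_mono) (auto simp: field_simps)
      finally have "v powr (m - 1) * (\<bar>(- \<nu>) gchoose l\<bar> * v powr (- \<nu> - real l)) \<le> v powr (m - 1) * (\<bar>(- \<nu>) gchoose l\<bar> * (v powr (- \<nu>) * (1/2) ^ l))"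
        by (intro mult_left_mono) auto
      thus "norm (norm (f l v)) \<le> v powr (m - 1) * v powr (- \<nu>) * (\<bar>(- \<nu>) gchoose l\<bar> * (1/2) ^ l)"
        using True by (simp add: fs abs_mult mult_ac)
    qed
  qed (simp add: fs)
  have "(\<lambda>l. f l v) sums (indicator {2<..} v * v powr (m - 1) * (1 + v) powr (- \<nu>))" for v
    unfolding fs by (cases "v > 2") (auto intro!: sums_mult gbinomial_powr_sums)
  hence s2: "(\<Sum>l. f l v) = indicator {2<..} v * ?g v" for v by (simp add: sums_iff mult_ac)
  have "(\<lambda>l. integral\<^sup>L lborel (f l)) sums (LINT v|lborel. (\<Sum>l. f l v))"
    by (rule sums_integral) (use fi s1 nf summable_gbinomial_coeff in \<open>auto simp: has_bochner_integral_iff\<close>)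
  hence L: "(LINT v|lborel. indicator {2<..} v * ?g v) = (\<Sum>l. ?a l)"
    unfolding s2 using fi by (simp add: sums_iff has_bochner_integral_iff)
  have "integrable lborel (\<lambda>v. \<Sum>l. f l v)"
    by (rule integrable_suminf) (use fi s1 nf summable_gbinomial_coeff in \<open>auto simp: has_bochner_integral_iff\<close>)
  hence Li: "integrable lborel (\<lambda>v. indicator {2<..} v * ?g v)" unfolding s2 .
  have "Gamma m * Gamma (\<nu> - m) / Gamma \<nu> = (LINT v|lborel. indicator {0<..} v * ?g v)"
    using has_bochner_integral_Beta[OF m] by (simp add: has_bochner_integral_iff)
  also have "\<dots> = (LINT v|lborel. indicator {0<..2} v * ?g v + indicator {2<..} v * ?g v)"
    by (intro Bochner_Integration.integral_cong refl) (auto simp: indicator_def)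
  also have "\<dots> = lower_beta \<nu> m + (\<Sum>l. ?a l)"
    unfolding lower_beta_def using L Li integrable_lower_beta[of m \<nu>] m by simp
  finally show ?thesis by simp
qed

text \<open>The obstruction to the complete integral is now at infinity, where a larger \<nu> helps.
  The continuation therefore runs in \<nu> by unit steps with m fixed. The condition on \<nu> keeps
  \<nu> - m off the poles of Gamma and the denominators off 0.\<close>

lemma lower_beta_eq:
  fixes \<nu> m :: real
  assumes m: "m > 0" and \<nu>: "\<nu> > 0" and nz: "\<And>l::nat. \<nu> + real l \<noteq> m"
  shows "lower_beta \<nu> m + (\<Sum>l. ((- \<nu>) gchoose l) * (2 powr (m - \<nu> - real l) / (\<nu> + real l - m))) = Gamma m * Gamma (\<nu> - m) / Gamma \<nu>"
proof -
  have "\<forall>\<nu>>0. \<nu> + real N > m \<longrightarrow> (\<forall>l::nat. \<nu> + real l \<noteq> m) \<longrightarrow>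
     lower_beta \<nu> m + (\<Sum>l. ((- \<nu>) gchoose l) * (2 powr (m - \<nu> - real l) / (\<nu> + real l - m))) = Gamma m * Gamma (\<nu> - m) / Gamma \<nu>" for N
  proof (induction N)
    case 0
    thus ?case using lower_beta_eq_of_less[OF m] by simp
  next
    case (Suc N)
    show ?case
    proof (intro allI impI)
      fix \<nu> :: real
      assume \<nu>: "\<nu> > 0" and N: "\<nu> + real (Suc N) > m" and nz: "\<forall>l::nat. \<nu> + real l \<noteq> m"
      define S where "S = (\<lambda>\<nu>. \<Sum>l. ((- \<nu>) gchoose l) * (2 powr (m - \<nu> - real l) / (\<nu> + real l - m)))"
      define R where "R = (\<lambda>\<nu>. Gamma m * Gamma (\<nu> - m) / Gamma \<nu>)"
      have eq: "\<nu> + 1 + real l = \<nu> + real (Suc l)" for l by simp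
      have IH: "lower_beta (\<nu> + 1) m + S (\<nu> + 1) = R (\<nu> + 1)"
        unfolding S_def R_def
        by (rule Suc.IH[rule_format]) (use N nz \<nu> in \<open>simp_all only: eq, simp_all\<close>)
      have R: "\<nu> * R (\<nu> + 1) = (\<nu> - m) * R \<nu>"
      proof -
        have "\<nu> - m \<notin> \<int>\<^sub>\<le>\<^sub>0"
        proof
          assume "\<nu> - m \<in> \<int>\<^sub>\<le>\<^sub>0"
          then obtain j :: nat where "\<nu> - m = - real j" by (elim nonpos_Ints_cases') auto
          thus False using nz[rule_format, of j] by simp
        qed
        hence 1: "Gamma (\<nu> + 1 - m) = (\<nu> - m) * Gamma (\<nu> - m)"
          using Gamma_plus1[of "\<nu> - m"] by (simp add: algebra_simps)
        have 2: "Gamma (\<nu> + 1) = \<nu> * Gamma \<nu>" using Gamma_plus1[of \<nu>] \<nu> nonpos_Ints_nonpos[of \<nu>] by force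
        show ?thesis unfolding R_def 1 2 using \<nu> by simp
      qed
      \<comment> \<open>Write \<open>(\<nu> - m) / (\<nu> + l - m)\<close> as
        \<open>1 - l / (\<nu> + l - m)\<close>. The constant 1 gives the binomial series at the cut,
        hence a power of 3; the factor l removes the term l = 0, and
        \<open>gbinomial_uminus_Suc\<close> identifies the shifted rest with the series at \<nu> +
        1.\<close>
      have S: "(\<nu> - m) * S \<nu> = 2 powr m * 3 powr (- \<nu>) + \<nu> * S (\<nu> + 1)"
      proof -
        let ?t = "\<lambda>\<nu> l. ((- \<nu>) gchoose l) * (2 powr (m - \<nu> - real l) / (\<nu> + real l - m))"
        have sm: "summable (?t \<nu>)" for \<nu>
          using summable_gbinomial_coeff by (rule summable_rabs_cancel)
        have e: "(\<lambda>l. 2 powr m * (((- \<nu>) gchoose l) * 2 powr (- \<nu> - real l))) sums (2 powr m * 3 powr (- \<nu>))"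
          using gbinomial_powr_sums[of 2 \<nu>] by (intro sums_mult) simp
        have t: "(\<nu> - m) * ?t \<nu> l = 2 powr m * (((- \<nu>) gchoose l) * 2 powr (- \<nu> - real l)) - real l * ?t \<nu> l" for l
        proof -
          define T where "T = ?t \<nu> l"
          have "2 powr m * 2 powr (- \<nu> - real l) = 2 powr (m - \<nu> - real l)"
            by (simp add: powr_add[symmetric] algebra_simps)
          hence "2 powr m * (((- \<nu>) gchoose l) * 2 powr (- \<nu> - real l)) = ((- \<nu>) gchoose l) * 2 powr (m - \<nu> - real l)"
            by (simp add: mult.left_commute)
          also have "\<dots> = (\<nu> + real l - m) * T" using nz by (simp add: T_def)
          finally show ?thesis unfolding T_def[symmetric] by (simp add: algebra_simps)
        qed
        have "(\<lambda>l. 2 powr m * (((- \<nu>) gchoose l) * 2 powr (- \<nu> - real l)) - (\<nu> - m) * ?t \<nu> l) sums (2 powr m * 3 powr (- \<nu>) - (\<nu> - m) * S \<nu>)"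
          unfolding S_def by (intro sums_diff e sums_mult summable_sums sm)
        hence A: "(\<lambda>l. real l * ?t \<nu> l) sums (2 powr m * 3 powr (- \<nu>) - (\<nu> - m) * S \<nu>)"
          unfolding t by simp
        have B: "(\<lambda>l. real (Suc l) * ?t \<nu> (Suc l)) sums (2 powr m * 3 powr (- \<nu>) - (\<nu> - m) * S \<nu>)"
          using A by (subst sums_Suc_iff) simp
        have "real (Suc l) * ?t \<nu> (Suc l) = - \<nu> * ?t (\<nu> + 1) l" for l
        proof -
          define X where "X = 2 powr (m - (\<nu> + 1) - real l) / (\<nu> + 1 + real l - m)"
          have e: "m - \<nu> - real (Suc l) = m - (\<nu> + 1) - real l" "\<nu> + real (Suc l) - m = \<nu> + 1 + real l - m" by simp_all
          have "real (Suc l) * (((- \<nu>) gchoose Suc l) * X) = - \<nu> * (((- (\<nu> + 1)) gchoose l) * X)"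
            unfolding mult.assoc[symmetric] gbinomial_uminus_Suc ..
          thus ?thesis unfolding e X_def .
        qed
        hence "(\<lambda>l. - \<nu> * ?t (\<nu> + 1) l) sums (2 powr m * 3 powr (- \<nu>) - (\<nu> - m) * S \<nu>)"
          using B by simp
        moreover have "(\<lambda>l. - \<nu> * ?t (\<nu> + 1) l) sums (- \<nu> * S (\<nu> + 1))"
          unfolding S_def by (intro sums_mult summable_sums sm)
        ultimately have "2 powr m * 3 powr (- \<nu>) - (\<nu> - m) * S \<nu> = - \<nu> * S (\<nu> + 1)"
          by (rule sums_unique2)
        thus ?thesis by simp
      qed
      have "(\<nu> - m) * (lower_beta \<nu> m + S \<nu>) = \<nu> * (lower_beta (\<nu> + 1) m + S (\<nu> + 1))"
        using lower_beta_recursion[OF m \<nu>] S by (simp add: algebra_simps)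
      hence "(\<nu> - m) * (lower_beta \<nu> m + S \<nu>) = (\<nu> - m) * R \<nu>" unfolding IH R .
      moreover have "\<nu> - m \<noteq> 0" using nz[rule_format, of 0] by simp
      ultimately have "lower_beta \<nu> m + S \<nu> = R \<nu>" by simp
      thus "lower_beta \<nu> m + (\<Sum>l. ((- \<nu>) gchoose l) * (2 powr (m - \<nu> - real l) / (\<nu> + real l - m))) = Gamma m * Gamma (\<nu> - m) / Gamma \<nu>"
        unfolding S_def R_def .
    qed
  qed
  moreover obtain N :: nat where "real N > m - \<nu>" using reals_Archimedean2 by blast
  hence "\<nu> + real N > m" by simp
  ultimately show ?thesis using \<nu> nz by blast
qed

section \<open>Expansion of the split integral\<close>

text \<open>Applied with \<beta> = 2 / \<alpha> and \<mu> = n / \<alpha>. By \<open>sep\<close> the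
  denominators of the double boundary sum are bounded away from 0 uniformly in both indices.\<close>

context
  fixes \<beta> \<mu> \<nu> \<delta> :: real
  assumes \<beta>: "\<beta> > 0" and \<mu>: "\<mu> > 0" and \<nu>: "\<nu> > 0" and \<delta>: "\<delta> > 0"
    and sep: "\<And>(l::nat) (j::nat). \<bar>\<mu> - \<nu> - real l + \<beta> * real j\<bar> \<ge> \<delta>"
begin

text \<open>Replacing the denominator by \<delta> decouples l from j, which leaves the product bound
  required for exchanging the sums.\<close>

lemma double_coeff_bound:
  assumes c: "c > 0"
  shows "\<bar>(- c) ^ j / fact j * (2 powr (\<mu> - \<nu> - real l + \<beta> * real j) / (\<mu> - \<nu> - real l + \<beta> * real j))\<bar>
    \<le> (1/2) ^ l * (2 powr (\<mu> - \<nu>) / \<delta> * ((c * 2 powr \<beta>) ^ j / fact j))"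
proof -
  have p: "2 powr (\<mu> - \<nu> - real l + \<beta> * real j) = 2 powr (\<mu> - \<nu>) * (1/2) ^ l * (2 powr \<beta>) ^ j"
    unfolding powr_add powr_diff[of 2 "\<mu> - \<nu>" "real l"]
    by (simp add: powr_realpow power_one_over powr_powr[symmetric])
  have "\<bar>(- c) ^ j / fact j * (2 powr (\<mu> - \<nu> - real l + \<beta> * real j) / (\<mu> - \<nu> - real l + \<beta> * real j))\<bar>
     = (2 powr (\<mu> - \<nu>) * (1/2) ^ l * (c * 2 powr \<beta>) ^ j / fact j) / \<bar>\<mu> - \<nu> - real l + \<beta> * real j\<bar>"
    unfolding p using c by (simp add: abs_mult power_abs power_mult_distrib)
  also have "\<dots> \<le> (2 powr (\<mu> - \<nu>) * (1/2) ^ l * (c * 2 powr \<beta>) ^ j / fact j) / \<delta>"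
    using sep[of l j] \<delta> c by (intro divide_left_mono) (auto intro!: mult_pos_pos)
  finally show ?thesis by (simp add: mult_ac)
qed

lemma summable_double_coeff_bound: "summable (\<lambda>j. 2 powr (\<mu> - \<nu>) / \<delta> * ((c * 2 powr \<beta>) ^ j / fact j))"
  using summable_exp_generic[of "c * 2 powr \<beta>"] by (intro summable_mult) (simp add: field_simps)

lemma upper_exp_eq':
  assumes c: "c > 0"
  shows "upper_exp c \<beta> (\<mu> - \<nu> - real l) = c powr (- (\<mu> - \<nu> - real l) / \<beta>) * Gamma ((\<mu> - \<nu> - real l) / \<beta>) / \<beta>
     - (\<Sum>j. (- c) ^ j / fact j * (2 powr (\<mu> - \<nu> - real l + \<beta> * real j) / (\<mu> - \<nu> - real l + \<beta> * real j)))"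
proof (rule upper_exp_eq[OF c \<beta>])
  show "\<mu> - \<nu> - real l + \<beta> * real j \<noteq> 0" for j using sep[of l j] \<delta> by force
qed

lemma lower_beta_eq':
  "lower_beta \<nu> (\<mu> + \<beta> * real j) + (\<Sum>l. ((- \<nu>) gchoose l) * (2 powr (\<mu> + \<beta> * real j - \<nu> - real l) / (\<nu> + real l - (\<mu> + \<beta> * real j))))
    = Gamma (\<mu> + \<beta> * real j) * Gamma (\<nu> - (\<mu> + \<beta> * real j)) / Gamma \<nu>"
proof (rule lower_beta_eq)
  show "\<mu> + \<beta> * real j > 0" using \<mu> \<beta> by (simp add: add_pos_nonneg)
  show "\<nu> + real l \<noteq> \<mu> + \<beta> * real j" for l using sep[of l j] \<delta> by force
qed (rule \<nu>)

text \<open>Read \<open>upper_exp_eq'\<close> as a formula for the Gamma term: the integral decays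
  like \<open>(1/2) ^ l\<close>, and so does the boundary series because of \<delta>. Here c is
  still free, and varying it turns this rate into convergence for every radius.\<close>

lemma Gamma_upper_bound:
  assumes c: "c > 0"
  obtains D where "\<And>l. \<bar>c powr (- (\<mu> - \<nu> - real l) / \<beta>) * Gamma ((\<mu> - \<nu> - real l) / \<beta>) / \<beta>\<bar> \<le> D * (1/2) ^ l"
proof
  fix l :: nat
  let ?B = "\<lambda>j. 2 powr (\<mu> - \<nu>) / \<delta> * ((c * 2 powr \<beta>) ^ j / fact j)"
  let ?t = "\<lambda>j. (- c) ^ j / fact j * (2 powr (\<mu> - \<nu> - real l + \<beta> * real j) / (\<mu> - \<nu> - real l + \<beta> * real j))"
  have sB: "summable (\<lambda>j. (1/2) ^ l * ?B j)" by (intro summable_mult summable_double_coeff_bound)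
  have st: "summable (\<lambda>j. \<bar>?t j\<bar>)"
    by (rule summable_comparison_test'[OF sB]) (use double_coeff_bound[OF c] in simp)
  have "\<bar>\<Sum>j. ?t j\<bar> \<le> (\<Sum>j. \<bar>?t j\<bar>)" by (rule summable_rabs[OF st])
  also have "\<dots> \<le> (\<Sum>j. (1/2) ^ l * ?B j)" by (rule suminf_le[OF double_coeff_bound[OF c] st sB])
  also have "\<dots> = (1/2) ^ l * (\<Sum>j. ?B j)" by (rule suminf_mult[OF summable_double_coeff_bound])
  finally have 1: "\<bar>\<Sum>j. ?t j\<bar> \<le> (1/2) ^ l * (\<Sum>j. ?B j)" .
  have "\<bar>upper_exp c \<beta> (\<mu> - \<nu> - real l)\<bar> \<le> (1/2) ^ l * upper_exp c \<beta> (\<mu> - \<nu>)"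
    using upper_exp_shift_le[OF c \<beta>] upper_exp_nonneg[of c \<beta> "\<mu> - \<nu> - real l"] by simp
  with 1 upper_exp_eq'[OF c, of l]
  show "\<bar>c powr (- (\<mu> - \<nu> - real l) / \<beta>) * Gamma ((\<mu> - \<nu> - real l) / \<beta>) / \<beta>\<bar> \<le> (upper_exp c \<beta> (\<mu> - \<nu>) + (\<Sum>j. ?B j)) * (1/2) ^ l"
    unfolding distrib_right by (simp only: mult.commute[of _ "(1/2) ^ l"])
qed

lemma summable_upper_terms:
  assumes c: "c > 0"
  shows "summable (\<lambda>l. \<bar>((- \<nu>) gchoose l) * (c powr (- (\<mu> - \<nu> - real l) / \<beta>) * Gamma ((\<mu> - \<nu> - real l) / \<beta>) / \<beta>)\<bar>)"
proof -
  obtain D where D: "\<And>l. \<bar>c powr (- (\<mu> - \<nu> - real l) / \<beta>) * Gamma ((\<mu> - \<nu> - real l) / \<beta>) / \<beta>\<bar> \<le> D * (1/2) ^ l"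
    using Gamma_upper_bound[OF c] by blast
  have s: "summable (\<lambda>l. D * (\<bar>(- \<nu>) gchoose l\<bar> * (1/2) ^ l))" by (intro summable_mult summable_abs_gbinomial)
  show ?thesis
  proof (rule summable_comparison_test'[OF s])
    fix l
    show "norm \<bar>((- \<nu>) gchoose l) * (c powr (- (\<mu> - \<nu> - real l) / \<beta>) * Gamma ((\<mu> - \<nu> - real l) / \<beta>) / \<beta>)\<bar> \<le> D * (\<bar>(- \<nu>) gchoose l\<bar> * (1/2) ^ l)"
      using mult_left_mono[OF D[of l] abs_ge_zero[of "(- \<nu>) gchoose l"]]
      unfolding abs_mult[symmetric] by (simp add: mult_ac)
  qed
qed

text \<open>The choice \<open>c = X powr \<beta>\<close> makes the power of c in
  \<open>summable_upper_terms\<close> equal to \<open>X ^ l\<close> up to a factor independent of l.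
  Hence the first series, stripped of its Gamma denominators, already has infinite radius of
  convergence.\<close>

lemma summable_upper_Gamma:
  assumes X: "X > 0"
  shows "summable (\<lambda>l. \<bar>((- \<nu>) gchoose l) * Gamma ((\<mu> - \<nu> - real l) / \<beta>)\<bar> * X ^ l)"
proof -
  have c: "X powr \<beta> > 0" using X by simp
  have e: "(X powr \<beta>) powr (- (\<mu> - \<nu> - real l) / \<beta>) = X powr (\<nu> - \<mu>) * X ^ l" for l
  proof -
    have "(X powr \<beta>) powr (- (\<mu> - \<nu> - real l) / \<beta>) = X powr (\<nu> - \<mu> + real l)"
    proof -
      have "\<beta> * (- (\<mu> - \<nu> - real l) / \<beta>) = \<nu> - \<mu> + real l" using \<beta> by simp
      thus ?thesis by (simp only: powr_powr)
    qed
    thus ?thesis using X by (simp add: powr_add powr_realpow)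
  qed
  have "summable (\<lambda>l. \<beta> * X powr (\<mu> - \<nu>) * \<bar>((- \<nu>) gchoose l) * ((X powr \<beta>) powr (- (\<mu> - \<nu> - real l) / \<beta>) * Gamma ((\<mu> - \<nu> - real l) / \<beta>) / \<beta>)\<bar>)"
    by (intro summable_mult summable_upper_terms c)
  also have "(\<lambda>l. \<beta> * X powr (\<mu> - \<nu>) * \<bar>((- \<nu>) gchoose l) * ((X powr \<beta>) powr (- (\<mu> - \<nu> - real l) / \<beta>) * Gamma ((\<mu> - \<nu> - real l) / \<beta>) / \<beta>)\<bar>)
    = (\<lambda>l. \<bar>((- \<nu>) gchoose l) * Gamma ((\<mu> - \<nu> - real l) / \<beta>)\<bar> * X ^ l)"
  proof
    fix l
    have "X powr (\<mu> - \<nu>) * X powr (\<nu> - \<mu>) = 1" using X by (simp add: powr_add[symmetric])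
    thus "\<beta> * X powr (\<mu> - \<nu>) * \<bar>((- \<nu>) gchoose l) * ((X powr \<beta>) powr (- (\<mu> - \<nu> - real l) / \<beta>) * Gamma ((\<mu> - \<nu> - real l) / \<beta>) / \<beta>)\<bar>
     = \<bar>((- \<nu>) gchoose l) * Gamma ((\<mu> - \<nu> - real l) / \<beta>)\<bar> * X ^ l"
      unfolding e using \<beta> X by (simp add: abs_mult)
  qed
  finally show ?thesis .
qed

text \<open>Read \<open>lower_beta_eq'\<close> as a formula for the Gamma product: the integral and
  the boundary series both grow at most like \<open>(2 powr \<beta>) ^ j\<close>.\<close>

lemma Gamma_lower_bound:
  obtains D where "\<And>j. \<bar>Gamma (\<mu> + \<beta> * real j) * Gamma (\<nu> - (\<mu> + \<beta> * real j))\<bar> \<le> D * (2 powr \<beta>) ^ j"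
proof
  fix j :: nat
  let ?m = "\<mu> + \<beta> * real j"
  let ?t = "\<lambda>l. ((- \<nu>) gchoose l) * (2 powr (?m - \<nu> - real l) / (\<nu> + real l - ?m))"
  have G: "Gamma \<nu> > 0" using \<nu> by simp
  have pj: "2 powr (\<beta> * real j) = (2 powr \<beta>) ^ j" by (simp add: powr_powr[symmetric] powr_realpow)
  have tb: "\<bar>?t l\<bar> \<le> 2 powr (\<mu> - \<nu>) / \<delta> * (2 powr \<beta>) ^ j * (\<bar>(- \<nu>) gchoose l\<bar> * (1/2) ^ l)" for l
  proof -
    have p: "2 powr (?m - \<nu> - real l) = 2 powr (\<mu> - \<nu>) * (1/2) ^ l * (2 powr \<beta>) ^ j"
    proof -
      have "?m - \<nu> - real l = \<mu> - \<nu> + \<beta> * real j - real l" by simp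
      thus ?thesis unfolding pj[symmetric] by (simp only: powr_diff powr_add) (simp add: powr_realpow power_one_over)
    qed
    have a: "\<bar>\<nu> + real l - ?m\<bar> \<ge> \<delta>" using sep[of l j] by linarith
    have "\<bar>?t l\<bar> = (2 powr (\<mu> - \<nu>) * (1/2) ^ l * (2 powr \<beta>) ^ j * \<bar>(- \<nu>) gchoose l\<bar>) / \<bar>\<nu> + real l - ?m\<bar>"
      unfolding p by (simp add: abs_mult)
    also have "\<dots> \<le> (2 powr (\<mu> - \<nu>) * (1/2) ^ l * (2 powr \<beta>) ^ j * \<bar>(- \<nu>) gchoose l\<bar>) / \<delta>"
      using a \<delta> by (intro divide_left_mono) (auto intro!: mult_pos_pos)
    finally show ?thesis by (simp add: mult_ac)
  qed
  have sB: "summable (\<lambda>l. 2 powr (\<mu> - \<nu>) / \<delta> * (2 powr \<beta>) ^ j * (\<bar>(- \<nu>) gchoose l\<bar> * (1/2) ^ l))"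
    by (intro summable_mult summable_abs_gbinomial)
  have st: "summable (\<lambda>l. \<bar>?t l\<bar>)" by (rule summable_gbinomial_coeff)
  have "\<bar>\<Sum>l. ?t l\<bar> \<le> (\<Sum>l. \<bar>?t l\<bar>)" by (rule summable_rabs[OF st])
  also have "\<dots> \<le> (\<Sum>l. 2 powr (\<mu> - \<nu>) / \<delta> * (2 powr \<beta>) ^ j * (\<bar>(- \<nu>) gchoose l\<bar> * (1/2) ^ l))"
    by (rule suminf_le[OF tb st sB])
  also have "\<dots> = 2 powr (\<mu> - \<nu>) / \<delta> * (2 powr \<beta>) ^ j * (\<Sum>l. \<bar>(- \<nu>) gchoose l\<bar> * (1/2) ^ l)"
    by (rule suminf_mult[OF summable_abs_gbinomial])
  finally have 1: "\<bar>\<Sum>l. ?t l\<bar> \<le> 2 powr (\<mu> - \<nu>) / \<delta> * (2 powr \<beta>) ^ j * (\<Sum>l. \<bar>(- \<nu>) gchoose l\<bar> * (1/2) ^ l)" .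
  have 2: "\<bar>lower_beta \<nu> ?m\<bar> \<le> (2 powr \<beta>) ^ j * lower_beta \<nu> \<mu>"
    using lower_beta_add_le[OF \<mu> \<nu>, of "\<beta> * real j"] lower_beta_nonneg[of \<nu> ?m] \<beta> by (simp add: pj)
  have "\<bar>Gamma ?m * Gamma (\<nu> - ?m)\<bar> = Gamma \<nu> * \<bar>lower_beta \<nu> ?m + (\<Sum>l. ?t l)\<bar>"
    unfolding lower_beta_eq' using G by (simp add: abs_mult)
  also have "\<dots> \<le> Gamma \<nu> * ((2 powr \<beta>) ^ j * lower_beta \<nu> \<mu> + 2 powr (\<mu> - \<nu>) / \<delta> * (2 powr \<beta>) ^ j * (\<Sum>l. \<bar>(- \<nu>) gchoose l\<bar> * (1/2) ^ l))"
    using 1 2 G by (intro mult_left_mono) linarith+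
  finally show "\<bar>Gamma ?m * Gamma (\<nu> - ?m)\<bar> \<le> Gamma \<nu> * (lower_beta \<nu> \<mu> + 2 powr (\<mu> - \<nu>) / \<delta> * (\<Sum>l. \<bar>(- \<nu>) gchoose l\<bar> * (1/2) ^ l)) * (2 powr \<beta>) ^ j"
    by (simp add: algebra_simps)
qed

lemma summable_lower_Gamma:
  assumes X: "X > 0"
  shows "summable (\<lambda>j. \<bar>Gamma (\<mu> + \<beta> * real j) * Gamma (\<nu> - (\<mu> + \<beta> * real j))\<bar> / fact j * X ^ j)"
proof -
  obtain D where D: "\<And>j. \<bar>Gamma (\<mu> + \<beta> * real j) * Gamma (\<nu> - (\<mu> + \<beta> * real j))\<bar> \<le> D * (2 powr \<beta>) ^ j"
    using Gamma_lower_bound by blast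
  have s: "summable (\<lambda>j. D * ((2 powr \<beta> * X) ^ j / fact j))"
    using summable_exp_generic[of "2 powr \<beta> * X"] by (intro summable_mult) (simp add: field_simps)
  show ?thesis
  proof (rule summable_comparison_test'[OF s])
    fix j
    have "norm (\<bar>Gamma (\<mu> + \<beta> * real j) * Gamma (\<nu> - (\<mu> + \<beta> * real j))\<bar> / fact j * X ^ j) = \<bar>Gamma (\<mu> + \<beta> * real j) * Gamma (\<nu> - (\<mu> + \<beta> * real j))\<bar> * (X ^ j / fact j)"
      using X by (simp add: abs_mult)
    also have "\<dots> \<le> D * (2 powr \<beta>) ^ j * (X ^ j / fact j)"
      using X by (intro mult_right_mono D) auto
    finally show "norm (\<bar>Gamma (\<mu> + \<beta> * real j) * Gamma (\<nu> - (\<mu> + \<beta> * real j))\<bar> / fact j * X ^ j) \<le> D * ((2 powr \<beta> * X) ^ j / fact j)"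
      by (simp add: power_mult_distrib mult_ac)
  qed
qed

lemma lower_part_sums:
  assumes c: "c > 0"
  shows "integrable lborel (\<lambda>v. indicator {0<..2} v * ((1 + v) powr (- \<nu>) * exp (- c * v powr \<beta>) * v powr (\<mu> - 1)))"
    and "(\<lambda>j. (- c) ^ j / fact j * lower_beta \<nu> (\<mu> + \<beta> * real j)) sums
      (LINT v|lborel. indicator {0<..2} v * ((1 + v) powr (- \<nu>) * exp (- c * v powr \<beta>) * v powr (\<mu> - 1)))"
proof -
  let ?g = "\<lambda>v. (1 + v) powr (- \<nu>) * exp (- c * v powr \<beta>) * v powr (\<mu> - 1)"
  define f where "f = (\<lambda>j v. (- c) ^ j / fact j * (indicator {0<..2} v * ((1 + v) powr (- \<nu>) * v powr (\<mu> + \<beta> * real j - 1))))"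
  have m: "\<mu> + \<beta> * real j > 0" for j using \<mu> \<beta> by (simp add: add_pos_nonneg)
  have fi: "integrable lborel (f j)" and fI: "integral\<^sup>L lborel (f j) = (- c) ^ j / fact j * lower_beta \<nu> (\<mu> + \<beta> * real j)" for j
    unfolding f_def lower_beta_def using integrable_lower_beta[OF m \<nu>] by auto
  have nf: "(LINT v|lborel. norm (f j v)) = c ^ j / fact j * lower_beta \<nu> (\<mu> + \<beta> * real j)" for j
    unfolding f_def lower_beta_def using c
    by (subst integral_mult_right_zero[symmetric], intro Bochner_Integration.integral_cong refl) (simp add: abs_mult power_abs)
  have fs: "f j v = indicator {0<..2} v * ((1 + v) powr (- \<nu>) * v powr (\<mu> - 1)) * ((- c * v powr \<beta>) ^ j /\<^sub>R fact j)" for j v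
    unfolding power_mult_distrib
    by (cases "v > 0") (auto simp: f_def powr_add powr_diff powr_powr[symmetric] powr_realpow field_simps)
  have s1: "summable (\<lambda>j. norm (f j v))" for v
    unfolding fs norm_mult by (intro summable_mult summable_norm_exp)
  have "(\<lambda>j. f j v) sums (indicator {0<..2} v * ((1 + v) powr (- \<nu>) * v powr (\<mu> - 1)) * exp (- c * v powr \<beta>))" for v
    unfolding fs by (intro sums_mult exp_converges)
  hence s2: "(\<Sum>j. f j v) = indicator {0<..2} v * ?g v" for v by (simp add: sums_iff mult_ac)
  have "summable (\<lambda>j. (c * 2 powr \<beta>) ^ j / fact j * lower_beta \<nu> \<mu>)"
    using summable_exp_generic[of "c * 2 powr \<beta>"] by (intro summable_mult2) (simp add: field_simps)
  hence sn: "summable (\<lambda>j. LINT v|lborel. norm (f j v))"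
  proof (rule summable_comparison_test')
    fix j :: nat
    have pj: "2 powr (\<beta> * real j) = (2 powr \<beta>) ^ j" by (simp add: powr_powr[symmetric] powr_realpow)
    have "lower_beta \<nu> (\<mu> + \<beta> * real j) \<le> (2 powr \<beta>) ^ j * lower_beta \<nu> \<mu>"
      using lower_beta_add_le[OF \<mu> \<nu>, of "\<beta> * real j"] \<beta> by (simp add: pj)
    hence "c ^ j / fact j * lower_beta \<nu> (\<mu> + \<beta> * real j) \<le> c ^ j / fact j * ((2 powr \<beta>) ^ j * lower_beta \<nu> \<mu>)"
      using c by (intro mult_left_mono) auto
    thus "norm (LINT v|lborel. norm (f j v)) \<le> (c * 2 powr \<beta>) ^ j / fact j * lower_beta \<nu> \<mu>"
      unfolding nf using c lower_beta_nonneg[of \<nu> "\<mu> + \<beta> * real j"] by (simp add: abs_mult power_mult_distrib)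
  qed
  have "(\<lambda>j. integral\<^sup>L lborel (f j)) sums (LINT v|lborel. (\<Sum>j. f j v))"
    by (rule sums_integral) (use fi s1 sn in auto)
  thus "(\<lambda>j. (- c) ^ j / fact j * lower_beta \<nu> (\<mu> + \<beta> * real j)) sums (LINT v|lborel. indicator {0<..2} v * ?g v)"
    unfolding s2 fI .
  have "integrable lborel (\<lambda>v. \<Sum>j. f j v)"
    by (rule integrable_suminf) (use fi s1 sn in auto)
  thus "integrable lborel (\<lambda>v. indicator {0<..2} v * ?g v)" unfolding s2 .
qed

text \<open>Only the binomial is expanded; the exponential stays inside \<open>upper_exp\<close> and
  secures convergence at infinity.\<close>

lemma upper_part_sums:
  assumes c: "c > 0"
  shows "integrable lborel (\<lambda>v. indicator {2<..} v * ((1 + v) powr (- \<nu>) * exp (- c * v powr \<beta>) * v powr (\<mu> - 1)))"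
    and "(\<lambda>l. ((- \<nu>) gchoose l) * upper_exp c \<beta> (\<mu> - \<nu> - real l)) sums
      (LINT v|lborel. indicator {2<..} v * ((1 + v) powr (- \<nu>) * exp (- c * v powr \<beta>) * v powr (\<mu> - 1)))"
proof -
  let ?g = "\<lambda>v. (1 + v) powr (- \<nu>) * exp (- c * v powr \<beta>) * v powr (\<mu> - 1)"
  define f where "f = (\<lambda>l v. ((- \<nu>) gchoose l) * (indicator {2<..} v * (exp (- c * v powr \<beta>) * v powr (\<mu> - \<nu> - real l - 1))))"
  have fi: "integrable lborel (f l)" and fI: "integral\<^sup>L lborel (f l) = ((- \<nu>) gchoose l) * upper_exp c \<beta> (\<mu> - \<nu> - real l)" for l
    unfolding f_def upper_exp_def using integrable_upper_exp[OF c \<beta>] by auto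
  have nf: "(LINT v|lborel. norm (f l v)) = \<bar>(- \<nu>) gchoose l\<bar> * upper_exp c \<beta> (\<mu> - \<nu> - real l)" for l
    unfolding f_def upper_exp_def
    by (subst integral_mult_right_zero[symmetric], intro Bochner_Integration.integral_cong refl) (simp add: abs_mult)
  have fs: "f l v = indicator {2<..} v * (exp (- c * v powr \<beta>) * v powr (\<mu> - 1)) * (((- \<nu>) gchoose l) * v powr (- \<nu> - real l))" for l v
  proof -
    have "v powr (\<mu> - \<nu> - real l - 1) = v powr (\<mu> - 1) * v powr (- \<nu> - real l)" by (simp add: powr_add[symmetric] algebra_simps)
    thus ?thesis by (simp add: f_def)
  qed
  have s1: "summable (\<lambda>l. norm (f l v))" for v
  proof (cases "v > 2")
    case True
    have "summable (\<lambda>l. exp (- c * v powr \<beta>) * v powr (\<mu> - 1) * v powr (- \<nu>) * (\<bar>(- \<nu>) gchoose l\<bar> * (1/2) ^ l))"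
      by (intro summable_mult summable_abs_gbinomial)
    thus ?thesis
    proof (rule summable_comparison_test'[where N = 0])
      fix l :: nat
      have "v powr (- \<nu> - real l) = v powr (- \<nu>) * (1 / v) ^ l"
        unfolding powr_diff[of v "- \<nu>" "real l"] using True by (simp add: powr_realpow power_one_over)
      also have "\<dots> \<le> v powr (- \<nu>) * (1/2) ^ l"
        using True by (intro mult_left_mono power_mono) (auto simp: field_simps)
      finally have "(exp (- c * v powr \<beta>) * v powr (\<mu> - 1)) * (\<bar>(- \<nu>) gchoose l\<bar> * v powr (- \<nu> - real l)) \<le> (exp (- c * v powr \<beta>) * v powr (\<mu> - 1)) * (\<bar>(- \<nu>) gchoose l\<bar> * (v powr (- \<nu>) * (1/2) ^ l))"
        by (intro mult_left_mono) auto
      thus "norm (norm (f l v)) \<le> exp (- c * v powr \<beta>) * v powr (\<mu> - 1) * v powr (- \<nu>) * (\<bar>(- \<nu>) gchoose l\<bar> * (1/2) ^ l)"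
        using True by (simp add: fs abs_mult mult_ac)
    qed
  qed (simp add: fs)
  have "(\<lambda>l. f l v) sums (indicator {2<..} v * (exp (- c * v powr \<beta>) * v powr (\<mu> - 1)) * (1 + v) powr (- \<nu>))" for v
    unfolding fs by (cases "v > 2") (auto intro!: sums_mult gbinomial_powr_sums)
  hence s2: "(\<Sum>l. f l v) = indicator {2<..} v * ?g v" for v by (simp add: sums_iff mult_ac)
  have "summable (\<lambda>l. \<bar>(- \<nu>) gchoose l\<bar> * (1/2) ^ l * upper_exp c \<beta> (\<mu> - \<nu>))"
    by (intro summable_mult2 summable_abs_gbinomial)
  hence sn: "summable (\<lambda>l. LINT v|lborel. norm (f l v))"
  proof (rule summable_comparison_test')
    fix l :: nat
    have "\<bar>(- \<nu>) gchoose l\<bar> * upper_exp c \<beta> (\<mu> - \<nu> - real l) \<le> \<bar>(- \<nu>) gchoose l\<bar> * ((1/2) ^ l * upper_exp c \<beta> (\<mu> - \<nu>))"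
      by (intro mult_left_mono upper_exp_shift_le c \<beta>) auto
    thus "norm (LINT v|lborel. norm (f l v)) \<le> \<bar>(- \<nu>) gchoose l\<bar> * (1/2) ^ l * upper_exp c \<beta> (\<mu> - \<nu>)"
      unfolding nf using upper_exp_nonneg[of c \<beta> "\<mu> - \<nu> - real l"] by (simp add: abs_mult)
  qed
  have "(\<lambda>l. integral\<^sup>L lborel (f l)) sums (LINT v|lborel. (\<Sum>l. f l v))"
    by (rule sums_integral) (use fi s1 sn in auto)
  thus "(\<lambda>l. ((- \<nu>) gchoose l) * upper_exp c \<beta> (\<mu> - \<nu> - real l)) sums (LINT v|lborel. indicator {2<..} v * ?g v)"
    unfolding s2 fI .
  have "integrable lborel (\<lambda>v. \<Sum>l. f l v)"
    by (rule integrable_suminf) (use fi s1 sn in auto)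
  thus "integrable lborel (\<lambda>v. indicator {2<..} v * ?g v)" unfolding s2 .
qed

lemma integral_one_plus_powr_exp:
  assumes c: "c > 0"
  shows "(LINT v|lborel. indicator {0<..} v * ((1 + v) powr (- \<nu>) * exp (- c * v powr \<beta>) * v powr (\<mu> - 1))) =
    (\<Sum>l. ((- \<nu>) gchoose l) * (c powr (- (\<mu> - \<nu> - real l) / \<beta>) * Gamma ((\<mu> - \<nu> - real l) / \<beta>) / \<beta>)) +
    (\<Sum>j. (- c) ^ j / fact j * (Gamma (\<mu> + \<beta> * real j) * Gamma (\<nu> - (\<mu> + \<beta> * real j)) / Gamma \<nu>))"
proof -
  let ?g = "\<lambda>v. (1 + v) powr (- \<nu>) * exp (- c * v powr \<beta>) * v powr (\<mu> - 1)"
  let ?b = "\<lambda>l. (- \<nu>) gchoose l"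
  let ?R = "\<lambda>l. c powr (- (\<mu> - \<nu> - real l) / \<beta>) * Gamma ((\<mu> - \<nu> - real l) / \<beta>) / \<beta>"
  \<comment> \<open>The boundary terms of the upper part. The sum of \<open>?b l * y l j\<close>
    enters with a minus sign through \<open>upper_exp_eq'\<close>.\<close>
  define y where "y = (\<lambda>l j. (- c) ^ j / fact j * (2 powr (\<mu> - \<nu> - real l + \<beta> * real j) / (\<mu> - \<nu> - real l + \<beta> * real j)))"
  define B where "B = (\<lambda>j. 2 powr (\<mu> - \<nu>) / \<delta> * ((c * 2 powr \<beta>) ^ j / fact j))"
  have yB: "\<bar>y l j\<bar> \<le> (1/2) ^ l * B j" for l j
    unfolding y_def B_def by (rule double_coeff_bound[OF c])
  have B: "summable B" unfolding B_def by (rule summable_double_coeff_bound)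
  have B0: "B j \<ge> 0" for j unfolding B_def using c \<delta> by simp
  have bound: "\<bar>?b l * y l j\<bar> \<le> (\<bar>?b l\<bar> * (1/2) ^ l) * B j" for l j
    using mult_left_mono[OF yB[of l j] abs_ge_zero[of "?b l"]] by (simp add: abs_mult mult_ac)
  note swap = suminf_swap_of_product_bound[OF bound summable_abs_gbinomial B B0]
  have sy: "summable (y l)" for l
    by (rule summable_rabs_cancel, rule summable_comparison_test'[OF summable_mult[OF B, of "(1/2) ^ l"]]) (use yB in simp)
  have U: "?b l * upper_exp c \<beta> (\<mu> - \<nu> - real l) = ?b l * ?R l - (\<Sum>j. ?b l * y l j)" for l
    unfolding upper_exp_eq'[OF c] suminf_mult[OF sy] right_diff_distrib unfolding y_def ..
  have sR: "summable (\<lambda>l. ?b l * ?R l)"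
    by (rule summable_rabs_cancel[OF summable_upper_terms[OF c]])
  have Usum: "(LINT v|lborel. indicator {2<..} v * ?g v) = (\<Sum>l. ?b l * ?R l) - (\<Sum>j. \<Sum>l. ?b l * y l j)"
    using upper_part_sums(2)[OF c] suminf_diff[OF sR swap(2)] unfolding U sums_iff swap(1) by simp
  \<comment> \<open>For fixed j the sum over l is, up to the sign of the denominator, the boundary
    series of \<open>lower_beta_eq'\<close>. Subtracting it therefore completes each incomplete Beta
    integral to its Gamma quotient.\<close>
  have Y: "(\<Sum>l. ?b l * y l j) = - ((- c) ^ j / fact j * (\<Sum>l. ?b l * (2 powr (\<mu> + \<beta> * real j - \<nu> - real l) / (\<nu> + real l - (\<mu> + \<beta> * real j)))))" for j
  proof -
    have "?b l * y l j = - ((- c) ^ j / fact j) * (?b l * (2 powr (\<mu> + \<beta> * real j - \<nu> - real l) / (\<nu> + real l - (\<mu> + \<beta> * real j))))" for l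
    proof -
      have e: "\<mu> - \<nu> - real l + \<beta> * real j = \<mu> + \<beta> * real j - \<nu> - real l" "\<mu> + \<beta> * real j - \<nu> - real l = - (\<nu> + real l - (\<mu> + \<beta> * real j))"
        by simp_all
      define K where "K = 2 powr (\<mu> + \<beta> * real j - \<nu> - real l)"
      define L where "L = \<nu> + real l - (\<mu> + \<beta> * real j)"
      have "y l j = (- c) ^ j / fact j * (K / (- L))"
        unfolding y_def e(1) K_def[symmetric] unfolding e(2) L_def ..
      thus ?thesis unfolding K_def[symmetric] L_def[symmetric] by simp
    qed
    moreover have "summable (\<lambda>l. ?b l * (2 powr (\<mu> + \<beta> * real j - \<nu> - real l) / (\<nu> + real l - (\<mu> + \<beta> * real j))))"
      using summable_gbinomial_coeff by (rule summable_rabs_cancel)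
    ultimately show ?thesis by (simp only: suminf_mult)
  qed
  have Lsum: "(LINT v|lborel. indicator {0<..2} v * ?g v) = (\<Sum>j. (- c) ^ j / fact j * lower_beta \<nu> (\<mu> + \<beta> * real j))"
    and Ls: "summable (\<lambda>j. (- c) ^ j / fact j * lower_beta \<nu> (\<mu> + \<beta> * real j))"
    using lower_part_sums(2)[OF c] by (simp_all add: sums_iff)
  have "(LINT v|lborel. indicator {0<..} v * ?g v) = (LINT v|lborel. indicator {0<..2} v * ?g v + indicator {2<..} v * ?g v)"
    by (intro Bochner_Integration.integral_cong refl) (auto simp: indicator_def)
  also have "\<dots> = (LINT v|lborel. indicator {0<..2} v * ?g v) + (LINT v|lborel. indicator {2<..} v * ?g v)"
    by (rule Bochner_Integration.integral_add[OF lower_part_sums(1)[OF c] upper_part_sums(1)[OF c]])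
  also have "\<dots> = (\<Sum>l. ?b l * ?R l) + ((\<Sum>j. (- c) ^ j / fact j * lower_beta \<nu> (\<mu> + \<beta> * real j)) - (\<Sum>j. \<Sum>l. ?b l * y l j))"
    unfolding Lsum Usum by simp
  also have "(\<Sum>j. (- c) ^ j / fact j * lower_beta \<nu> (\<mu> + \<beta> * real j)) - (\<Sum>j. \<Sum>l. ?b l * y l j) =
     (\<Sum>j. (- c) ^ j / fact j * lower_beta \<nu> (\<mu> + \<beta> * real j) - (\<Sum>l. ?b l * y l j))"
    by (rule suminf_diff[OF Ls swap(3)])
  also have "\<dots> = (\<Sum>j. (- c) ^ j / fact j * (Gamma (\<mu> + \<beta> * real j) * Gamma (\<nu> - (\<mu> + \<beta> * real j)) / Gamma \<nu>))"
    unfolding Y lower_beta_eq'[symmetric] by (simp only: diff_minus_eq_add distrib_left)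
  finally show ?thesis .
qed

end

section \<open>Uniqueness from Gaussian integrals\<close>

text \<open>Vanishing moments annihilate all polynomials in w, and \<phi> is a uniform limit of
  polynomials on [0,1]; the error of the integral is at most e times the L1 norm of f. Values in a
  Banach space allow real and complex use.\<close>

lemma integral_continuous_eq_0_of_moments:
  fixes f :: "'a \<Rightarrow> 'b::{banach, second_countable_topology}" and w :: "'a \<Rightarrow> real"
  assumes f: "integrable M f" and w[measurable]: "w \<in> borel_measurable M"
    and w01: "\<And>x. w x \<in> {0..1}"
    and moments: "\<And>k::nat. (\<integral>x. w x ^ k *\<^sub>R f x \<partial>M) = 0"
    and \<phi>: "continuous_on {0..1} \<phi>"
  shows "(\<integral>x. \<phi> (w x) *\<^sub>R f x \<partial>M) = 0"
proof -
  have [measurable]: "f \<in> borel_measurable M" using f by auto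
  \<comment> \<open>Clamping extends \<phi> continuously to the line, which gives measurability of
    the composition; on the range of w nothing changes.\<close>
  define \<phi>' where "\<phi>' = (\<lambda>u::real. \<phi> (max 0 (min 1 u)))"
  have "continuous_on UNIV \<phi>'"
    unfolding \<phi>'_def by (rule continuous_on_compose2[OF \<phi>]) (auto intro!: continuous_intros)
  hence [measurable]: "\<phi>' \<in> borel_measurable borel" by (rule borel_measurable_continuous_onI)
  have \<phi>': "\<phi> (w x) = \<phi>' (w x)" for x using w01[of x] by (auto simp: \<phi>'_def)
  have bounded_int: "integrable M (\<lambda>x. g (w x) *\<^sub>R f x)"
    if [measurable]: "g \<in> borel_measurable borel" and B: "\<And>u. u \<in> {0..1} \<Longrightarrow> \<bar>g u\<bar> \<le> B" for g :: "real \<Rightarrow> real" and B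
  proof (rule Bochner_Integration.integrable_bound)
    show "integrable M (\<lambda>x. B *\<^sub>R norm (f x))" using f by auto
    show "AE x in M. norm (g (w x) *\<^sub>R f x) \<le> norm (B *\<^sub>R norm (f x))"
    proof (intro AE_I2)
      fix x
      have "\<bar>g (w x)\<bar> \<le> \<bar>B\<bar>" using B[OF w01[of x]] by linarith
      thus "norm (g (w x) *\<^sub>R f x) \<le> norm (B *\<^sub>R norm (f x))"
        by (simp add: abs_mult mult_right_mono)
    qed
  qed auto
  have int: "integrable M (\<lambda>x. g (w x) *\<^sub>R f x)"
    if "continuous_on UNIV g" for g :: "real \<Rightarrow> real"
  proof -
    have "compact (g ` {0..1})"
      by (rule compact_continuous_image) (use that continuous_on_subset in \<open>auto\<close>)
    from compact_imp_bounded[OF this] obtain B where "\<And>u. u \<in> {0..1} \<Longrightarrow> \<bar>g u\<bar> \<le> B"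
      by (metis bounded_iff imageI real_norm_def)
    thus ?thesis using bounded_int[OF borel_measurable_continuous_onI[OF that]] by blast
  qed
  have est: "norm (\<integral>x. \<phi> (w x) *\<^sub>R f x \<partial>M) \<le> e * (\<integral>x. norm (f x) \<partial>M)" if e: "e > 0" for e
  proof -
    obtain P where P: "real_polynomial_function P" "\<And>x. x \<in> {0..1} \<Longrightarrow> \<bar>\<phi> x - P x\<bar> < e"
      using Stone_Weierstrass_real_polynomial_function[OF _ \<phi> e] by auto
    then obtain a n where a: "P = (\<lambda>x. \<Sum>i\<le>n. a i * x ^ i)"
      by (auto simp: real_polynomial_function_iff_sum)
    have contP: "continuous_on UNIV P" unfolding a by (intro continuous_intros)
    have "(\<integral>x. P (w x) *\<^sub>R f x \<partial>M) = (\<integral>x. (\<Sum>i\<le>n. a i *\<^sub>R (w x ^ i *\<^sub>R f x)) \<partial>M)"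
      by (simp add: a scaleR_sum_left)
    also have "\<dots> = (\<Sum>i\<le>n. (\<integral>x. a i *\<^sub>R (w x ^ i *\<^sub>R f x) \<partial>M))"
    proof (rule Bochner_Integration.integral_sum)
      fix i show "integrable M (\<lambda>x. a i *\<^sub>R (w x ^ i *\<^sub>R f x))"
        by (intro integrable_scaleR_right int[of "\<lambda>u. u ^ i"] continuous_intros)
    qed
    also have "\<dots> = 0" by (simp only: integral_scaleR_right moments scaleR_zero_right sum.neutral_const)
    finally have P0: "(\<integral>x. P (w x) *\<^sub>R f x \<partial>M) = 0" .
    have i1: "integrable M (\<lambda>x. \<phi>' (w x) *\<^sub>R f x)" "integrable M (\<lambda>x. P (w x) *\<^sub>R f x)"
      using int contP \<open>continuous_on UNIV \<phi>'\<close> by auto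
    have "(\<integral>x. \<phi> (w x) *\<^sub>R f x \<partial>M) = (\<integral>x. \<phi>' (w x) *\<^sub>R f x - P (w x) *\<^sub>R f x \<partial>M)"
      using P0 i1 by (simp add: \<phi>')
    also have "norm \<dots> \<le> (\<integral>x. norm (\<phi>' (w x) *\<^sub>R f x - P (w x) *\<^sub>R f x) \<partial>M)"
      by (rule integral_norm_bound)
    also have "\<dots> \<le> (\<integral>x. e * norm (f x) \<partial>M)"
    proof (rule integral_mono)
      show "integrable M (\<lambda>x. norm (\<phi>' (w x) *\<^sub>R f x - P (w x) *\<^sub>R f x))"
        using i1 by auto
      show "integrable M (\<lambda>x. e * norm (f x))" using f by auto
      fix x
      have "norm (\<phi>' (w x) *\<^sub>R f x - P (w x) *\<^sub>R f x) = \<bar>\<phi> (w x) - P (w x)\<bar> * norm (f x)"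
        by (simp add: \<phi>' scaleR_diff_left[symmetric])
      also have "\<dots> \<le> e * norm (f x)"
        using P(2)[OF w01[of x]] by (intro mult_right_mono) auto
      finally show "norm (\<phi>' (w x) *\<^sub>R f x - P (w x) *\<^sub>R f x) \<le> e * norm (f x)" .
    qed
    finally show ?thesis by simp
  qed
  define I where "I = (\<integral>x. norm (f x) \<partial>M)"
  have I: "I \<ge> 0" unfolding I_def by (intro integral_nonneg_AE) auto
  have "norm (\<integral>x. \<phi> (w x) *\<^sub>R f x \<partial>M) \<le> 0 + e" if "e > 0" for e
  proof -
    \<comment> \<open>Dividing by \<open>I + 1\<close> rather than \<open>I\<close> covers an L1
      norm of 0.\<close>
    have "norm (\<integral>x. \<phi> (w x) *\<^sub>R f x \<partial>M) \<le> (e / (I + 1)) * I"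
      unfolding I_def by (rule est) (use that I in \<open>auto simp: I_def[symmetric]\<close>)
    also have "\<dots> \<le> e" using that I by (simp add: field_simps)
    finally show ?thesis by simp
  qed
  from field_le_epsilon[OF this] show ?thesis by simp
qed

lemma gaussian_moments_positive_shell:
  fixes f :: "'a::euclidean_space \<Rightarrow> real" and s l u :: real and x0 :: 'a
  assumes int: "integrable lborel (\<lambda>x. f x * exp (- s * (norm x)\<^sup>2))"
    and moments: "\<And>k::nat. (LINT x|lborel. f x * exp (- (s + real k) * (norm x)\<^sup>2)) = 0"
    and pos: "\<And>x. l < (norm x)\<^sup>2 \<Longrightarrow> (norm x)\<^sup>2 < u \<Longrightarrow> f x > 0"
    and x0: "l < (norm x0)\<^sup>2" "(norm x0)\<^sup>2 < u"
  shows False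
proof -
  let ?F = "\<lambda>x. f x * exp (- s * (norm x)\<^sup>2)" and ?w = "\<lambda>x::'a. exp (- (norm x)\<^sup>2)"
  \<comment> \<open>Positive exactly for \<open>exp (- u) < v < exp (- l)\<close>, which is the
    shell in the variable \<open>v = exp (- (norm x)^2)\<close>.\<close>
  define \<phi> where "\<phi> = (\<lambda>v::real. max 0 (v - exp (- u)) * max 0 (exp (- l) - v))"
  let ?W = "{x::'a. l < (norm x)\<^sup>2 \<and> (norm x)\<^sup>2 < u}"
  have "?w x ^ k *\<^sub>R ?F x = f x * exp (- (s + real k) * (norm x)\<^sup>2)" for x k
    by (simp add: exp_of_nat_mult[symmetric] exp_add[symmetric] algebra_simps)
  hence m0: "(LINT x|lborel. ?w x ^ k *\<^sub>R ?F x) = 0" for k using moments[of k] by (simp only:)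
  have c: "continuous_on {0..1} \<phi>" unfolding \<phi>_def by (intro continuous_intros)
  have 0: "(LINT x|lborel. \<phi> (?w x) *\<^sub>R ?F x) = 0"
    by (rule integral_continuous_eq_0_of_moments[OF int _ _ m0 c]) auto
  have iff: "\<phi> (?w x) > 0 \<longleftrightarrow> x \<in> ?W" for x
    by (auto simp: \<phi>_def zero_less_mult_iff max_def)
  have nn: "\<phi> v \<ge> 0" for v by (simp add: \<phi>_def)
  have ge: "\<phi> (?w x) *\<^sub>R ?F x \<ge> 0" for x
  proof (cases "x \<in> ?W")
    case True
    thus ?thesis using pos[of x] nn by (intro scaleR_nonneg_nonneg mult_nonneg_nonneg) (auto intro: less_imp_le)
  next
    case False
    hence "\<phi> (?w x) = 0" using iff[of x] nn[of "?w x"] by linarith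
    thus ?thesis by simp
  qed
  have "integrable lborel (\<lambda>x. \<phi> (?w x) *\<^sub>R ?F x)"
  proof (rule Bochner_Integration.integrable_bound)
    have [measurable]: "?F \<in> borel_measurable lborel" using int by auto
    show "integrable lborel (\<lambda>x. (1 + exp (- u)) * (1 + exp (- l)) * norm (?F x))"
      using int by auto
    have [measurable]: "\<phi> \<in> borel_measurable borel" unfolding \<phi>_def by measurable
    show "(\<lambda>x. \<phi> (?w x) *\<^sub>R ?F x) \<in> borel_measurable lborel" by measurable
    have "\<phi> (?w x) \<le> (1 + exp (- u)) * (1 + exp (- l))" for x
    proof -
      have "?w x \<le> 1" "0 < ?w x" "0 < exp (- u)" "0 < exp (- l)" by simp_all
      hence "max 0 (?w x - exp (- u)) \<le> 1 + exp (- u)" "max 0 (exp (- l) - ?w x) \<le> 1 + exp (- l)"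
        by linarith+
      thus ?thesis unfolding \<phi>_def by (intro mult_mono) auto
    qed
    thus "AE x in lborel. norm (\<phi> (?w x) *\<^sub>R ?F x) \<le> norm ((1 + exp (- u)) * (1 + exp (- l)) * norm (?F x))"
      using nn by (intro AE_I2) (simp add: abs_mult mult_right_mono)
  qed
  from integral_nonneg_eq_0_iff_AE[OF this] ge 0
  have "AE x in lborel. \<phi> (?w x) *\<^sub>R ?F x = 0" by simp
  hence "AE x in lborel. x \<notin> ?W"
  proof eventually_elim
    case (elim x)
    show ?case
    proof
      assume x: "x \<in> ?W"
      hence "\<phi> (?w x) > 0" "f x > 0" using iff[of x] pos[of x] by auto
      thus False using elim by simp
    qed
  qed
  moreover have op: "open ?W"
    by (intro open_Collect_conj open_Collect_less continuous_intros)
  ultimately have "?W \<in> null_sets lborel"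
    by (subst (asm) AE_iff_null_sets[symmetric]) auto
  hence "negligible ?W" by (simp add: negligible_iff_null_sets null_sets_completionI)
  moreover have "x0 \<in> ?W" using x0 by simp
  hence "?W \<noteq> {}" by (metis empty_iff)
  ultimately show False using open_not_negligible[OF op] by simp
qed

text \<open>Fourier inversion regularized by a Gaussian: the Gaussian around y is itself the Fourier
  transform of one with parameter \<open>1 / (4 * s)\<close>, and Fubini moves the transform onto p.
  No integrability of the characteristic function is involved.\<close>

lemma gaussian_smoothing:
  fixes p :: "'a::euclidean_space \<Rightarrow> real"
  assumes p: "integrable lborel p" and s: "s > 0"
  shows "complex_of_real ((4 * pi * s) powr (DIM('a) / 2)) *
      (CLINT x|lborel. complex_of_real (p x * exp (- s * (norm (x - y))\<^sup>2))) =
    (CLINT u|lborel. iexp (u \<bullet> (- y)) * complex_of_real (exp (- (1 / (4 * s)) * (norm u)\<^sup>2)) *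
       (CLINT x|lborel. iexp (x \<bullet> u) * complex_of_real (p x)))"
proof -
  let ?E = "\<lambda>u::'a. complex_of_real (exp (- (1 / (4 * s)) * (norm u)\<^sup>2))"
  let ?h = "\<lambda>x u. complex_of_real (p x) * (iexp (u \<bullet> (x - y)) * ?E u)"
  have [measurable]: "p \<in> borel_measurable borel" using p by auto
  have s': "1 / (4 * s) > 0" using s by simp
  have gi: "integrable lborel (\<lambda>u. iexp (u \<bullet> (x - y)) * ?E u)" for x
    using gaussian_fourier_integrable[OF s', of "x - y"] .
  have E: "integrable lborel ?E"
    using gaussian_fourier_integrable[OF s', of 0] by simp
  have int: "integrable (lborel \<Otimes>\<^sub>M lborel) (\<lambda>(x, u). ?h x u)"
  proof (rule lborel_pair.Fubini_integrable)
    show "(\<lambda>(x, u). ?h x u) \<in> borel_measurable (lborel \<Otimes>\<^sub>M lborel)" by measurable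
    show "AE x in lborel. integrable lborel (\<lambda>u. case (x, u) of (x, u) \<Rightarrow> ?h x u)"
      using gi by auto
    have "(\<lambda>x. LINT u|lborel. norm (case (x, u) of (x, u) \<Rightarrow> ?h x u)) = (\<lambda>x. norm (p x) * (LINT u|lborel. norm (?E u)))"
      by (simp add: norm_mult)
    thus "integrable lborel (\<lambda>x. LINT u|lborel. norm (case (x, u) of (x, u) \<Rightarrow> ?h x u))"
      using p by auto
  qed
  have cg: "(4 * pi * s) powr (DIM('a) / 2) = (pi / (1 / (4 * s))) powr (DIM('a) / 2)"
    by (simp add: field_simps)
  have "complex_of_real ((4 * pi * s) powr (DIM('a) / 2)) *
      (CLINT x|lborel. complex_of_real (p x * exp (- s * (norm (x - y))\<^sup>2))) =
     (CLINT x|lborel. complex_of_real (p x) * complex_of_real ((4 * pi * s) powr (DIM('a) / 2) * exp (- s * (norm (x - y))\<^sup>2)))"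
    using s by (subst integral_mult_right_zero[symmetric]) (simp add: powr_of_real mult_ac)
  also have "\<dots> = (CLINT x|lborel. CLINT u|lborel. ?h x u)"
    unfolding cg using gaussian_fourier[OF s', of "_ - y"] s by (simp add: field_simps)
  also have "\<dots> = (CLINT u|lborel. CLINT x|lborel. ?h x u)"
    by (rule lborel_pair.Fubini_integral[symmetric]) (rule int)
  also have "\<dots> = (CLINT u|lborel. CLINT x|lborel. iexp (u \<bullet> (- y)) * ?E u * (iexp (x \<bullet> u) * complex_of_real (p x)))"
    by (intro Bochner_Integration.integral_cong refl)
       (simp add: inner_diff_right exp_diff exp_minus inner_commute field_simps)
  also have "\<dots> = (CLINT u|lborel. iexp (u \<bullet> (- y)) * ?E u * (CLINT x|lborel. iexp (x \<bullet> u) * complex_of_real (p x)))"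
    by simp
  finally show ?thesis .
qed

text \<open>Rotation invariance is replaced by approximating a radial characteristic function by
  polynomials in \<open>exp (- (norm t)\<^sup>2)\<close>, whose Fourier transforms are explicit radial functions.\<close>

lemma radial_if_char_radial:
  fixes p :: "'a::euclidean_space \<Rightarrow> real"
  assumes p: "integrable lborel p"
    and char: "\<And>t. (CLINT x|lborel. iexp (x \<bullet> t) * complex_of_real (p x)) = complex_of_real (\<phi> (exp (- (norm t)\<^sup>2)))"
    and \<phi>: "continuous_on {0..1} \<phi>"
    and cont: "isCont p y" "isCont p z" and norm: "norm y = norm z"
  shows "p y = p z"
proof -
  have eq: "(LINT x|lborel. p x * exp (- s * (norm (x - y))\<^sup>2)) = (LINT x|lborel. p x * exp (- s * (norm (x - z))\<^sup>2))"
    if s: "s > 0" for s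
  proof -
    let ?E = "\<lambda>u::'a. complex_of_real (exp (- (1 / (4 * s)) * (norm u)\<^sup>2))"
    let ?f = "\<lambda>y u::'a. iexp (u \<bullet> (- y)) * ?E u"
    have s': "1 / (4 * s) > 0" using s by simp
    have gi: "integrable lborel (?f y)" for y
      using gaussian_fourier_integrable[OF s', of "- y"] .
    have w: "exp (- (norm u)\<^sup>2) ^ k *\<^sub>R ?f y u = iexp (u \<bullet> (- y)) * complex_of_real (exp (- (1 / (4 * s) + real k) * (norm u)\<^sup>2))" for k and y u :: 'a
      by (simp add: scaleR_conv_of_real exp_of_nat_mult[symmetric] exp_add[symmetric] algebra_simps flip: exp_of_real)
    \<comment> \<open>The moments of the difference of the kernels at y and z are differences of
      Fourier transforms of Gaussians at -y and -z. These depend on the norm alone, so they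
      vanish.\<close>
    have \<phi>0: "(CLINT u|lborel. \<phi> (exp (- (norm u)\<^sup>2)) *\<^sub>R (?f y u - ?f z u)) = 0"
    proof (rule integral_continuous_eq_0_of_moments[OF _ _ _ _ \<phi>])
      fix k :: nat
      have s'': "1 / (4 * s) + real k > 0" using s' by linarith
      note gi' = gaussian_fourier_integrable[OF s'', of "- y"] gaussian_fourier_integrable[OF s'', of "- z"]
      show "(CLINT u|lborel. exp (- (norm u)\<^sup>2) ^ k *\<^sub>R (?f y u - ?f z u)) = 0"
        unfolding scaleR_diff_right w
        using Bochner_Integration.integral_diff[OF gi'] gaussian_fourier[OF s'', of "- y"] gaussian_fourier[OF s'', of "- z"]
        by (simp only: norm_minus_cancel norm diff_self)
    qed (use gi in auto)
    have "compact (\<phi> ` {0..1})" by (rule compact_continuous_image[OF \<phi>]) auto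
    from compact_imp_bounded[OF this] obtain B where B: "\<And>u. u \<in> {0..1} \<Longrightarrow> \<bar>\<phi> u\<bar> \<le> B"
      by (metis bounded_iff imageI real_norm_def)
    have ci: "integrable lborel (\<lambda>u. ?f y u * complex_of_real (\<phi> (exp (- (norm u)\<^sup>2))))" for y
    proof (rule Bochner_Integration.integrable_bound)
      show "integrable lborel (\<lambda>u::'a. B *\<^sub>R norm (?f y u))" using gi[of y] by auto
      define \<phi>' where "\<phi>' = (\<lambda>u::real. \<phi> (max 0 (min 1 u)))"
      have "continuous_on UNIV \<phi>'"
        unfolding \<phi>'_def by (rule continuous_on_compose2[OF \<phi>]) (auto intro!: continuous_intros)
      hence [measurable]: "\<phi>' \<in> borel_measurable borel" by (rule borel_measurable_continuous_onI)
      have \<phi>': "\<phi> (exp (- (norm x)\<^sup>2)) = \<phi>' (exp (- (norm x)\<^sup>2))" for x :: 'a by (auto simp: \<phi>'_def)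
      show "(\<lambda>u. ?f y u * complex_of_real (\<phi> (exp (- (norm u)\<^sup>2)))) \<in> borel_measurable lborel"
        unfolding \<phi>' by measurable
      show "AE u in lborel. norm (?f y u * complex_of_real (\<phi> (exp (- (norm u)\<^sup>2)))) \<le> norm (B *\<^sub>R norm (?f y u))"
      proof (intro AE_I2)
        fix u :: 'a
        have "\<bar>\<phi> (exp (- (norm u)\<^sup>2))\<bar> \<le> \<bar>B\<bar>" using B[of "exp (- (norm u)\<^sup>2)"] by force
        thus "norm (?f y u * complex_of_real (\<phi> (exp (- (norm u)\<^sup>2)))) \<le> norm (B *\<^sub>R norm (?f y u))"
          by (simp add: norm_mult mult.commute abs_mult mult_right_mono)
      qed
    qed
    have sm: "complex_of_real ((4 * pi * s) powr (DIM('a) / 2)) *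
      (CLINT x|lborel. complex_of_real (p x * exp (- s * (norm (x - y))\<^sup>2))) =
      (CLINT u|lborel. ?f y u * complex_of_real (\<phi> (exp (- (norm u)\<^sup>2))))" for y
      unfolding gaussian_smoothing[OF p s] char ..
    have "(CLINT u|lborel. ?f y u * complex_of_real (\<phi> (exp (- (norm u)\<^sup>2)))) - (CLINT u|lborel. ?f z u * complex_of_real (\<phi> (exp (- (norm u)\<^sup>2)))) = 0"
      using \<phi>0 by (subst Bochner_Integration.integral_diff[OF ci ci, symmetric]) (simp add: scaleR_conv_of_real algebra_simps)
    hence "complex_of_real ((4 * pi * s) powr (DIM('a) / 2)) *
      (CLINT x|lborel. complex_of_real (p x * exp (- s * (norm (x - y))\<^sup>2))) = complex_of_real ((4 * pi * s) powr (DIM('a) / 2)) *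
      (CLINT x|lborel. complex_of_real (p x * exp (- s * (norm (x - z))\<^sup>2)))"
      unfolding sm by simp
    thus ?thesis using s by (simp del: of_real_mult)
  qed
  have pint: "integrable lborel (\<lambda>x. p (x + a))" for a
  proof -
    have "integrable (distr lborel borel ((+) a)) p" by (subst lborel_distr_plus) (rule p)
    from integrable_distr[OF _ this] show ?thesis by (simp add: add.commute)
  qed
  \<comment> \<open>Equal Gaussian averages around y and z at all scales force equal values:
    otherwise the difference of the two translates is positive near 0 while its Gaussian integrals
    vanish.\<close>
  have "\<not> p y > p z" if cont: "isCont p y" "isCont p z"
     and eq: "\<And>s. s > 0 \<Longrightarrow> (LINT x|lborel. p x * exp (- s * (norm (x - y))\<^sup>2)) = (LINT x|lborel. p x * exp (- s * (norm (x - z))\<^sup>2))" for y z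
  proof
    assume less: "p y > p z"
    let ?D = "\<lambda>x. p (x + y) - p (x + z)"
    have sub: "integrable lborel (\<lambda>x. p (x + a) * exp (- s * (norm x)\<^sup>2))" if "s > 0" for s a
    proof (rule Bochner_Integration.integrable_bound[OF pint[of a]])
      have [measurable]: "p \<in> borel_measurable borel" using p by auto
      show "(\<lambda>x. p (x + a) * exp (- s * (norm x)\<^sup>2)) \<in> borel_measurable lborel" by measurable
      have "exp (- s * (norm x)\<^sup>2) \<le> 1" for x :: 'a using that by simp
      thus "AE x in lborel. norm (p (x + a) * exp (- s * (norm x)\<^sup>2)) \<le> norm (p (x + a))"
        by (auto simp: abs_mult intro!: mult_left_le)
    qed
    have shift: "(LINT x|lborel. p (x + a) * exp (- s * (norm x)\<^sup>2)) = (LINT x|lborel. p x * exp (- s * (norm (x - a))\<^sup>2))" for s a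
    proof -
      have [measurable]: "p \<in> borel_measurable borel" using p by auto
      show ?thesis
        by (subst (2) lborel_distr_plus[of a, symmetric], subst integral_distr) (auto simp: add.commute)
    qed
    have "isCont (\<lambda>x. p (x + a)) 0" if "isCont p a" for a
      using isCont_o2[where f = "\<lambda>x. x + a" and a = 0 and g = p] that by (auto intro!: continuous_intros)
    hence "isCont ?D 0" using cont by (intro continuous_diff) auto
    hence "(?D \<longlongrightarrow> ?D 0) (nhds 0)"
      using tendsto_at_iff_tendsto_nhds[of ?D 0] unfolding isCont_def by simp
    hence "\<forall>\<^sub>F x in nhds 0. ?D x > 0"
      by (rule order_tendstoD) (use less in simp)
    then obtain d where d: "d > 0" "\<And>x. dist x 0 < d \<Longrightarrow> ?D x > 0"
      unfolding eventually_nhds_metric by blast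
    show False
    \<comment> \<open>The bound l = -1 puts the origin into the shell, which becomes the ball of
      radius d.\<close>
    proof (rule gaussian_moments_positive_shell[where f = ?D and s = 1 and l = "-1" and u = "d\<^sup>2" and ?x0.0 = 0])
      show "integrable lborel (\<lambda>x. ?D x * exp (- 1 * (norm x)\<^sup>2))"
        using sub[of 1] by (simp add: left_diff_distrib)
      fix k :: nat
      have "(LINT x|lborel. ?D x * exp (- (1 + real k) * (norm x)\<^sup>2)) =
         (LINT x|lborel. p (x + y) * exp (- (1 + real k) * (norm x)\<^sup>2)) - (LINT x|lborel. p (x + z) * exp (- (1 + real k) * (norm x)\<^sup>2))"
        unfolding left_diff_distrib[of "p _"] by (rule Bochner_Integration.integral_diff; rule sub; linarith)
      thus "(LINT x|lborel. ?D x * exp (- (1 + real k) * (norm x)\<^sup>2)) = 0"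
        unfolding shift by (subst (asm) eq) auto
    qed (use d in \<open>auto simp: power_less_imp_less_base less_imp_le\<close>)
  qed
  from this[OF cont eq] this[OF cont(2,1) eq[symmetric]] show ?thesis by force
qed

text \<open>A positive value persists for nearby norms by continuity along a ray and spreads over a
  shell by radial symmetry, which the shell lemma forbids; negative values are treated through
  -f.\<close>

lemma radial_eq_0_if_gaussian_moments_0:
  fixes f :: "'a::euclidean_space \<Rightarrow> real" and s :: real
  assumes int: "integrable lborel (\<lambda>x. f x * exp (- s * (norm x)\<^sup>2))"
    and moments: "\<And>k::nat. (LINT x|lborel. f x * exp (- (s + real k) * (norm x)\<^sup>2)) = 0"
    and cont: "continuous_on (- {0}) f"
    and radial: "\<And>x y. x \<noteq> 0 \<Longrightarrow> norm x = norm y \<Longrightarrow> f x = f y"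
    and x: "x \<noteq> 0"
  shows "f x = 0"
proof -
  have "\<not> f x > 0" if int: "integrable lborel (\<lambda>x. f x * exp (- s * (norm x)\<^sup>2))"
    and moments: "\<And>k::nat. (LINT x|lborel. f x * exp (- (s + real k) * (norm x)\<^sup>2)) = 0"
    and cont: "continuous_on (- {0}) f"
    and radial: "\<And>x y. x \<noteq> 0 \<Longrightarrow> norm x = norm y \<Longrightarrow> f x = f y" for f :: "'a \<Rightarrow> real"
  proof
    assume fx: "f x > 0"
    define r where "r = norm x"
    have r: "r > 0" using x by (simp add: r_def)
    have fn: "f y = f ((norm y / r) *\<^sub>R x)" if "y \<noteq> 0" for y
      using r that by (intro radial) (auto simp: r_def)
    define g where "g = (\<lambda>v. f ((sqrt v / r) *\<^sub>R x))"
    have "isCont f x" using cont x by (simp add: continuous_on_eq_continuous_at open_Compl)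
    hence 1: "isCont f ((sqrt (r\<^sup>2) / r) *\<^sub>R x)" using r by simp
    have 2: "isCont (\<lambda>v. (sqrt v / r) *\<^sub>R x) (r\<^sup>2)"
      using r by (auto intro!: continuous_intros isCont_real_sqrt)
    have "isCont g (r\<^sup>2)"
      unfolding g_def using isCont_o2[OF 2 1] .
    hence "\<forall>\<^sub>F v in nhds (r\<^sup>2). g v > 0"
      unfolding isCont_def tendsto_at_iff_tendsto_nhds by (rule order_tendstoD) (use fx r in \<open>auto simp: g_def\<close>)
    then obtain d where d: "d > 0" "\<And>v. dist v (r\<^sup>2) < d \<Longrightarrow> g v > 0"
      unfolding eventually_nhds_metric by blast
    show False
    \<comment> \<open>The maximum with 0 keeps the origin, where f is not controlled, outside the
      shell.\<close>
    proof (rule gaussian_moments_positive_shell[OF int moments, where l = "max 0 (r\<^sup>2 - d)" and u = "r\<^sup>2 + d" and ?x0.0 = x])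
      fix y :: 'a assume y: "max 0 (r\<^sup>2 - d) < (norm y)\<^sup>2" "(norm y)\<^sup>2 < r\<^sup>2 + d"
      hence "dist ((norm y)\<^sup>2) (r\<^sup>2) < d" by (auto simp: dist_real_def)
      from d(2)[OF this] have "f ((norm y / r) *\<^sub>R x) > 0" by (simp add: g_def)
      thus "f y > 0" using fn[of y] y by auto
    qed (use r d in \<open>auto simp: r_def\<close>)
  qed
  note * = this
  have "\<not> f x > 0" by (rule *) fact+
  moreover have "\<not> - f x > 0"
    by (rule *[of "\<lambda>x. - f x"]) (use int moments in \<open>auto intro: radial continuous_on_minus cont\<close>)
  ultimately show ?thesis by simp
qed

section \<open>Gaussian integrals of radial series\<close>

text \<open>Restrict Euler's integral to [1,2], where \<open>exp (- v)\<close> is at least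
  \<open>exp (- 2)\<close> and \<open>v powr (x - 1)\<close> at least \<open>1 / v\<close>, hence
  1/2. A bound uniform in x is all that is needed to discard the Gamma denominators of the
  coefficients.\<close>

lemma Gamma_real_lower_bound:
  assumes x: "x > (0::real)"
  shows "exp (- 2) / 2 \<le> Gamma x"
proof -
  have I: "has_bochner_integral lborel (\<lambda>v. indicator {0<..} v * (exp (- 1 * v) * v powr (x - 1))) (Gamma x)"
    using has_bochner_integral_Gamma[of 1 x] x by simp
  have "exp (- 2) / (2::real) = (LINT v|lborel. indicator {1..2::real} v * (exp (- 2) / 2 :: real))" by simp
  also have "\<dots> \<le> (LINT v|lborel. indicator {0<..} v * (exp (- 1 * v) * v powr (x - 1)))"
  proof (rule integral_mono)
    show "integrable lborel (\<lambda>v. indicator {1..2::real} v * (exp (- 2) / 2 :: real))" by simp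
    show "integrable lborel (\<lambda>v. indicator {0<..} v * (exp (- 1 * v) * v powr (x - 1)))"
      using I by (simp add: has_bochner_integral_iff)
    fix v :: real
    show "indicator {1..2} v * (exp (- 2) / 2) \<le> indicator {0<..} v * (exp (- 1 * v) * v powr (x - 1))"
    proof (cases "v \<in> {1..2}")
      case True
      have "1 / 2 \<le> v powr (-1)" using True by (simp add: powr_minus field_simps)
      also have "\<dots> \<le> v powr (x - 1)" using True x by (intro powr_mono) auto
      finally have "exp (- 2) * (1 / 2) \<le> exp (- 1 * v) * v powr (x - 1)"
        using True by (intro mult_mono) auto
      thus ?thesis using True by simp
    qed (auto simp: indicator_def)
  qed
  finally show ?thesis using I by (simp add: has_bochner_integral_iff)
qed

text \<open>Multiplied by a, the quantity becomes an integer minus \<open>a * \<nu>\<close>, and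
  \<open>a * \<nu>\<close> is irrational. Thus \<delta> is the distance from
  \<open>a * \<nu>\<close> to the nearest integer, divided by a.\<close>

lemma rational_exponent_separation:
  fixes a b n :: nat and \<nu> :: real
  assumes a: "a \<ge> 1" and \<nu>: "\<nu> \<notin> \<rat>"
  defines "\<alpha> \<equiv> real a / real b"
  assumes b: "b \<ge> 1"
  obtains \<delta> where "\<delta> > 0" "\<And>(l::nat) (j::nat). \<bar>real n / \<alpha> - \<nu> - real l + 2 / \<alpha> * real j\<bar> \<ge> \<delta>"
proof
  define d where "d = min (frac (real a * \<nu>)) (1 - frac (real a * \<nu>))"
  have "real a * \<nu> \<notin> \<int>"
  proof
    assume "real a * \<nu> \<in> \<int>"
    then obtain k where "real a * \<nu> = of_int k" by (auto elim: Ints_cases)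
    hence "\<nu> = of_int k / of_nat a" using a by (simp add: field_simps)
    thus False using \<nu> by auto
  qed
  hence d: "d > 0" unfolding d_def using frac_lt_1[of "real a * \<nu>"] by (simp add: frac_gt_0_iff)
  have dist: "\<bar>of_int k - real a * \<nu>\<bar> \<ge> d" for k
  proof (cases "k \<le> \<lfloor>real a * \<nu>\<rfloor>")
    case True
    hence "real_of_int k \<le> of_int \<lfloor>real a * \<nu>\<rfloor>" by simp
    thus ?thesis unfolding d_def frac_def by linarith
  next
    case False
    hence "real_of_int k \<ge> of_int \<lfloor>real a * \<nu>\<rfloor> + 1" by linarith
    thus ?thesis unfolding d_def frac_def by linarith
  qed
  show "d / real a > 0" using d a by simp
  fix l j :: nat
  let ?k = "int (n * b) - int (a * l) + int (2 * b * j)"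
  have "real n / \<alpha> - \<nu> - real l + 2 / \<alpha> * real j = (of_int ?k - real a * \<nu>) / real a"
    unfolding \<alpha>_def using a b by (simp add: field_simps)
  thus "\<bar>real n / \<alpha> - \<nu> - real l + 2 / \<alpha> * real j\<bar> \<ge> d / real a"
    using dist[of ?k] a by (simp add: divide_right_mono)
qed

text \<open>The factor \<open>Gamma (\<gamma> / 2)\<close> is the one that cancels: \<gamma> =
  \<alpha> * (\<nu> + l) and \<gamma> = n + 2 * j give exactly the Gamma denominators of the two
  series.\<close>

lemma has_bochner_integral_norm_powr_gaussian:
  fixes s \<gamma> :: real
  assumes s: "s > 0" and \<gamma>: "\<gamma> > 0"
  defines "n \<equiv> real DIM('a::euclidean_space)"
  shows "has_bochner_integral lborel (\<lambda>x::'a. norm x powr (\<gamma> - n) * exp (- s * (norm x)\<^sup>2))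
    (unit_ball_vol n * (n / 2) * (Gamma (\<gamma> / 2) * s powr (- (\<gamma> / 2))))"
proof -
  define f where "f = (\<lambda>v. v powr ((\<gamma> - n) / 2) * exp (- s * v))"
  have [measurable]: "f \<in> borel_measurable borel" unfolding f_def by measurable
  have f: "f (norm x powr 2) = norm x powr (\<gamma> - n) * exp (- s * (norm x)\<^sup>2)" for x :: 'a
  proof -
    have e: "2 * ((\<gamma> - n) / 2) = \<gamma> - n" by simp
    have 1: "(norm x powr 2) powr ((\<gamma> - n) / 2) = norm x powr (\<gamma> - n)" by (simp only: powr_powr e)
    have 2: "norm x powr 2 = (norm x)\<^sup>2" by (simp add: powr_numeral)
    show ?thesis unfolding f_def 1 unfolding 2 ..
  qed
  have e: "f v * v powr (n / 2 - 1) = exp (- s * v) * v powr (\<gamma> / 2 - 1)" for v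
    by (simp add: f_def powr_add[symmetric] field_simps)
  have G: "has_bochner_integral lborel (\<lambda>v. indicator {0<..} v * (f v * v powr (n / 2 - 1))) (Gamma (\<gamma> / 2) * s powr (- (\<gamma> / 2)))"
    unfolding e by (rule has_bochner_integral_Gamma[OF s]) (use \<gamma> in simp)
  show ?thesis
    using integrable_norm_powr[of 2 f, where ?'a = 'a] integral_norm_powr[of 2 f, where ?'a = 'a] G
    unfolding f n_def[symmetric] by (simp add: has_bochner_integral_iff)
qed

lemma has_bochner_integral_radial_series_gaussian:
  fixes e \<gamma> :: "nat \<Rightarrow> real" and F :: "'a::euclidean_space \<Rightarrow> real" and s :: real
  defines "n \<equiv> real DIM('a)"
  assumes s: "s > 0" and \<gamma>: "\<And>l. \<gamma> l > 0"
    and summable_e: "summable (\<lambda>l. \<bar>e l\<bar> * (Gamma (\<gamma> l / 2) * s powr (- (\<gamma> l / 2))))"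
    and F[measurable]: "F \<in> borel_measurable borel"
    and summable_F: "\<And>x::'a. x \<noteq> 0 \<Longrightarrow> summable (\<lambda>l. \<bar>e l * norm x powr (\<gamma> l - n)\<bar>)"
    and F_eq: "\<And>x. x \<noteq> 0 \<Longrightarrow> F x = (\<Sum>l. e l * norm x powr (\<gamma> l - n))"
  shows "has_bochner_integral lborel (\<lambda>x. F x * exp (- s * (norm x)\<^sup>2))
    (unit_ball_vol n * (n / 2) * (\<Sum>l. e l * (Gamma (\<gamma> l / 2) * s powr (- (\<gamma> l / 2)))))"
proof -
  define f where "f = (\<lambda>l (x::'a). e l * (norm x powr (\<gamma> l - n) * exp (- s * (norm x)\<^sup>2)))"
  let ?c = "unit_ball_vol n * (n / 2)"
  let ?M = "\<lambda>l. Gamma (\<gamma> l / 2) * s powr (- (\<gamma> l / 2))"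
  \<comment> \<open>The series represents F only off the origin, which is a null set.\<close>
  have nz: "AE x in (lborel :: 'a measure). x \<noteq> 0" by (rule AE_lborel_singleton)
  have M: "?M l > 0" for l using \<gamma>[of l] s by simp
  have I: "has_bochner_integral lborel (\<lambda>x::'a. norm x powr (\<gamma> l - n) * exp (- s * (norm x)\<^sup>2)) (?c * ?M l)" for l
    unfolding n_def by (rule has_bochner_integral_norm_powr_gaussian[OF s \<gamma>])
  have fi: "has_bochner_integral lborel (f l) (e l * (?c * ?M l))" for l
    unfolding f_def by (rule has_bochner_integral_mult_right[OF I])
  have "has_bochner_integral lborel (\<lambda>x. \<bar>e l\<bar> * (norm x powr (\<gamma> l - n) * exp (- s * (norm (x::'a))\<^sup>2))) (\<bar>e l\<bar> * (?c * ?M l))" for l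
    by (rule has_bochner_integral_mult_right[OF I])
  hence nf: "(LINT x|lborel. norm (f l x)) = \<bar>e l\<bar> * (?c * ?M l)" for l
    by (simp add: has_bochner_integral_iff f_def abs_mult)
  have s1: "AE x in lborel. summable (\<lambda>l. norm (f l x))"
    using nz
  proof eventually_elim
    case (elim x)
    have "summable (\<lambda>l. \<bar>e l * norm x powr (\<gamma> l - n)\<bar> * exp (- s * (norm x)\<^sup>2))"
      using summable_F[OF elim] by (rule summable_mult2)
    thus ?case by (simp add: f_def abs_mult mult_ac)
  qed
  have "summable (\<lambda>l. ?c * (\<bar>e l\<bar> * ?M l))" by (intro summable_mult summable_e)
  hence sn: "summable (\<lambda>l. LINT x|lborel. norm (f l x))" unfolding nf by (simp add: mult_ac)
  have eq: "AE x in lborel. (\<Sum>l. f l x) = F x * exp (- s * (norm x)\<^sup>2)"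
    using nz
  proof eventually_elim
    case (elim x)
    have "(\<Sum>l. f l x) = (\<Sum>l. e l * norm x powr (\<gamma> l - n) * exp (- s * (norm x)\<^sup>2))"
      by (simp add: f_def mult_ac)
    also have "\<dots> = F x * exp (- s * (norm x)\<^sup>2)"
      unfolding F_eq[OF elim] by (rule suminf_mult2[symmetric, OF summable_rabs_cancel[OF summable_F[OF elim]]])
    finally show ?case .
  qed
  have "has_bochner_integral lborel (\<lambda>x. \<Sum>l. f l x) (\<Sum>l. e l * (?c * ?M l))"
  proof -
    have fi': "integrable lborel (f l)" and fI: "integral\<^sup>L lborel (f l) = e l * (?c * ?M l)" for l
      using fi[of l] by (simp_all only: has_bochner_integral_iff)
    from integrable_suminf[OF fi' s1 sn] integral_suminf[OF fi' s1 sn] show ?thesis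
      unfolding has_bochner_integral_iff fI by blast
  qed
  moreover have "(\<Sum>l. e l * (?c * ?M l)) = ?c * (\<Sum>l. e l * ?M l)"
  proof -
    have "summable (\<lambda>l. e l * ?M l)"
    proof (rule summable_rabs_cancel)
      have "\<bar>e l * ?M l\<bar> = \<bar>e l\<bar> * ?M l" for l by (simp only: abs_mult[of "e l"] abs_of_pos[OF M])
      thus "summable (\<lambda>l. \<bar>e l * ?M l\<bar>)" using summable_e by (simp only:)
    qed
    from suminf_mult[OF this, of ?c] show ?thesis by (simp add: mult_ac)
  qed
  ultimately have S: "has_bochner_integral lborel (\<lambda>x. \<Sum>l. f l x) (?c * (\<Sum>l. e l * ?M l))" by (simp only:)
  have m: "(\<lambda>x. F x * exp (- s * (norm x)\<^sup>2)) \<in> borel_measurable lborel" by measurable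
  show ?thesis
    by (rule iffD1[OF has_bochner_integral_cong_AE[OF borel_measurable_has_bochner_integral[OF S] m eq] S])
qed

text \<open>Smoothing at y = 0, where the oscillating factor is 1, leaves a radial integral; the
  radial variable \<open>v = norm u powr \<alpha>\<close> turns \<open>(norm u)^2\<close> into
  \<open>v powr (2 / \<alpha>)\<close>.\<close>

lemma gaussian_integral_of_char:
  fixes p :: "'a::euclidean_space \<Rightarrow> real" and \<alpha> \<nu> s :: real
  assumes p: "integrable lborel p" and s: "s > 0" and \<alpha>: "\<alpha> > 0"
    and char: "\<And>t. (CLINT x|lborel. iexp (x \<bullet> t) * complex_of_real (p x)) = complex_of_real ((1 + norm t powr \<alpha>) powr (- \<nu>))"
  defines "n \<equiv> real DIM('a)"
  shows "(4 * pi * s) powr (n / 2) * (LINT x|lborel. p x * exp (- s * (norm x)\<^sup>2)) =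
    unit_ball_vol n * (n / \<alpha>) * (LINT v|lborel. indicator {0<..} v *
      ((1 + v) powr (- \<nu>) * exp (- (1 / (4 * s)) * v powr (2 / \<alpha>)) * v powr (n / \<alpha> - 1)))"
proof -
  define f where "f = (\<lambda>v. (1 + v) powr (- \<nu>) * exp (- (1 / (4 * s)) * v powr (2 / \<alpha>)))"
  have [measurable]: "f \<in> borel_measurable borel" unfolding f_def by measurable
  have f: "f (norm u powr \<alpha>) = exp (- (1 / (4 * s)) * (norm u)\<^sup>2) * (1 + norm u powr \<alpha>) powr (- \<nu>)" for u :: 'a
    using \<alpha> by (simp add: f_def powr_powr powr_numeral)
  have "complex_of_real ((4 * pi * s) powr (n / 2) * (LINT x|lborel. p x * exp (- s * (norm x)\<^sup>2))) =
    complex_of_real ((4 * pi * s) powr (n / 2)) * (CLINT x|lborel. complex_of_real (p x * exp (- s * (norm (x - 0))\<^sup>2)))"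
    unfolding integral_complex_of_real by simp
  also have "\<dots> = (CLINT u|lborel. iexp ((u::'a) \<bullet> (- 0)) * complex_of_real (exp (- (1 / (4 * s)) * (norm u)\<^sup>2)) * complex_of_real ((1 + norm u powr \<alpha>) powr (- \<nu>)))"
    unfolding n_def gaussian_smoothing[OF p s] char ..
  also have "\<dots> = (CLINT u|lborel. complex_of_real (f (norm (u::'a) powr \<alpha>)))"
    unfolding f by simp
  finally have "complex_of_real ((4 * pi * s) powr (n / 2) * (LINT x|lborel. p x * exp (- s * (norm x)\<^sup>2))) =
    (CLINT u|lborel. complex_of_real (f (norm (u::'a) powr \<alpha>)))" .
  hence "(4 * pi * s) powr (n / 2) * (LINT x|lborel. p x * exp (- s * (norm x)\<^sup>2)) = (LINT u|lborel. f (norm (u::'a) powr \<alpha>))"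
    by (simp only: integral_complex_of_real of_real_eq_iff)
  also have "\<dots> = unit_ball_vol n * (n / \<alpha>) * (LINT v|lborel. indicator {0<..} v * (f v * v powr (n / \<alpha> - 1)))"
    unfolding n_def by (rule integral_norm_powr[OF \<alpha>]) simp
  finally show ?thesis by (simp add: f_def)
qed

text \<open>The characteristic function in the variable \<open>u = exp (- (norm t)^2)\<close>, where
  \<open>norm t powr \<alpha>\<close> is \<open>(- ln u) powr (\<alpha> / 2)\<close>. The point u =
  0 stands for infinity, and decay of the characteristic function is continuity there.\<close>

lemma continuous_on_char_profile:
  fixes \<alpha> \<nu> :: real
  assumes \<alpha>: "\<alpha> > 0" and \<nu>: "\<nu> > 0"
  shows "continuous_on {0..1} (\<lambda>u. if u = 0 then 0 else (1 + (- ln u) powr (\<alpha> / 2)) powr (- \<nu>))"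
    (is "continuous_on _ ?\<phi>")
proof (subst continuous_on_eq_continuous_within, intro ballI)
  fix x :: real assume x: "x \<in> {0..1}"
  show "continuous (at x within {0..1}) ?\<phi>"
  proof (cases "x = 0")
    case True
    have L: "filterlim (\<lambda>u::real. - ln u) at_top (at_right 0)" by real_asymp
    have "filterlim (\<lambda>w::real. 1 + w powr (\<alpha> / 2)) at_top at_top" using \<alpha> by real_asymp
    from filterlim_compose[OF this L] have "filterlim (\<lambda>u::real. 1 + (- ln u) powr (\<alpha> / 2)) at_top (at_right 0)" .
    hence "((\<lambda>u::real. (1 + (- ln u) powr (\<alpha> / 2)) powr (- \<nu>)) \<longlongrightarrow> 0) (at_right 0)"
      using \<nu> by (intro tendsto_neg_powr) auto
    moreover have "\<forall>\<^sub>F u in at_right 0. (1 + (- ln u) powr (\<alpha> / 2)) powr (- \<nu>) = ?\<phi> u"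
      using eventually_at_right_less[of "0::real"] by eventually_elim auto
    ultimately have "(?\<phi> \<longlongrightarrow> 0) (at_right 0)" by (rule Lim_transform_eventually)
    moreover have "at (0::real) within {0..1} = at_right 0" by (rule at_within_Icc_at_right) simp
    ultimately show ?thesis using True by (simp add: continuous_within)
  next
    case False
    have c: "continuous_on {0<..1} (\<lambda>u::real. (1 + (- ln u) powr (\<alpha> / 2)) powr (- \<nu>))"
      using \<alpha> by (intro continuous_intros continuous_on_powr') (auto simp: add_nonneg_eq_0_iff)
    have "continuous_on {0<..1} ?\<phi>"
      by (rule continuous_on_eq[OF c]) auto
    hence "continuous (at x within {0<..1}) ?\<phi>"
      using x False by (simp add: continuous_on_eq_continuous_within)
    moreover have "at x within {0<..1} = at x within {0..1}"
      using x False by (intro at_within_nhd[of x "{0<..}"]) auto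
    ultimately show ?thesis by (simp add: continuous_within)
  qed
qed

lemma holomorphic_on_UNIV_power_series:
  fixes c :: "nat \<Rightarrow> complex"
  assumes "\<And>z. summable (\<lambda>k. c k * z ^ k)"
  shows "(\<lambda>z. \<Sum>k. c k * z ^ k) holomorphic_on UNIV"
proof -
  have "(\<lambda>z. \<Sum>k. c k * z ^ k) holomorphic_on ball 0 r" for r
    by (rule power_series_holomorphic[of 0 r c]) (use assms in \<open>auto simp: sums_iff\<close>)
  hence "(\<lambda>z. \<Sum>k. c k * z ^ k) field_differentiable at z" for z
    by (rule holomorphic_on_imp_differentiable_at[of _ "ball 0 (norm z + 1)"]) auto
  thus ?thesis by (auto simp: holomorphic_on_def field_differentiable_at_within)
qed

section \<open>The Linnik density\<close>

definition A1_coeff :: "real \<Rightarrow> real \<Rightarrow> nat \<Rightarrow> nat \<Rightarrow> real" where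
  "A1_coeff \<alpha> \<nu> n l = (- 1) ^ l / fact l * Gamma (\<nu> + real l)
     * (Gamma ((real n - \<alpha> * (\<nu> + real l)) / 2) / Gamma (\<alpha> * (\<nu> + real l) / 2)) / 2 powr (\<alpha> * real l)"

definition A2_coeff :: "real \<Rightarrow> real \<Rightarrow> nat \<Rightarrow> nat \<Rightarrow> real" where
  "A2_coeff \<alpha> \<nu> n j = (- 1) ^ j / fact j
     * (Gamma ((real n + 2 * real j) / \<alpha>) / Gamma ((real n + 2 * real j) / 2))
     * Gamma ((\<alpha> * \<nu> - real n - 2 * real j) / \<alpha>) / 4 ^ j"

lemma A1_term_eq: "A1_term \<alpha> \<nu> n z = (\<lambda>l. complex_of_real (A1_coeff \<alpha> \<nu> n l) * z ^ l)"
  by (simp add: fun_eq_iff A1_term_def A1_coeff_def)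

lemma A2_term_eq: "A2_term \<alpha> \<nu> n z = (\<lambda>j. complex_of_real (A2_coeff \<alpha> \<nu> n j) * z ^ j)"
  by (simp add: fun_eq_iff A2_term_def A2_coeff_def power_mult)

definition linnik_profile :: "real \<Rightarrow> real \<Rightarrow> nat \<Rightarrow> real \<Rightarrow> real" where
  "linnik_profile \<alpha> \<nu> n r = 1 / (2 ^ n * pi powr (real n / 2) * Gamma \<nu>) *
     (r powr (\<alpha> * \<nu> - real n) / 2 powr (\<alpha> * \<nu> - real n) * (\<Sum>l. A1_coeff \<alpha> \<nu> n l * (r powr \<alpha>) ^ l)
       + 2 / \<alpha> * (\<Sum>j. A2_coeff \<alpha> \<nu> n j * (r\<^sup>2) ^ j))"

context
  fixes \<alpha> \<nu> \<delta> :: real and n :: nat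
  assumes \<alpha>: "\<alpha> > 0" and \<nu>: "\<nu> > 0" and n: "n > 0" and \<delta>: "\<delta> > 0"
    and sep: "\<And>(l::nat) (j::nat). \<bar>real n / \<alpha> - \<nu> - real l + 2 / \<alpha> * real j\<bar> \<ge> \<delta>"
begin

lemma two_div_alpha_pos: "2 / \<alpha> > 0" and n_div_alpha_pos: "real n / \<alpha> > 0"
  using \<alpha> n by simp_all

text \<open>After the Gaussian moment has cancelled the Gamma denominator, what remains is a term of
  the expansion of \<open>integral_one_plus_powr_exp\<close>. This identity and its companion for
  \<open>A2_coeff\<close> serve both the convergence proof and the comparison of Gaussian
  integrals.\<close>

lemma A1_coeff_Gamma:
  "A1_coeff \<alpha> \<nu> n l * Gamma (\<alpha> * (\<nu> + real l) / 2) =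
    Gamma \<nu> * (((- \<nu>) gchoose l) * Gamma ((real n / \<alpha> - \<nu> - real l) / (2 / \<alpha>))) / 2 powr (\<alpha> * real l)"
proof -
  have "Gamma (\<alpha> * (\<nu> + real l) / 2) > 0" using \<alpha> \<nu> by (intro Gamma_real_pos) (simp add: add_pos_nonneg)
  moreover have "(real n / \<alpha> - \<nu> - real l) / (2 / \<alpha>) = (real n - \<alpha> * (\<nu> + real l)) / 2"
    using \<alpha> by (simp add: field_simps)
  ultimately show ?thesis
    unfolding A1_coeff_def Gamma_gbinomial[OF \<nu>] by (simp only:) simp
qed

lemma A2_coeff_Gamma:
  "A2_coeff \<alpha> \<nu> n j * Gamma ((real n + 2 * real j) / 2) =
    (- 1) ^ j / fact j * (Gamma (real n / \<alpha> + 2 / \<alpha> * real j) * Gamma (\<nu> - (real n / \<alpha> + 2 / \<alpha> * real j))) / 4 ^ j"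
proof -
  have "Gamma ((real n + 2 * real j) / 2) > 0" using n by (intro Gamma_real_pos) simp
  moreover have "real n / \<alpha> + 2 / \<alpha> * real j = (real n + 2 * real j) / \<alpha>"
    "\<nu> - (real n / \<alpha> + 2 / \<alpha> * real j) = (\<alpha> * \<nu> - real n - 2 * real j) / \<alpha>"
    using \<alpha> by (simp_all add: field_simps)
  ultimately show ?thesis unfolding A2_coeff_def by (simp only:) simp
qed

lemma summable_A1_coeff:
  assumes X: "X > 0"
  shows "summable (\<lambda>l. \<bar>A1_coeff \<alpha> \<nu> n l\<bar> * X ^ l)"
proof -
  let ?h = "\<lambda>l. \<bar>((- \<nu>) gchoose l) * Gamma ((real n / \<alpha> - \<nu> - real l) / (2 / \<alpha>))\<bar>"
  \<comment> \<open>The constant \<open>2 * exp 2\<close> is the reciprocal of the uniform lower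
    bound for Gamma, the price of restoring the denominator.\<close>
  have "summable (\<lambda>l. 2 * exp 2 * Gamma \<nu> * (?h l * X ^ l))"
    by (intro summable_mult summable_upper_Gamma[OF two_div_alpha_pos n_div_alpha_pos \<nu> \<delta> sep X])
  thus ?thesis
  proof (rule summable_comparison_test')
    fix l :: nat
    have G: "exp (- 2) / 2 \<le> Gamma (\<alpha> * (\<nu> + real l) / 2)"
      using \<alpha> \<nu> by (intro Gamma_real_lower_bound) (simp add: add_pos_nonneg)
    hence G': "1 \<le> 2 * exp 2 * Gamma (\<alpha> * (\<nu> + real l) / 2)" by (simp add: exp_minus field_simps)
    have t: "1 \<le> 2 powr (\<alpha> * real l)" using \<alpha> by (intro ge_one_powr_ge_zero) auto
    have "Gamma (\<alpha> * (\<nu> + real l) / 2) > 0" using G by (smt (verit) exp_gt_zero half_gt_zero)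
    have "\<bar>A1_coeff \<alpha> \<nu> n l\<bar> \<le> \<bar>A1_coeff \<alpha> \<nu> n l\<bar> * (2 * exp 2 * Gamma (\<alpha> * (\<nu> + real l) / 2))"
      using mult_left_mono[OF G' abs_ge_zero[of "A1_coeff \<alpha> \<nu> n l"]] by simp
    also have "\<dots> = 2 * exp 2 * \<bar>A1_coeff \<alpha> \<nu> n l * Gamma (\<alpha> * (\<nu> + real l) / 2)\<bar>"
      using \<open>Gamma (\<alpha> * (\<nu> + real l) / 2) > 0\<close> by (simp add: abs_mult)
    also have "\<dots> = 2 * exp 2 * Gamma \<nu> * ?h l / 2 powr (\<alpha> * real l)"
      unfolding A1_coeff_Gamma using \<nu> by (simp add: abs_mult)
    also have "\<dots> \<le> 2 * exp 2 * Gamma \<nu> * ?h l / 1"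
      using t \<nu> by (intro divide_left_mono) (auto simp: Gamma_real_nonneg)
    finally have "\<bar>A1_coeff \<alpha> \<nu> n l\<bar> \<le> 2 * exp 2 * Gamma \<nu> * ?h l" by simp
    from mult_right_mono[OF this, of "X ^ l"] X
    show "norm (\<bar>A1_coeff \<alpha> \<nu> n l\<bar> * X ^ l) \<le> 2 * exp 2 * Gamma \<nu> * (?h l * X ^ l)"
      by (simp add: abs_mult mult.assoc)
  qed
qed

lemma summable_A2_coeff:
  assumes X: "X > 0"
  shows "summable (\<lambda>j. \<bar>A2_coeff \<alpha> \<nu> n j\<bar> * X ^ j)"
proof -
  let ?h = "\<lambda>j. \<bar>Gamma (real n / \<alpha> + 2 / \<alpha> * real j) * Gamma (\<nu> - (real n / \<alpha> + 2 / \<alpha> * real j))\<bar> / fact j"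
  have "summable (\<lambda>j. 2 * exp 2 * (?h j * X ^ j))"
    by (intro summable_mult summable_lower_Gamma[OF two_div_alpha_pos n_div_alpha_pos \<nu> \<delta> sep X])
  thus ?thesis
  proof (rule summable_comparison_test')
    fix j :: nat
    have G: "exp (- 2) / 2 \<le> Gamma ((real n + 2 * real j) / 2)"
      using n by (intro Gamma_real_lower_bound) simp
    hence G': "1 \<le> 2 * exp 2 * Gamma ((real n + 2 * real j) / 2)" by (simp add: exp_minus field_simps)
    have pos: "Gamma ((real n + 2 * real j) / 2) > 0" using G by (smt (verit) exp_gt_zero half_gt_zero)
    have "\<bar>A2_coeff \<alpha> \<nu> n j\<bar> \<le> \<bar>A2_coeff \<alpha> \<nu> n j\<bar> * (2 * exp 2 * Gamma ((real n + 2 * real j) / 2))"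
      using mult_left_mono[OF G' abs_ge_zero[of "A2_coeff \<alpha> \<nu> n j"]] by simp
    also have "\<dots> = 2 * exp 2 * \<bar>A2_coeff \<alpha> \<nu> n j * Gamma ((real n + 2 * real j) / 2)\<bar>"
      using pos by (simp add: abs_mult)
    also have "\<dots> = 2 * exp 2 * ?h j / 4 ^ j"
      unfolding A2_coeff_Gamma by (simp add: abs_mult power_abs)
    also have "\<dots> \<le> 2 * exp 2 * ?h j / 1"
      by (intro divide_left_mono) auto
    finally have "\<bar>A2_coeff \<alpha> \<nu> n j\<bar> \<le> 2 * exp 2 * ?h j" by simp
    from mult_right_mono[OF this, of "X ^ j"] X
    show "norm (\<bar>A2_coeff \<alpha> \<nu> n j\<bar> * X ^ j) \<le> 2 * exp 2 * (?h j * X ^ j)"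
      by (simp add: abs_mult mult.assoc)
  qed
qed

section \<open>Absolute convergence, holomorphy and continuity\<close>

lemma summable_norm_A1_term: "summable (\<lambda>l. norm (A1_term \<alpha> \<nu> n z l))"
proof (rule summable_comparison_test'[OF summable_A1_coeff[of "norm z + 1"]])
  show "norm z + 1 > 0" by (simp add: add_nonneg_pos)
  show "norm (norm (A1_term \<alpha> \<nu> n z l)) \<le> \<bar>A1_coeff \<alpha> \<nu> n l\<bar> * (norm z + 1) ^ l" for l
    by (auto simp: A1_term_eq norm_mult norm_power intro!: mult_left_mono power_mono)
qed

lemma summable_norm_A2_term: "summable (\<lambda>j. norm (A2_term \<alpha> \<nu> n z j))"
proof (rule summable_comparison_test'[OF summable_A2_coeff[of "norm z + 1"]])
  show "norm z + 1 > 0" by (simp add: add_nonneg_pos)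
  show "norm (norm (A2_term \<alpha> \<nu> n z j)) \<le> \<bar>A2_coeff \<alpha> \<nu> n j\<bar> * (norm z + 1) ^ j" for j
    by (auto simp: A2_term_eq norm_mult norm_power intro!: mult_left_mono power_mono)
qed

lemma A1_holomorphic: "A1 \<alpha> \<nu> n holomorphic_on UNIV"
  using holomorphic_on_UNIV_power_series[of "\<lambda>l. complex_of_real (A1_coeff \<alpha> \<nu> n l)"]
    summable_norm_cancel[OF summable_norm_A1_term]
  by (simp add: A1_def[abs_def] A1_term_eq)

lemma A2_holomorphic: "A2 \<alpha> \<nu> n holomorphic_on UNIV"
  unfolding A2_def[abs_def] A2_term_eq
  using summable_norm_cancel[OF summable_norm_A2_term]
  by (intro holomorphic_intros holomorphic_on_UNIV_power_series) (simp add: A2_term_eq)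

lemma summable_A1_coeff': "summable (\<lambda>l. \<bar>A1_coeff \<alpha> \<nu> n l * w ^ l\<bar>)"
  using summable_norm_A1_term[of "complex_of_real w"] by (simp add: A1_term_eq norm_mult norm_power abs_mult power_abs)

lemma summable_A2_coeff': "summable (\<lambda>j. \<bar>A2_coeff \<alpha> \<nu> n j * w ^ j\<bar>)"
  using summable_norm_A2_term[of "complex_of_real w"] by (simp add: A2_term_eq norm_mult norm_power abs_mult power_abs)

lemma A1_of_real: "A1 \<alpha> \<nu> n (complex_of_real w) = complex_of_real (\<Sum>l. A1_coeff \<alpha> \<nu> n l * w ^ l)"
  using sums_of_real_iff[where ?'a = complex, THEN iffD2, OF summable_sums[OF summable_rabs_cancel[OF summable_A1_coeff'[of w]]]]
  unfolding A1_def A1_term_eq by (simp add: sums_iff)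

lemma A2_of_real: "A2 \<alpha> \<nu> n (complex_of_real w) = complex_of_real (2 / \<alpha> * (\<Sum>j. A2_coeff \<alpha> \<nu> n j * w ^ j))"
  using sums_of_real_iff[where ?'a = complex, THEN iffD2, OF summable_sums[OF summable_rabs_cancel[OF summable_A2_coeff'[of w]]]]
  unfolding A2_def A2_term_eq by (simp add: sums_iff)

lemma continuous_A1_real: "continuous_on UNIV (\<lambda>w::real. \<Sum>l. A1_coeff \<alpha> \<nu> n l * w ^ l)"
proof -
  have "continuous_on UNIV (\<lambda>w::real. Re (A1 \<alpha> \<nu> n (complex_of_real w)))"
    by (intro continuous_intros continuous_on_compose2[OF holomorphic_on_imp_continuous_on[OF A1_holomorphic]]) auto
  thus ?thesis by (simp add: A1_of_real)
qed

lemma continuous_A2_real: "continuous_on UNIV (\<lambda>w::real. \<Sum>j. A2_coeff \<alpha> \<nu> n j * w ^ j)"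
proof -
  have "continuous_on UNIV (\<lambda>w::real. \<alpha> / 2 * Re (A2 \<alpha> \<nu> n (complex_of_real w)))"
    by (intro continuous_intros continuous_on_compose2[OF holomorphic_on_imp_continuous_on[OF A2_holomorphic]]) auto
  thus ?thesis using \<alpha> by (simp add: A2_of_real)
qed

lemma of_real_linnik_profile:
  "complex_of_real (linnik_profile \<alpha> \<nu> n r) =
     1 / complex_of_real (2 ^ n * pi powr (real n / 2) * Gamma \<nu>)
       * (complex_of_real (r powr (\<alpha> * \<nu> - real n) / 2 powr (\<alpha> * \<nu> - real n))
            * A1 \<alpha> \<nu> n (complex_of_real (r powr \<alpha>))
          + A2 \<alpha> \<nu> n (complex_of_real (r\<^sup>2)))"
  unfolding A1_of_real A2_of_real linnik_profile_def by simp

lemma continuous_linnik_profile: "continuous_on {0<..} (linnik_profile \<alpha> \<nu> n)"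
  unfolding linnik_profile_def[abs_def]
  by (intro continuous_intros continuous_on_compose2[OF continuous_A1_real] continuous_on_compose2[OF continuous_A2_real]) auto

lemma gaussian_integral_linnik_profile:
  assumes dim: "n = DIM('a::euclidean_space)" and s: "s > 0"
  shows "has_bochner_integral lborel (\<lambda>x::'a. linnik_profile \<alpha> \<nu> n (norm x) * exp (- s * (norm x)\<^sup>2))
    (unit_ball_vol n * (n / 2) * (1 / (2 ^ n * pi powr (real n / 2) * Gamma \<nu>)) *
      (2 powr (real n - \<alpha> * \<nu>) * (\<Sum>l. A1_coeff \<alpha> \<nu> n l * (Gamma (\<alpha> * (\<nu> + real l) / 2) * s powr (- (\<alpha> * (\<nu> + real l) / 2))))
       + 2 / \<alpha> * (\<Sum>j. A2_coeff \<alpha> \<nu> n j * (Gamma ((real n + 2 * real j) / 2) * s powr (- ((real n + 2 * real j) / 2))))))"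
proof -
  define F1 where "F1 = (\<lambda>x::'a. norm x powr (\<alpha> * \<nu> - real n) * (\<Sum>l. A1_coeff \<alpha> \<nu> n l * (norm x powr \<alpha>) ^ l))"
  define F2 where "F2 = (\<lambda>x::'a. \<Sum>j. A2_coeff \<alpha> \<nu> n j * ((norm x)\<^sup>2) ^ j)"
  have m1: "(\<lambda>x::'a. \<Sum>l. A1_coeff \<alpha> \<nu> n l * (norm x powr \<alpha>) ^ l) \<in> borel_measurable borel"
    by (rule measurable_compose[OF _ borel_measurable_continuous_onI[OF continuous_A1_real]]) measurable
  have F1m: "F1 \<in> borel_measurable borel"
    unfolding F1_def by (intro borel_measurable_times m1) measurable
  have F2m: "F2 \<in> borel_measurable borel"
    unfolding F2_def by (rule measurable_compose[OF _ borel_measurable_continuous_onI[OF continuous_A2_real]]) measurable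
  have e1: "A1_coeff \<alpha> \<nu> n l * norm x powr (\<alpha> * (\<nu> + real l) - real DIM('a)) =
     norm x powr (\<alpha> * \<nu> - real n) * (A1_coeff \<alpha> \<nu> n l * (norm x powr \<alpha>) ^ l)" if "x \<noteq> 0" for x :: 'a and l
  proof -
    have "norm x powr (\<alpha> * (\<nu> + real l) - real DIM('a)) = norm x powr (\<alpha> * \<nu> - real n) * norm x powr (\<alpha> * real l)"
      unfolding dim by (simp add: powr_add[symmetric] algebra_simps)
    also have "norm x powr (\<alpha> * real l) = (norm x powr \<alpha>) ^ l"
      using that by (simp add: powr_powr[symmetric] powr_realpow)
    finally show ?thesis by simp
  qed
  have e2: "A2_coeff \<alpha> \<nu> n j * norm x powr (real n + 2 * real j - real DIM('a)) = A2_coeff \<alpha> \<nu> n j * ((norm x)\<^sup>2) ^ j"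
    if "x \<noteq> 0" for x :: 'a and j
  proof -
    have "norm x powr (real n + 2 * real j - real DIM('a)) = norm x powr real (2 * j)" unfolding dim by simp
    also have "\<dots> = norm x ^ (2 * j)" using that by (intro powr_realpow) simp
    also have "\<dots> = ((norm x)\<^sup>2) ^ j" by (rule power_mult)
    finally show ?thesis by simp
  qed
  have I1: "has_bochner_integral lborel (\<lambda>x. F1 x * exp (- s * (norm x)\<^sup>2))
     (unit_ball_vol n * (n / 2) * (\<Sum>l. A1_coeff \<alpha> \<nu> n l * (Gamma (\<alpha> * (\<nu> + real l) / 2) * s powr (- (\<alpha> * (\<nu> + real l) / 2)))))"
    unfolding dim
  proof (rule has_bochner_integral_radial_series_gaussian[OF s _ _ F1m], unfold dim[symmetric])
    fix l show pos: "\<alpha> * (\<nu> + real l) > 0" using \<alpha> \<nu> by (simp add: add_pos_nonneg)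
  next
    let ?h = "\<lambda>l. \<bar>((- \<nu>) gchoose l) * Gamma ((real n / \<alpha> - \<nu> - real l) / (2 / \<alpha>))\<bar>"
    \<comment> \<open>The powers of 2 and s in the l-th Gaussian moment form \<open>?X ^ l\<close>
      up to a constant factor. Since \<open>summable_upper_Gamma\<close> allows every radius, all s
      > 0 are covered.\<close>
    let ?X = "2 powr (- \<alpha>) * s powr (- (\<alpha> / 2))"
    have "summable (\<lambda>l. Gamma \<nu> * s powr (- (\<alpha> * \<nu> / 2)) * (?h l * ?X ^ l))"
      using s by (intro summable_mult summable_upper_Gamma[OF two_div_alpha_pos n_div_alpha_pos \<nu> \<delta> sep]) simp
    also have "(\<lambda>l. Gamma \<nu> * s powr (- (\<alpha> * \<nu> / 2)) * (?h l * ?X ^ l)) =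
      (\<lambda>l. \<bar>A1_coeff \<alpha> \<nu> n l\<bar> * (Gamma (\<alpha> * (\<nu> + real l) / 2) * s powr (- (\<alpha> * (\<nu> + real l) / 2))))"
    proof
      fix l :: nat
      have G: "Gamma (\<alpha> * (\<nu> + real l) / 2) > 0" using \<alpha> \<nu> by (intro Gamma_real_pos) (simp add: add_pos_nonneg)
      have 1: "\<bar>A1_coeff \<alpha> \<nu> n l\<bar> * Gamma (\<alpha> * (\<nu> + real l) / 2) = Gamma \<nu> * ?h l / 2 powr (\<alpha> * real l)"
        using arg_cong[OF A1_coeff_Gamma[of l], of abs] G \<nu> by (simp add: abs_mult)
      have 2: "s powr (- (\<alpha> * (\<nu> + real l) / 2)) = s powr (- (\<alpha> * \<nu> / 2)) * (s powr (- (\<alpha> / 2))) ^ l"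
      proof -
        have "- (\<alpha> * (\<nu> + real l) / 2) = - (\<alpha> * \<nu> / 2) + (- (\<alpha> / 2)) * real l" by (simp add: field_simps)
        moreover have "s powr (- (\<alpha> / 2) * real l) = (s powr (- (\<alpha> / 2))) powr real l" by (rule powr_powr[symmetric])
        moreover have "\<dots> = (s powr (- (\<alpha> / 2))) ^ l" using s by (intro powr_realpow) simp
        ultimately show ?thesis by (simp only: powr_add)
      qed
      have 3: "1 / 2 powr (\<alpha> * real l) = (2 powr (- \<alpha>)) ^ l"
        by (simp add: powr_powr[symmetric] powr_realpow powr_minus field_simps)
      have "\<bar>A1_coeff \<alpha> \<nu> n l\<bar> * (Gamma (\<alpha> * (\<nu> + real l) / 2) * s powr (- (\<alpha> * (\<nu> + real l) / 2))) =
        Gamma \<nu> * ?h l * (1 / 2 powr (\<alpha> * real l)) * (s powr (- (\<alpha> * \<nu> / 2)) * (s powr (- (\<alpha> / 2))) ^ l)"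
        unfolding mult.assoc[symmetric] 1 unfolding 2 by simp
      thus "Gamma \<nu> * s powr (- (\<alpha> * \<nu> / 2)) * (?h l * ?X ^ l) = \<bar>A1_coeff \<alpha> \<nu> n l\<bar> * (Gamma (\<alpha> * (\<nu> + real l) / 2) * s powr (- (\<alpha> * (\<nu> + real l) / 2)))"
        unfolding 3 power_mult_distrib by (simp only: mult_ac)
    qed
    finally show "summable (\<lambda>l. \<bar>A1_coeff \<alpha> \<nu> n l\<bar> * (Gamma (\<alpha> * (\<nu> + real l) / 2) * s powr (- (\<alpha> * (\<nu> + real l) / 2))))" .
  next
    fix x :: 'a assume x: "x \<noteq> 0"
    show "summable (\<lambda>l. \<bar>A1_coeff \<alpha> \<nu> n l * norm x powr (\<alpha> * (\<nu> + real l) - real n)\<bar>)"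
      unfolding e1[OF x, unfolded dim[symmetric]] abs_mult[of "norm x powr _"] by (intro summable_mult summable_A1_coeff')
    show "F1 x = (\<Sum>l. A1_coeff \<alpha> \<nu> n l * norm x powr (\<alpha> * (\<nu> + real l) - real n))"
      unfolding e1[OF x, unfolded dim[symmetric]] F1_def
      by (rule suminf_mult[symmetric, OF summable_rabs_cancel[OF summable_A1_coeff']])
  qed
  have I2: "has_bochner_integral lborel (\<lambda>x. F2 x * exp (- s * (norm x)\<^sup>2))
     (unit_ball_vol n * (n / 2) * (\<Sum>j. A2_coeff \<alpha> \<nu> n j * (Gamma ((real n + 2 * real j) / 2) * s powr (- ((real n + 2 * real j) / 2)))))"
    unfolding dim
  proof (rule has_bochner_integral_radial_series_gaussian[OF s _ _ F2m], unfold dim[symmetric])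
    fix j :: nat show "real n + 2 * real j > 0" using n by simp
  next
    let ?h = "\<lambda>j. \<bar>Gamma (real n / \<alpha> + 2 / \<alpha> * real j) * Gamma (\<nu> - (real n / \<alpha> + 2 / \<alpha> * real j))\<bar> / fact j"
    have "summable (\<lambda>j. s powr (- (real n / 2)) * (?h j * (1 / (4 * s)) ^ j))"
      using s by (intro summable_mult summable_lower_Gamma[OF two_div_alpha_pos n_div_alpha_pos \<nu> \<delta> sep]) simp
    also have "(\<lambda>j. s powr (- (real n / 2)) * (?h j * (1 / (4 * s)) ^ j)) =
      (\<lambda>j. \<bar>A2_coeff \<alpha> \<nu> n j\<bar> * (Gamma ((real n + 2 * real j) / 2) * s powr (- ((real n + 2 * real j) / 2))))"
    proof
      fix j :: nat
      have G: "Gamma ((real n + 2 * real j) / 2) > 0" using n by (intro Gamma_real_pos) simp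
      have 1: "\<bar>A2_coeff \<alpha> \<nu> n j\<bar> * Gamma ((real n + 2 * real j) / 2) = ?h j / 4 ^ j"
        using arg_cong[OF A2_coeff_Gamma[of j], of abs] G by (simp add: abs_mult power_abs)
      have 2: "s powr (- ((real n + 2 * real j) / 2)) = s powr (- (real n / 2)) * (1 / s ^ j)"
      proof -
        have "- ((real n + 2 * real j) / 2) = - (real n / 2) - real j" by (simp add: field_simps)
        thus ?thesis using s by (simp only: powr_diff) (simp add: powr_realpow)
      qed
      have 3: "(1 / (4 * s)) ^ j = 1 / 4 ^ j * (1 / s ^ j)" by (simp add: power_divide power_mult_distrib)
      show "s powr (- (real n / 2)) * (?h j * (1 / (4 * s)) ^ j) = \<bar>A2_coeff \<alpha> \<nu> n j\<bar> * (Gamma ((real n + 2 * real j) / 2) * s powr (- ((real n + 2 * real j) / 2)))"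
        unfolding mult.assoc[symmetric] 1 unfolding 2 3 by (simp add: mult_ac)
    qed
    finally show "summable (\<lambda>j. \<bar>A2_coeff \<alpha> \<nu> n j\<bar> * (Gamma ((real n + 2 * real j) / 2) * s powr (- ((real n + 2 * real j) / 2))))" .
  next
    fix x :: 'a assume x: "x \<noteq> 0"
    show "summable (\<lambda>j. \<bar>A2_coeff \<alpha> \<nu> n j * norm x powr (real n + 2 * real j - real n)\<bar>)"
      unfolding e2[OF x, unfolded dim[symmetric]] by (rule summable_A2_coeff')
    show "F2 x = (\<Sum>j. A2_coeff \<alpha> \<nu> n j * norm x powr (real n + 2 * real j - real n))"
      unfolding e2[OF x, unfolded dim[symmetric]] F2_def ..
  qed
  let ?C = "1 / (2 ^ n * pi powr (real n / 2) * Gamma \<nu>)"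
  have "has_bochner_integral lborel (\<lambda>x. ?C * (2 powr (real n - \<alpha> * \<nu>) * (F1 x * exp (- s * (norm x)\<^sup>2)) + 2 / \<alpha> * (F2 x * exp (- s * (norm x)\<^sup>2))))
     (?C * (2 powr (real n - \<alpha> * \<nu>) * (unit_ball_vol n * (n / 2) * (\<Sum>l. A1_coeff \<alpha> \<nu> n l * (Gamma (\<alpha> * (\<nu> + real l) / 2) * s powr (- (\<alpha> * (\<nu> + real l) / 2)))))
       + 2 / \<alpha> * (unit_ball_vol n * (n / 2) * (\<Sum>j. A2_coeff \<alpha> \<nu> n j * (Gamma ((real n + 2 * real j) / 2) * s powr (- ((real n + 2 * real j) / 2)))))))"
    by (intro has_bochner_integral_mult_right has_bochner_integral_add I1 I2)
  moreover have "?C * (2 powr (real n - \<alpha> * \<nu>) * (F1 x * exp (- s * (norm x)\<^sup>2)) + 2 / \<alpha> * (F2 x * exp (- s * (norm x)\<^sup>2))) =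
     linnik_profile \<alpha> \<nu> n (norm x) * exp (- s * (norm x)\<^sup>2)" for x
  proof -
    have "2 powr (real n - \<alpha> * \<nu>) = 1 / 2 powr (\<alpha> * \<nu> - real n)" by (simp add: powr_diff)
    thus ?thesis unfolding linnik_profile_def F1_def F2_def by (simp add: algebra_simps)
  qed
  ultimately show ?thesis by (simp add: algebra_simps)
qed

lemma gaussian_integral_linnik_density:
  fixes p :: "'a::euclidean_space \<Rightarrow> real"
  assumes dim: "n = DIM('a)" and s: "s > 0"
    and p: "integrable lborel p"
    and char: "\<And>t. (CLINT x|lborel. iexp (x \<bullet> t) * complex_of_real (p x)) = complex_of_real ((1 + norm t powr \<alpha>) powr (- \<nu>))"
  shows "(LINT x|lborel. p x * exp (- s * (norm x)\<^sup>2)) = (LINT x|lborel. linnik_profile \<alpha> \<nu> n (norm (x::'a)) * exp (- s * (norm x)\<^sup>2))"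
proof -
  let ?c = "1 / (4 * s)"
  let ?b = "\<lambda>l. (- \<nu>) gchoose l"
  let ?G1 = "\<lambda>l. Gamma ((real n / \<alpha> - \<nu> - real l) / (2 / \<alpha>))"
  let ?G2 = "\<lambda>j. Gamma (real n / \<alpha> + 2 / \<alpha> * real j) * Gamma (\<nu> - (real n / \<alpha> + 2 / \<alpha> * real j))"
  let ?C = "1 / (2 ^ n * pi powr (real n / 2) * Gamma \<nu>)"
  let ?V = "unit_ball_vol n * (n / 2)"
  have c: "?c > 0" using s by simp
  have G: "Gamma \<nu> > 0" using \<nu> by simp
  \<comment> \<open>Of the constant on the Fourier side, \<open>n / \<alpha>\<close> is split as
    \<open>n / 2\<close> times \<open>2 / \<alpha>\<close>: the first factor joins the unit ball
    volume, as in the integral of the profile, and D collects everything else.\<close>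
  define D where "D = (4 * pi * s) powr (- (real n / 2)) * (2 / \<alpha>)"
  have D: "D = 1 / 2 ^ n * pi powr (- (real n / 2)) * s powr (- (real n / 2)) * (2 / \<alpha>)"
  proof -
    have "4 powr (- (real n / 2)) = 1 / (2::real) ^ n"
    proof -
      have "(4::real) = 2 powr 2" by simp
      hence "4 powr (- (real n / 2)) = (2 powr 2 :: real) powr (- (real n / 2))" by (simp only:)
      also have "\<dots> = 2 powr (- real n)" by (simp only: powr_powr) simp
      finally show ?thesis by (simp add: powr_minus powr_realpow field_simps)
    qed
    thus ?thesis unfolding D_def using s by (simp add: powr_mult)
  qed
  \<comment> \<open>Separates the powers of 2, which become the scalings in the coefficients, from
    the powers of s, which become those of the Gaussian moments.\<close>
  have cp: "?c powr e = 2 powr (- 2 * e) * s powr (- e)" for e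
  proof -
    have "?c = 2 powr (- 2) * s powr (- 1)" using s by (simp add: powr_minus powr_numeral field_simps)
    hence "?c powr e = (2 powr (- 2) * s powr (- 1)) powr e" by (simp only:)
    also have "\<dots> = (2 powr (- 2)) powr e * (s powr (- 1)) powr e" by (rule powr_mult)
    also have "\<dots> = 2 powr (- 2 * e) * s powr (- e)" by (simp only: powr_powr) simp
    finally show ?thesis .
  qed
  have t1: "D * (?b l * (?c powr (- (real n / \<alpha> - \<nu> - real l) / (2 / \<alpha>)) * ?G1 l / (2 / \<alpha>))) =
     ?C * 2 powr (real n - \<alpha> * \<nu>) * (A1_coeff \<alpha> \<nu> n l * (Gamma (\<alpha> * (\<nu> + real l) / 2) * s powr (- (\<alpha> * (\<nu> + real l) / 2))))" for l
  proof -
    define e where "e = (\<alpha> * (\<nu> + real l) - real n) / 2"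
    have e: "- (real n / \<alpha> - \<nu> - real l) / (2 / \<alpha>) = e" unfolding e_def using \<alpha> by (simp add: field_simps)
    have s1: "s powr (- (real n / 2)) * s powr (- e) = s powr (- (\<alpha> * (\<nu> + real l) / 2))"
      unfolding powr_add[symmetric] e_def by (rule arg_cong[where f = "\<lambda>e. s powr e"]) (simp add: field_simps)
    have s2: "2 powr (real n - \<alpha> * \<nu>) / 2 powr (\<alpha> * real l) = 2 powr (- 2 * e)"
      unfolding powr_diff[symmetric] e_def by (rule arg_cong[where f = "\<lambda>e. 2 powr e"]) (simp add: field_simps)
    have "D * (?b l * (?c powr e * ?G1 l / (2 / \<alpha>))) = 1 / 2 ^ n * pi powr (- (real n / 2)) * (?b l * ?G1 l) * 2 powr (- 2 * e) * (s powr (- (real n / 2)) * s powr (- e))"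
      unfolding D cp using \<alpha> by simp
    also have "\<dots> = 1 / 2 ^ n * pi powr (- (real n / 2)) * (?b l * ?G1 l) * (2 powr (real n - \<alpha> * \<nu>) / 2 powr (\<alpha> * real l)) * s powr (- (\<alpha> * (\<nu> + real l) / 2))"
      unfolding s1 s2 ..
    also have "\<dots> = ?C * 2 powr (real n - \<alpha> * \<nu>) * (Gamma \<nu> * (?b l * ?G1 l) / 2 powr (\<alpha> * real l)) * s powr (- (\<alpha> * (\<nu> + real l) / 2))"
      using G by (simp add: powr_minus field_simps)
    also have "\<dots> = ?C * 2 powr (real n - \<alpha> * \<nu>) * (A1_coeff \<alpha> \<nu> n l * (Gamma (\<alpha> * (\<nu> + real l) / 2) * s powr (- (\<alpha> * (\<nu> + real l) / 2))))"
      unfolding A1_coeff_Gamma[symmetric] by (simp only: mult.assoc)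
    finally show ?thesis unfolding e .
  qed
  have t2: "D * ((- ?c) ^ j / fact j * (?G2 j / Gamma \<nu>)) =
     ?C * (2 / \<alpha>) * (A2_coeff \<alpha> \<nu> n j * (Gamma ((real n + 2 * real j) / 2) * s powr (- ((real n + 2 * real j) / 2))))" for j
  proof -
    have s1: "s powr (- ((real n + 2 * real j) / 2)) = s powr (- (real n / 2)) * (1 / s ^ j)"
    proof -
      have "- ((real n + 2 * real j) / 2) = - (real n / 2) - real j" by (simp add: field_simps)
      thus ?thesis using s by (simp only: powr_diff) (simp add: powr_realpow)
    qed
    have s2: "(- ?c) ^ j = (- 1) ^ j / 4 ^ j * (1 / s ^ j)"
      unfolding power_minus[of ?c] by (simp add: power_divide power_mult_distrib)
    have "D * ((- ?c) ^ j / fact j * (?G2 j / Gamma \<nu>)) = ?C * (2 / \<alpha>) * ((- 1) ^ j / fact j * ?G2 j / 4 ^ j) * (s powr (- (real n / 2)) * (1 / s ^ j))"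
    proof -
      have alg: "(1 / x * (1 / p) * t * y) * ((m / q * z) / f * (g / G)) = 1 / (x * p * G) * y * (m / f * g / q) * (t * z)"
        for x p t y m q z f g G :: real by (simp add: mult_ac)
      show ?thesis unfolding D s2 powr_minus_divide[of pi] by (rule alg)
    qed
    also have "\<dots> = ?C * (2 / \<alpha>) * (A2_coeff \<alpha> \<nu> n j * (Gamma ((real n + 2 * real j) / 2) * s powr (- ((real n + 2 * real j) / 2))))"
      unfolding A2_coeff_Gamma[symmetric] s1[symmetric] by (simp only: mult.assoc)
    finally show ?thesis .
  qed
  let ?U1 = "\<lambda>l. ?b l * (?c powr (- (real n / \<alpha> - \<nu> - real l) / (2 / \<alpha>)) * ?G1 l / (2 / \<alpha>))"
  let ?U2 = "\<lambda>j. (- ?c) ^ j / fact j * (?G2 j / Gamma \<nu>)"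
  let ?W1 = "\<lambda>l. A1_coeff \<alpha> \<nu> n l * (Gamma (\<alpha> * (\<nu> + real l) / 2) * s powr (- (\<alpha> * (\<nu> + real l) / 2)))"
  let ?W2 = "\<lambda>j. A2_coeff \<alpha> \<nu> n j * (Gamma ((real n + 2 * real j) / 2) * s powr (- ((real n + 2 * real j) / 2)))"
  have sU1: "summable ?U1" by (rule summable_rabs_cancel[OF summable_upper_terms[OF two_div_alpha_pos n_div_alpha_pos \<nu> \<delta> sep c]])
  have sU2: "summable ?U2"
  proof -
    have "summable (\<lambda>j. 1 / Gamma \<nu> * (\<bar>?G2 j\<bar> / fact j * ?c ^ j))"
      by (intro summable_mult summable_lower_Gamma[OF two_div_alpha_pos n_div_alpha_pos \<nu> \<delta> sep c])
    also have "(\<lambda>j. 1 / Gamma \<nu> * (\<bar>?G2 j\<bar> / fact j * ?c ^ j)) = (\<lambda>j. \<bar>?U2 j\<bar>)"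
      using G s by (intro ext) (simp add: abs_mult power_abs mult_ac)
    finally show ?thesis by (rule summable_rabs_cancel)
  qed
  have E1: "D * (\<Sum>l. ?U1 l) = ?C * 2 powr (real n - \<alpha> * \<nu>) * (\<Sum>l. ?W1 l)"
  proof -
    have "summable (\<lambda>l. (?C * 2 powr (real n - \<alpha> * \<nu>)) * ?W1 l)"
      unfolding t1[symmetric] by (intro summable_mult sU1)
    hence W: "summable ?W1" by (rule summable_mult_D) (use G \<alpha> in simp)
    have "D * (\<Sum>l. ?U1 l) = (\<Sum>l. D * ?U1 l)" by (rule suminf_mult[OF sU1, symmetric])
    also have "\<dots> = (\<Sum>l. (?C * 2 powr (real n - \<alpha> * \<nu>)) * ?W1 l)" unfolding t1 ..
    also have "\<dots> = ?C * 2 powr (real n - \<alpha> * \<nu>) * (\<Sum>l. ?W1 l)" by (rule suminf_mult[OF W])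
    finally show ?thesis .
  qed
  have E2: "D * (\<Sum>j. ?U2 j) = ?C * (2 / \<alpha>) * (\<Sum>j. ?W2 j)"
  proof -
    have "summable (\<lambda>j. (?C * (2 / \<alpha>)) * ?W2 j)"
      unfolding t2[symmetric] by (intro summable_mult sU2)
    hence W: "summable ?W2" by (rule summable_mult_D) (use G \<alpha> in simp)
    have "D * (\<Sum>j. ?U2 j) = (\<Sum>j. D * ?U2 j)" by (rule suminf_mult[OF sU2, symmetric])
    also have "\<dots> = (\<Sum>j. (?C * (2 / \<alpha>)) * ?W2 j)" unfolding t2 ..
    also have "\<dots> = ?C * (2 / \<alpha>) * (\<Sum>j. ?W2 j)" by (rule suminf_mult[OF W])
    finally show ?thesis .
  qed
  have J: "(LINT v|lborel. indicator {0<..} v * ((1 + v) powr (- \<nu>) * exp (- ?c * v powr (2 / \<alpha>)) * v powr (real n / \<alpha> - 1))) = (\<Sum>l. ?U1 l) + (\<Sum>j. ?U2 j)"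
    by (rule integral_one_plus_powr_exp[OF two_div_alpha_pos n_div_alpha_pos \<nu> \<delta> sep c])
  have "(LINT x|lborel. p x * exp (- s * (norm x)\<^sup>2)) =
     (4 * pi * s) powr (- (real n / 2)) * ((4 * pi * s) powr (real n / 2) * (LINT x|lborel. p x * exp (- s * (norm x)\<^sup>2)))"
    using s by (simp add: mult.assoc[symmetric] powr_add[symmetric])
  also have "\<dots> = (4 * pi * s) powr (- (real n / 2)) * (unit_ball_vol n * (n / \<alpha>) * ((\<Sum>l. ?U1 l) + (\<Sum>j. ?U2 j)))"
    using gaussian_integral_of_char[OF p s \<alpha> char] unfolding dim[symmetric] J by simp
  also have "\<dots> = ?V * (D * (\<Sum>l. ?U1 l) + D * (\<Sum>j. ?U2 j))"
    unfolding D_def by (simp add: algebra_simps)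
  also have "\<dots> = ?V * ?C * (2 powr (real n - \<alpha> * \<nu>) * (\<Sum>l. ?W1 l) + 2 / \<alpha> * (\<Sum>j. ?W2 j))"
    unfolding E1 E2 by (simp only: distrib_left mult.assoc)
  also have "\<dots> = (LINT x|lborel. linnik_profile \<alpha> \<nu> n (norm (x::'a)) * exp (- s * (norm x)\<^sup>2))"
    using gaussian_integral_linnik_profile[OF dim s] by (simp only: has_bochner_integral_iff)
  finally show ?thesis .
qed

end

section \<open>Identification of the density\<close>

lemma linnik_density_integrable:
  assumes "linnik_density \<alpha> \<nu> p"
  shows "integrable lborel p"
proof -
  have [measurable]: "p \<in> borel_measurable borel" and nn: "\<And>x. 0 \<le> p x"
    and ps: "prob_space (density lborel (\<lambda>x. ennreal (p x)))"
    using assms by (auto simp: linnik_density_def)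
  from prob_space.emeasure_space_1[OF ps] have "(\<integral>\<^sup>+x. ennreal (p x) \<partial>lborel) = 1"
    by (simp add: emeasure_density)
  thus ?thesis by (intro integrableI_nonneg) (auto simp: nn)
qed

lemma linnik_density_radial:
  fixes p :: "real ^ 'n \<Rightarrow> real"
  assumes p: "linnik_density \<alpha> \<nu> p" and \<alpha>: "\<alpha> > 0" and \<nu>: "\<nu> > 0" and x: "x \<noteq> 0" and norm: "norm x = norm y"
  shows "p x = p y"
proof (rule radial_if_char_radial[OF linnik_density_integrable[OF p] _ continuous_on_char_profile[OF \<alpha> \<nu>] _ _ norm])
  have "continuous_on (- {0}) p" using p by (simp add: linnik_density_def)
  moreover have "y \<noteq> 0" using x norm by auto
  ultimately show "isCont p x" "isCont p y"
    using x by (auto simp: continuous_on_eq_continuous_at open_Compl)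
  fix t :: "real ^ 'n"
  have "(norm t)\<^sup>2 powr (\<alpha> / 2) = norm t powr \<alpha>"
    by (cases "t = 0") (auto simp: powr_powr powr_numeral[symmetric] simp del: powr_numeral)
  thus "(CLINT x|lborel. iexp (x \<bullet> t) * complex_of_real (p x)) =
    complex_of_real (if exp (- (norm t)\<^sup>2) = 0 then 0 else (1 + (- ln (exp (- (norm t)\<^sup>2))) powr (\<alpha> / 2)) powr (- \<nu>))"
    using p by (simp add: linnik_density_def)
qed

lemma linnik_density_eq_profile:
  fixes p :: "real ^ 'n \<Rightarrow> real"
  assumes p: "linnik_density \<alpha> \<nu> p" and \<alpha>: "\<alpha> > 0" and \<nu>: "\<nu> > 0" and \<delta>: "\<delta> > 0"
    and sep: "\<And>(l::nat) (j::nat). \<bar>real CARD('n) / \<alpha> - \<nu> - real l + 2 / \<alpha> * real j\<bar> \<ge> \<delta>"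
    and x: "x \<noteq> 0"
  shows "p x = linnik_profile \<alpha> \<nu> CARD('n) (norm x)"
proof -
  let ?Q = "linnik_profile \<alpha> \<nu> CARD('n)"
  have n: "CARD('n) > 0" by simp
  have dim: "CARD('n) = DIM(real ^ 'n)" by simp
  note int = linnik_density_integrable[OF p]
  have [measurable]: "p \<in> borel_measurable borel" and char: "\<And>t. (CLINT x|lborel. iexp (x \<bullet> t) * complex_of_real (p x)) = complex_of_real ((1 + norm t powr \<alpha>) powr (- \<nu>))"
    and cont: "continuous_on (- {0}) p"
    using p by (auto simp: linnik_density_def)
  have Q: "integrable lborel (\<lambda>x::real^'n. ?Q (norm x) * exp (- s * (norm x)\<^sup>2))" if "s > 0" for s
    using gaussian_integral_linnik_profile[OF \<alpha> \<nu> n \<delta> sep dim that] by (simp only: has_bochner_integral_iff)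
  have P: "integrable lborel (\<lambda>x. p x * exp (- s * (norm x)\<^sup>2))" if "s > 0" for s
  proof (rule Bochner_Integration.integrable_bound[OF int])
    have "exp (- s * (norm x)\<^sup>2) \<le> 1" for x :: "real ^ 'n" using that by simp
    thus "AE x in lborel. norm (p x * exp (- s * (norm x)\<^sup>2)) \<le> norm (p x)"
      by (auto simp: abs_mult intro!: mult_left_le)
  qed measurable
  have "p x - ?Q (norm x) = 0"
  \<comment> \<open>A base parameter s = 1 supplies the weight that makes the profile integrable
    without knowledge of its decay; the moments then use the parameters 1 + k.\<close>
  proof (rule radial_eq_0_if_gaussian_moments_0[where s = 1 and f = "\<lambda>x. p x - ?Q (norm x)"])
    show "integrable lborel (\<lambda>x. (p x - ?Q (norm x)) * exp (- 1 * (norm x)\<^sup>2))"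
      unfolding left_diff_distrib by (intro Bochner_Integration.integrable_diff P Q) auto
    show "(LINT x|lborel. (p x - ?Q (norm x)) * exp (- (1 + real k) * (norm x)\<^sup>2)) = 0" for k
    proof -
      have k: "1 + real k > 0" by simp
      show ?thesis
        unfolding left_diff_distrib[of "p _"] Bochner_Integration.integral_diff[OF P[OF k] Q[OF k]]
          gaussian_integral_linnik_density[OF \<alpha> \<nu> n \<delta> sep dim k int char] by simp
    qed
    show "continuous_on (- {0}) (\<lambda>x. p x - ?Q (norm x))"
      by (intro continuous_intros cont continuous_on_compose2[OF continuous_linnik_profile[OF \<alpha> \<nu> n \<delta> sep]]) auto
    show "p x - ?Q (norm x) = p y - ?Q (norm y)" if "x \<noteq> 0" "norm x = norm y" for x y
      using linnik_density_radial[OF p \<alpha> \<nu> that] that by simp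
  qed (rule x)
  thus ?thesis by simp
qed

theorem proposition4p4:
  fixes p :: "real ^ 'n \<Rightarrow> real" and \<alpha> \<nu> :: real and a b n :: nat
  assumes "n = CARD('n)"
    and "a \<ge> 1" and "b \<ge> 1" and "coprime a b"
    and "\<alpha> = real a / real b" and "0 < \<alpha>" and "\<alpha> < 2"
    and "\<nu> > 0" and "\<nu> \<notin> \<rat>"
    and "linnik_density \<alpha> \<nu> p"
  shows "(\<forall>z. summable (\<lambda>l. norm (A1_term \<alpha> \<nu> n z l))) \<and>
         (\<forall>z. summable (\<lambda>j. norm (A2_term \<alpha> \<nu> n z j))) \<and>
         A1 \<alpha> \<nu> n holomorphic_on UNIV \<and>
         A2 \<alpha> \<nu> n holomorphic_on UNIV \<and>
         (\<forall>x y. x \<noteq> 0 \<and> norm x = norm y \<longrightarrow> p x = p y) \<and>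
         (\<forall>r>0. complex_of_real (radial_value p r) =
           1 / complex_of_real (2 ^ n * pi powr (real n / 2) * Gamma \<nu>)
           * (complex_of_real (r powr (\<alpha> * \<nu> - real n) / 2 powr (\<alpha> * \<nu> - real n))
                * A1 \<alpha> \<nu> n (complex_of_real (r powr \<alpha>))
              + A2 \<alpha> \<nu> n (complex_of_real (r\<^sup>2))))"
proof -
  have n: "n > 0" using assms(1) by simp
  obtain \<delta> where \<delta>: "\<delta> > 0" and sep: "\<And>(l::nat) (j::nat). \<bar>real n / \<alpha> - \<nu> - real l + 2 / \<alpha> * real j\<bar> \<ge> \<delta>"
    using rational_exponent_separation[of a \<nu> b n] assms by metis
  note ctx = \<open>0 < \<alpha>\<close> \<open>\<nu> > 0\<close> n \<delta> sep
  have val: "radial_value p r = linnik_profile \<alpha> \<nu> n r" if r: "r > 0" for r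
  proof -
    have "p ` {x. norm x = r} = {linnik_profile \<alpha> \<nu> n r}"
    proof (intro equalityI subsetI)
      fix v assume "v \<in> p ` {x. norm x = r}"
      then obtain x where x: "norm x = r" "v = p x" by auto
      hence "x \<noteq> 0" using r by auto
      with linnik_density_eq_profile[OF assms(10,6,8) \<delta> sep[unfolded assms(1)]] x assms(1)
      show "v \<in> {linnik_profile \<alpha> \<nu> n r}" by simp
    next
      fix v assume "v \<in> {linnik_profile \<alpha> \<nu> n r}"
      \<comment> \<open>The sphere has to be nonempty for its image to be a singleton rather than
        the empty set, so that the definite description in \<open>radial_value\<close> is
        determined.\<close>
      obtain x :: "real ^ 'n" where x: "norm x = r" using vector_choose_size[of r] r by auto
      hence "x \<noteq> 0" using r by auto
      with linnik_density_eq_profile[OF assms(10,6,8) \<delta> sep[unfolded assms(1)]] x assms(1) \<open>v \<in> _\<close>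
      show "v \<in> p ` {x. norm x = r}" by force
    qed
    thus ?thesis unfolding radial_value_def by simp
  qed
  show ?thesis
  proof (intro conjI allI impI)
    show "p x = p y" if "x \<noteq> 0 \<and> norm x = norm y" for x y
      using linnik_density_radial[OF assms(10,6,8)] that by blast
  next
    fix r :: real assume "r > 0"
    show "complex_of_real (radial_value p r) =
           1 / complex_of_real (2 ^ n * pi powr (real n / 2) * Gamma \<nu>)
           * (complex_of_real (r powr (\<alpha> * \<nu> - real n) / 2 powr (\<alpha> * \<nu> - real n))
                * A1 \<alpha> \<nu> n (complex_of_real (r powr \<alpha>))
              + A2 \<alpha> \<nu> n (complex_of_real (r\<^sup>2)))"
      unfolding val[OF \<open>r > 0\<close>] by (rule of_real_linnik_profile[OF ctx])
  qed (rule summable_norm_A1_term[OF ctx] summable_norm_A2_term[OF ctx] A1_holomorphic[OF ctx] A2_holomorphic[OF ctx])+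
qed

end
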